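(* Let $m\ge 3$. The following three families are in bijection: (1) enriched $m$-bipartite trees; (2) $m$-bipartite trees endowed with a forward matching; (3) rooted $m$-regular bipartite maps (of arbitrary, unfixed genus). The bijections can be chosen such that the number of black nodes in families (1) and (2) is preserved and corresponds to the number of black vertices in family (3). The three families are enumerated by the series $r_1(g)$, where $g$ is conjugate to the number of black nodes (resp. black vertices).
   Context: Maps. A map is a cellular embedding of a connected graph (multiple edges allowed) in a closed oriented surface of arbitrary genus, up to orientation-preserving homeomorphism. An $m$-regular bipartite map is a map whose vertices all have degree $m$ and are colored black or white so that adjacent vertices have different colors. It is rooted if a corner at a white vertex is marked. By convention the family of rooted $m$-regular bipartite maps also contains one trivial object with no vertex (contributing $1$ to the counting series). Blossoming trees. Trees are plane trees; vertices of degree 1 are leaves, the others are nodes. A rooted tree is a plane tree with a marked leaf (the root leaf); it is nodeless if it has a single edge (joining two leaves), otherwise the node adjacent to the root leaf is the root node. A blossoming tree is a rooted tree whose leaves are of two kinds, opening and closing, with as many opening as closing leaves, the root leaf being opening. Leaves are ordered according to a clockwise walk around the tree (outer face on the left) starting with the root leaf. The leaf-path is the path starting at height $1$ obtained by reading the non-root leaves in this order, with an up-step for each opening leaf and a down-step for each closing leaf (it ends at height $0$). A closing leaf has height $h$ if its down-step goes from $h$ to $h-1$. The tree is balanced if all closing leaves have height $\ge1$. An $m$-bipartite tree is a blossoming tree that is either nodeless, or has its nodes colored black or white with no edge joining two nodes of the same color, all nodes of degree $m$, the root node white, all opening (resp. closing) leaves adjacent to white (resp. black) nodes, and every white node having exactly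 one child that is a black node, its other $m-2$ children being opening leaves. An enriched $m$-bipartite tree is a balanced $m$-bipartite tree in which each closing leaf of height $h$ carries an integer in $\{0,\dots,h-1\}$. A forward matching is a perfect matching of the opening leaves (including the root leaf) with the closing leaves such that in each pair the opening leaf appears before the closing leaf in the clockwise walk around the tree (outer face on the left) starting with the root leaf. Series. The formal power series $r_i(g),q_i(g)$, $i\ge1$, are uniquely determined by $$r_i(g)=i+\sum_{a=0}^{m-2}q_{i-a}(g),\qquad q_i(g)=g\prod_{a=0}^{m-2}r_{i+a}(g),\qquad i\ge 1,$$ with the convention $q_j(g)=0$ for $j\le0$; in particular $r_1(g)=1+q_1(g)$. *)

theory Defs
  imports
    "HOL-Combinatorics.Combinatorics"
    "HOL-Library.FuncSet"
    "HOL-Computational_Algebra.Formal_Power_Series"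
begin

section \<open>Blossoming trees\<close>

datatype leaf = Opening | Closing

datatype color = Black | White

text \<open>
  A term of type \<open>tree\<close> stands for the plane tree obtained from it by attaching the root leaf,
  which is opening, at the top; the root leaf itself is not part of the term.  Thus the nodeless
  tree is a \<open>Leaf\<close>, and a node with list of children \<open>ts\<close> has degree \<open>length ts + 1\<close>.
  Children are listed in the order in which the clockwise walk visits them.
\<close>

datatype tree = Leaf leaf | Node color "tree list"

fun subtrees :: "tree \<Rightarrow> tree set" where
  "subtrees (Leaf l) = {Leaf l}"
| "subtrees (Node c ts) = insert (Node c ts) (\<Union>t\<in>set ts. subtrees t)"

fun black_nodes :: "tree \<Rightarrow> nat" where
  "black_nodes (Leaf l) = 0"
| "black_nodes (Node c ts) = (if c = Black then 1 else 0) + sum_list (map black_nodes ts)"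

fun nonroot_leaves :: "tree \<Rightarrow> leaf list" where
  "nonroot_leaves (Leaf l) = [l]"
| "nonroot_leaves (Node c ts) = concat (map nonroot_leaves ts)"

definition leaves :: "tree \<Rightarrow> leaf list" where
  "leaves t = Opening # nonroot_leaves t"

text \<open>Leaves are referred to by their position in \<open>leaves\<close>; the root leaf has position 0.\<close>

definition openings :: "tree \<Rightarrow> nat set" where
  "openings t = {p. p < length (leaves t) \<and> leaves t ! p = Opening}"

definition closings :: "tree \<Rightarrow> nat set" where
  "closings t = {p. p < length (leaves t) \<and> leaves t ! p = Closing}"

text \<open>
  The height of the leaf-path just before its step for the leaf at position \<open>p \<ge> 1\<close>.  The
  root leaf has no step in the leaf-path; being counted here as an opening leaf, it provides
  the starting height 1.
\<close>

definition height :: "tree \<Rightarrow> nat \<Rightarrow> int" where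
  "height t p = int (count_list (take p (leaves t)) Opening)
              - int (count_list (take p (leaves t)) Closing)"

text \<open>The first conjunct says that no node has degree 1.\<close>

definition blossoming :: "tree \<Rightarrow> bool" where
  "blossoming t \<longleftrightarrow> (\<forall>c ts. Node c ts \<in> subtrees t \<longrightarrow> ts \<noteq> []) \<and>
     card (openings t) = card (closings t)"

definition balanced :: "tree \<Rightarrow> bool" where
  "balanced t \<longleftrightarrow> (\<forall>p\<in>closings t. height t p \<ge> 1)"

text \<open>\<open>child_ok c s\<close>: a node of color \<open>c\<close> may have \<open>s\<close> as a child.\<close>

fun child_ok :: "color \<Rightarrow> tree \<Rightarrow> bool" where
  "child_ok c (Leaf Opening) \<longleftrightarrow> c = White"
| "child_ok c (Leaf Closing) \<longleftrightarrow> c = Black"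
| "child_ok c (Node c' ts) \<longleftrightarrow> c' \<noteq> c"

fun is_black_node :: "tree \<Rightarrow> bool" where
  "is_black_node (Leaf l) \<longleftrightarrow> False"
| "is_black_node (Node c ts) \<longleftrightarrow> c = Black"

definition m_bipartite :: "nat \<Rightarrow> tree \<Rightarrow> bool" where
  "m_bipartite m t \<longleftrightarrow> blossoming t \<and>
     ((\<exists>l. t = Leaf l) \<or>
      (\<exists>ts. t = Node White ts) \<and>
      (\<forall>c ts. Node c ts \<in> subtrees t \<longrightarrow>
         length ts + 1 = m \<and>
         (\<forall>s\<in>set ts. child_ok c s) \<and>
         (c = White \<longrightarrow>
            length (filter is_black_node ts) = 1 \<and>
            length (filter (\<lambda>s. s = Leaf Opening) ts) = m - 2)))"

definition enriched_trees :: "nat \<Rightarrow> (tree \<times> (nat \<Rightarrow> int)) set" where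
  "enriched_trees m = {(t, w). m_bipartite m t \<and> balanced t \<and>
     w \<in> (\<Pi>\<^sub>E p\<in>closings t. {0..height t p - 1})}"

definition forward_matching :: "tree \<Rightarrow> (nat \<times> nat) set \<Rightarrow> bool" where
  "forward_matching t M \<longleftrightarrow>
     M \<subseteq> openings t \<times> closings t \<and>
     (\<forall>p\<in>openings t. \<exists>!c. (p, c) \<in> M) \<and>
     (\<forall>c\<in>closings t. \<exists>!p. (p, c) \<in> M) \<and>
     (\<forall>(p, c)\<in>M. p < c)"

definition matched_trees :: "nat \<Rightarrow> (tree \<times> (nat \<times> nat) set) set" where
  "matched_trees m = {(t, M). m_bipartite m t \<and> forward_matching t M}"


section \<open>Maps\<close>

text \<open>
  Maps on closed oriented surfaces are encoded by their rotation systems: \<open>darts\<close> are the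
  half-edges, \<open>rot\<close> sends a half-edge to the next one around its vertex, and \<open>opp\<close> exchanges the
  two halves of each edge.  A connected map with at least one edge is, up to
  orientation-preserving homeomorphism, the same as such a transitive system up to relabelling
  of the darts, so darts may be taken to be natural numbers.  The field \<open>whites\<close> is the set of
  white vertices.  A corner is identified with the half-edge that follows it around its vertex,
  so a marked corner is given by a dart, \<open>root_dart\<close>.
\<close>

record rmap =
  darts :: "nat set"
  rot :: "nat \<Rightarrow> nat"
  opp :: "nat \<Rightarrow> nat"
  whites :: "nat set set"
  root_dart :: nat

definition vertex_of :: "rmap \<Rightarrow> nat \<Rightarrow> nat set" where
  "vertex_of M d = orbit (rot M) d"

definition vertices :: "rmap \<Rightarrow> nat set set" where
  "vertices M = vertex_of M ` darts M"

definition is_map :: "rmap \<Rightarrow> bool" where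
  "is_map M \<longleftrightarrow> finite (darts M) \<and> rot M permutes darts M \<and> opp M permutes darts M \<and>
     (\<forall>d\<in>darts M. opp M d \<noteq> d \<and> opp M (opp M d) = d) \<and>
     (\<forall>d\<in>darts M. \<forall>e\<in>darts M. (d, e) \<in> {(x, y). y = rot M x \<or> y = opp M x}\<^sup>*)"

definition bipartite_coloring :: "rmap \<Rightarrow> bool" where
  "bipartite_coloring M \<longleftrightarrow> whites M \<subseteq> vertices M \<and>
     (\<forall>d\<in>darts M. vertex_of M d \<in> whites M \<longleftrightarrow> vertex_of M (opp M d) \<notin> whites M)"

definition rooted_mbip :: "nat \<Rightarrow> rmap set" where
  "rooted_mbip m = {M. is_map M \<and> bipartite_coloring M \<and> (\<forall>v\<in>vertices M. card v = m) \<and>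
     root_dart M \<in> darts M \<and> vertex_of M (root_dart M) \<in> whites M}"

definition is_iso :: "(nat \<Rightarrow> nat) \<Rightarrow> rmap \<Rightarrow> rmap \<Rightarrow> bool" where
  "is_iso \<phi> M N \<longleftrightarrow> bij_betw \<phi> (darts M) (darts N) \<and>
     (\<forall>d\<in>darts M. \<phi> (rot M d) = rot N (\<phi> d) \<and> \<phi> (opp M d) = opp N (\<phi> d)) \<and>
     image \<phi> ` whites M = whites N \<and> \<phi> (root_dart M) = root_dart N"

definition map_iso :: "nat \<Rightarrow> (rmap \<times> rmap) set" where
  "map_iso m = {(M, N). M \<in> rooted_mbip m \<and> N \<in> rooted_mbip m \<and> (\<exists>\<phi>. is_iso \<phi> M N)}"

text \<open>\<open>None\<close> is the trivial object without vertices.\<close>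

definition rooted_maps :: "nat \<Rightarrow> rmap set option set" where
  "rooted_maps m = insert None (Some ` (rooted_mbip m // map_iso m))"

definition num_blacks :: "rmap \<Rightarrow> nat" where
  "num_blacks M = card (vertices M - whites M)"

fun black_vertices :: "rmap set option \<Rightarrow> nat" where
  "black_vertices None = 0"
| "black_vertices (Some C) = the_elem (num_blacks ` C)"

lemma rooted_mbipD:
  assumes "M \<in> rooted_mbip m"
  shows "rot M permutes darts M" "opp M permutes darts M" "root_dart M \<in> darts M"
    "whites M \<subseteq> vertices M"
  using assms unfolding rooted_mbip_def is_map_def bipartite_coloring_def by simp_all

lemma vertices_subset:
  assumes "M \<in> rooted_mbip m" and "v \<in> vertices M"
  shows "v \<subseteq> darts M"
proof -
  obtain d where "d \<in> darts M" "v = orbit (rot M) d"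
    using assms(2) unfolding vertices_def vertex_of_def by blast
  then show ?thesis
    using rooted_mbipD(1)[OF assms(1)] permutes_orbit_subset by metis
qed

lemma is_iso_inv:
  assumes "M \<in> rooted_mbip m" and iso: "is_iso \<phi> M N"
  shows "is_iso (inv_into (darts M) \<phi>) N M"
proof -
  define \<psi> where "\<psi> = inv_into (darts M) \<phi>"
  have b: "bij_betw \<phi> (darts M) (darts N)"
    and h: "\<And>d. d \<in> darts M \<Longrightarrow> rot N (\<phi> d) = \<phi> (rot M d)"
           "\<And>d. d \<in> darts M \<Longrightarrow> opp N (\<phi> d) = \<phi> (opp M d)"
    and w: "whites N = image \<phi> ` whites M" and r: "root_dart N = \<phi> (root_dart M)"
    using iso unfolding is_iso_def by simp_all
  have inv: "\<psi> (\<phi> d) = d" if "d \<in> darts M" for d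
    using b that unfolding \<psi>_def by (rule bij_betw_inv_into_left)
  have closed: "rot M d \<in> darts M" "opp M d \<in> darts M" if "d \<in> darts M" for d
    using rooted_mbipD(1,2)[OF assms(1)] that by (simp_all add: permutes_in_image)
  have "\<psi> ` \<phi> ` v = v" if "v \<in> whites M" for v
  proof -
    have "v \<subseteq> darts M"
      using rooted_mbipD(4)[OF assms(1)] vertices_subset[OF assms(1)] that by blast
    then have "\<psi> ` \<phi> ` v = id ` v"
      unfolding image_image by (intro image_cong) (auto simp: inv)
    then show ?thesis by simp
  qed
  then have "image \<psi> ` whites N = whites M"
    by (simp add: w image_image)
  moreover have "bij_betw \<psi> (darts N) (darts M)"
    unfolding \<psi>_def by (rule bij_betw_inv_into[OF b])
  moreover have "\<psi> (rot N d) = rot M (\<psi> d) \<and> \<psi> (opp N d) = opp M (\<psi> d)" if d: "d \<in> darts N" for d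
  proof -
    obtain e where "e \<in> darts M" "d = \<phi> e"
      using d bij_betw_imp_surj_on[OF b] by blast
    then show ?thesis by (simp add: h inv closed)
  qed
  moreover have "\<psi> (root_dart N) = root_dart M"
    using rooted_mbipD(3)[OF assms(1)] by (simp add: r inv)
  ultimately show ?thesis
    unfolding is_iso_def \<psi>_def[symmetric] by blast
qed

lemma is_iso_comp:
  assumes "is_iso \<phi> M N" and "is_iso \<psi> N L"
  shows "is_iso (\<psi> \<circ> \<phi>) M L"
proof -
  have "bij_betw (\<psi> \<circ> \<phi>) (darts M) (darts L)"
    using assms unfolding is_iso_def by (intro bij_betw_trans[of \<phi> _ "darts N"]) simp_all
  moreover have "\<phi> d \<in> darts N" if "d \<in> darts M" for d
    using assms(1) that unfolding is_iso_def by (metis bij_betwE)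
  moreover have "image (\<psi> \<circ> \<phi>) ` whites M = image \<psi> ` (image \<phi> ` whites M)"
    by (simp add: image_image o_def)
  ultimately show ?thesis
    using assms unfolding is_iso_def by (metis comp_apply)
qed

lemma equiv_map_iso: "equiv (rooted_mbip m) (map_iso m)"
proof (rule equivI)
  show "map_iso m \<subseteq> rooted_mbip m \<times> rooted_mbip m"
    unfolding map_iso_def by blast
  have "is_iso id M M" for M
    by (simp add: is_iso_def)
  then show "refl_on (rooted_mbip m) (map_iso m)"
    unfolding refl_on_def map_iso_def by blast
  show "sym (map_iso m)"
    unfolding sym_def map_iso_def using is_iso_inv by blast
  show "trans (map_iso m)"
    unfolding trans_def map_iso_def using is_iso_comp by blast
qed

lemma num_blacks_iso:
  assumes "(M, N) \<in> map_iso m"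
  shows "num_blacks M = num_blacks N"
proof -
  obtain \<phi> where M: "M \<in> rooted_mbip m" and iso: "is_iso \<phi> M N"
    using assms unfolding map_iso_def by blast
  have b: "bij_betw \<phi> (darts M) (darts N)"
    and h: "\<And>d. d \<in> darts M \<Longrightarrow> rot N (\<phi> d) = \<phi> (rot M d)"
    and w: "whites N = image \<phi> ` whites M"
    using iso unfolding is_iso_def by simp_all
  have orb: "\<phi> ` orbit (rot M) d = orbit (rot N) (\<phi> d)" if d: "d \<in> darts M" for d
  proof -
    have sub: "x \<in> darts M" if "x \<in> orbit (rot M) d" for x
      using permutes_orbit_subset[OF rooted_mbipD(1)[OF M] d] that by blast
    have "\<phi> x \<in> orbit (rot N) (\<phi> d)" if "x \<in> orbit (rot M) d" for x
      using that
    proof induction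
      case base
      then show ?case by (metis h[OF d] orbit.base)
    next
      case (step x)
      then show ?case by (metis h[OF sub] orbit.step)
    qed
    moreover have "y \<in> \<phi> ` orbit (rot M) d" if "y \<in> orbit (rot N) (\<phi> d)" for y
      using that
    proof induction
      case base
      then show ?case by (metis h[OF d] imageI orbit.base)
    next
      case (step y)
      then obtain x where x: "x \<in> orbit (rot M) d" "y = \<phi> x" by blast
      then show ?case by (metis h[OF sub] imageI orbit.step)
    qed
    ultimately show ?thesis by blast
  qed
  have "image \<phi> ` vertices M = (\<lambda>d. orbit (rot N) (\<phi> d)) ` darts M"
    unfolding vertices_def vertex_of_def image_image by (rule image_cong) (simp_all add: orb)
  also have "\<dots> = orbit (rot N) ` (\<phi> ` darts M)"
    by (simp add: image_image)
  also have "\<dots> = vertices N"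
    using b unfolding vertices_def vertex_of_def bij_betw_def by simp
  finally have V: "image \<phi> ` vertices M = vertices N" .
  have "inj_on (image \<phi>) (Pow (darts M))"
    using b by (intro inj_on_image_Pow) (simp add: bij_betw_def)
  then have inj: "inj_on (image \<phi>) (vertices M)"
    by (rule inj_on_subset) (use vertices_subset[OF M] in blast)
  have "image \<phi> ` (vertices M - whites M) = vertices N - whites N"
    using inj_on_image_set_diff[OF inj Diff_subset rooted_mbipD(4)[OF M]] V w by simp
  moreover have "inj_on (image \<phi>) (vertices M - whites M)"
    using inj by (rule inj_on_subset) blast
  ultimately show ?thesis
    unfolding num_blacks_def by (metis card_image)
qed

lemma black_vertices_class:
  assumes "C \<in> rooted_mbip m // map_iso m" and "M \<in> C"
  shows "black_vertices (Some C) = num_blacks M"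
proof -
  have "num_blacks N = num_blacks M" if "N \<in> C" for N
    using quotient_eq_iff[OF equiv_map_iso assms(1) assms(1) that assms(2)] num_blacks_iso
    by blast
  then have "num_blacks ` C = {num_blacks M}"
    using assms(2) by blast
  then show ?thesis by simp
qed


section \<open>The generating series\<close>

text \<open>\<open>series_system\<close> leaves \<open>r i\<close> unconstrained for \<open>i \<le> 0\<close>; all else is determined by it.\<close>

definition series_system :: "nat \<Rightarrow> (int \<Rightarrow> int fps) \<Rightarrow> (int \<Rightarrow> int fps) \<Rightarrow> bool" where
  "series_system m r q \<longleftrightarrow>
     (\<forall>i\<ge>1. r i = of_int i + (\<Sum>a=0..m-2. q (i - int a))) \<and>
     (\<forall>i\<ge>1. q i = fps_X * (\<Prod>a=0..m-2. r (i + int a))) \<and>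
     (\<forall>j\<le>0. q j = 0)"

context
  includes fps_syntax
begin

lemma fps_mult_agree:
  fixes f g f' g' :: "int fps"
  assumes "\<And>k. k < n \<Longrightarrow> f $ k = f' $ k" and "\<And>k. k < n \<Longrightarrow> g $ k = g' $ k" and "k < n"
  shows "(f * g) $ k = (f' * g') $ k"
  unfolding fps_mult_nth using assms by (intro sum.cong) auto

lemma fps_prod_agree:
  fixes f g :: "nat \<Rightarrow> int fps"
  assumes "finite A" and "\<And>a k. a \<in> A \<Longrightarrow> k < n \<Longrightarrow> f a $ k = g a $ k" and "k < n"
  shows "prod f A $ k = prod g A $ k"
  using assms
proof (induction A arbitrary: k rule: finite_induct)
  case (insert x A)
  have "(f x * prod f A) $ k = (g x * prod g A) $ k"
    by (rule fps_mult_agree[of n]) (use insert in auto)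
  then show ?case using insert by simp
qed simp

lemma series_system_unique:
  assumes "series_system m r q" and "series_system m r' q'"
  shows "q i = q' i" and "i \<ge> 1 \<Longrightarrow> r i = r' i"
proof -
  have r: "r i = of_int i + (\<Sum>a=0..m-2. q (i - int a))"
    "r' i = of_int i + (\<Sum>a=0..m-2. q' (i - int a))" if "i \<ge> 1" for i
    using assms that by (auto simp: series_system_def)
  have *: "\<forall>i. \<forall>k<n. q i $ k = q' i $ k" for n
  proof (induction n)
    case (Suc n)
    show ?case
    proof (intro allI impI)
      fix i k assume k: "k < Suc n"
      show "q i $ k = q' i $ k"
      proof (cases "i \<ge> 1")
        case False
        then show ?thesis using assms by (simp add: series_system_def)
      next
        case True
        have "r (i + int a) $ l = r' (i + int a) $ l" if "l < n" for a l
          using Suc that True by (simp add: r fps_sum_nth)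
        then have "(\<Prod>a=0..m-2. r (i + int a)) $ l = (\<Prod>a=0..m-2. r' (i + int a)) $ l"
          if "l < n" for l
          using that by (intro fps_prod_agree[of _ n]) auto
        moreover have "q i = fps_X * (\<Prod>a=0..m-2. r (i + int a))"
          "q' i = fps_X * (\<Prod>a=0..m-2. r' (i + int a))"
          using assms True by (auto simp: series_system_def)
        ultimately show ?thesis using k by auto
      qed
    qed
  qed simp
  show q: "q i = q' i" for i
    using * by (intro fps_ext) blast
  show "r i = r' i" if "i \<ge> 1"
    using that by (simp add: r q)
qed

definition r_from_q :: "nat \<Rightarrow> (int \<Rightarrow> int fps) \<Rightarrow> int \<Rightarrow> int fps" where
  "r_from_q m q i = of_int i + (\<Sum>a=0..m-2. q (i - int a))"

fun q_approx :: "nat \<Rightarrow> nat \<Rightarrow> int \<Rightarrow> int fps" where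
  "q_approx m 0 i = 0"
| "q_approx m (Suc n) i =
     (if i \<le> 0 then 0 else fps_X * (\<Prod>a=0..m-2. r_from_q m (q_approx m n) (i + int a)))"

lemma q_step_agree:
  assumes "\<And>i k. k < n \<Longrightarrow> q i $ k = q' i $ k" and "k < Suc n"
  shows "(fps_X * (\<Prod>a=0..m-2. r_from_q m q (i + int a))) $ k =
         (fps_X * (\<Prod>a=0..m-2. r_from_q m q' (i + int a))) $ k"
proof -
  have "(\<Prod>a=0..m-2. r_from_q m q (i + int a)) $ l = (\<Prod>a=0..m-2. r_from_q m q' (i + int a)) $ l"
    if "l < n" for l
    using that assms(1) by (intro fps_prod_agree[of _ n]) (auto simp: r_from_q_def fps_sum_nth)
  then show ?thesis using assms(2) by auto
qed

lemma q_approx_Suc: "k < n \<Longrightarrow> q_approx m (Suc n) i $ k = q_approx m n i $ k"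
proof (induction n arbitrary: i k)
  case (Suc n)
  show ?case
    using q_step_agree[of n "q_approx m (Suc n)" "q_approx m n" k m i] Suc
    by (simp del: q_approx.simps add: q_approx.simps(2)[of m "Suc n"] q_approx.simps(2)[of m n])
qed simp

lemma q_approx_ge: "k < n \<Longrightarrow> q_approx m n i $ k = q_approx m (Suc k) i $ k"
proof (induction n)
  case (Suc n)
  then show ?case
    by (cases "k = n") (auto simp del: q_approx.simps simp: q_approx_Suc)
qed simp

lemma series_system_exists: "\<exists>r q. series_system m r q"
proof -
  define q where "q i = Abs_fps (\<lambda>k. q_approx m (Suc k) i $ k)" for i
  have ag: "q i $ k = q_approx m n i $ k" if "k < n" for i k n
    using q_approx_ge[OF that] by (simp add: q_def del: q_approx.simps)
  have "q i = fps_X * (\<Prod>a=0..m-2. r_from_q m q (i + int a))" if "i \<ge> 1" for i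
  proof (rule fps_ext)
    fix k
    have "q i $ k = (fps_X * (\<Prod>a=0..m-2. r_from_q m (q_approx m k) (i + int a))) $ k"
      using that ag[of k "Suc k" i] by simp
    also have "\<dots> = (fps_X * (\<Prod>a=0..m-2. r_from_q m q (i + int a))) $ k"
      by (rule q_step_agree[of k]) (use ag in auto)
    finally show "q i $ k = (fps_X * (\<Prod>a=0..m-2. r_from_q m q (i + int a))) $ k" .
  qed
  moreover have "q j = 0" if "j \<le> 0" for j
    using that by (intro fps_ext) (simp add: q_def)
  ultimately have "series_system m (r_from_q m q) q"
    by (simp add: series_system_def r_from_q_def)
  then show ?thesis by blast
qed

end

definition enumerated_by :: "'a set \<Rightarrow> ('a \<Rightarrow> nat) \<Rightarrow> int fps \<Rightarrow> bool" where
  "enumerated_by S w f \<longleftrightarrow>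
     (\<forall>n. finite {x\<in>S. w x = n} \<and> fps_nth f n = int (card {x\<in>S. w x = n}))"

end

theory Submission
  imports Defs
begin

text \<open>
  Level sets of the three families are finite, so it suffices to count them. A closing leaf of
  height \<open>h\<close> can be matched with any of the \<open>h\<close> openings that precede it and are still free, so
  forward matchings and enrichments of a tree are both counted by the product of the heights of
  its closing leaves (\<open>0\<close> if the tree is not balanced). Weighting trees by this product, with
  leaf-paths started at height \<open>i\<close>, gives series that satisfy the system defining \<open>r\<^sub>i\<close>.

  A map is a pair of permutations of its edges, whose cycles all have length \<open>m\<close>. There are
  \<open>((m n)! / (m\<^sup>n n!))\<^sup>2\<close> such pairs on \<open>m n\<close> edges, and splitting off the component of a marked edge
  shows that the series \<open>c\<close> of rooted maps satisfies \<open>Z c = Z + m g Z'\<close>, where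
  \<open>Z = (\<Sum>n. (m n)! / (m\<^sup>n n!)\<^sup>2 g\<^sup>n)\<close>. Here \<open>Z\<close> and \<open>Z + m g Z'\<close> are the values at \<open>1\<close> and \<open>x y\<close> of the
  functional with weight \<open>exp (- x y + (x\<^sup>m + g y\<^sup>m) / m)\<close>. The system for \<open>r\<^sub>i\<close> consists of the string
  equations of that weight: it says that two operators built from the \<open>r\<^sub>i\<close> and \<open>q\<^sub>i\<close> satisfy
  \<open>B A - A B = 1\<close>, so that their vacuum expectations obey the same recursions as the moments. The
  two families of moments are thus proportional, and the one at \<open>x y\<close> gives \<open>Z r\<^sub>1 = Z + m g Z'\<close>.
\<close>

section \<open>Trees, matchings and enrichments\<close>

text \<open>The functional stays formal and no biorthogonal polynomial is constructed: only its two
  integrations by parts are needed. Writing \<open><f>\<close> for its value at \<open>f\<close>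
  times the exponential, they read \<open><x^a y^(b+1)> = a <x^(a-1) y^b> + <x^(a+m-1) y^b>\<close>
  and \<open><x^(a+1)> = g <x^a y^(m-1)>\<close>. The first says that \<open>y\<close> acts on
  polynomials in \<open>x\<close> as derivative plus multiplication by \<open>x^(m-1)\<close>, which
  is the origin of the commutator 1; the second is the origin of the product formula for
  \<open>q\<close>. The value at \<open>x y\<close> singles out index 1, because the lowest
  coefficient of \<open>B A\<close> applied to the vacuum is just \<open>r_1\<close>. The delicate
  point is the lower boundary: the recursions close on vectors indexed by nonnegative integers only
  because \<open>q\<close> vanishes at indices up to 0 and \<open>r\<close> is continued there by 0.
  On the map side edges are labelled because labels kill symmetries. In
  \<open>Z c = Z + m g Z'\<close> the factor \<open>m n\<close> hidden in the derivative is the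
  choice of the marked edge, and the summand \<open>Z\<close> comes from the trivial object.\<close>

fun path_weight :: "int \<Rightarrow> leaf list \<Rightarrow> nat" where
  "path_weight i [] = 1"
| "path_weight i (Opening # l) = path_weight (i + 1) l"
| "path_weight i (Closing # l) = nat i * path_weight (i - 1) l"

definition rise :: "leaf list \<Rightarrow> int" where
  "rise l = int (count_list l Opening) - int (count_list l Closing)"

lemma rise_simps [simp]:
  "rise [] = 0" "rise (Opening # l) = rise l + 1" "rise (Closing # l) = rise l - 1"
  "rise (l @ l') = rise l + rise l'"
  by (simp_all add: rise_def)

lemma path_weight_append: "path_weight i (l @ l') = path_weight i l * path_weight (i + rise l) l'"
  by (induction i l rule: path_weight.induct) (simp_all add: algebra_simps)

text \<open>Somewhere the path steps from height \<open>i + rise l + 1\<close> down to its final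
  height, since it starts at or above the former. That height is at most 0, so \<open>nat\<close>
  makes the factor vanish.\<close>

lemma path_weight_eq_0: "rise l < 0 \<Longrightarrow> i + rise l < 0 \<Longrightarrow> path_weight i l = 0"
proof (induction i l rule: path_weight.induct)
  case (3 i l)
  then show ?case by (cases "rise l < 0") auto
qed auto

section \<open>Forward matchings of a list of leaves\<close>

definition positions :: "leaf \<Rightarrow> leaf list \<Rightarrow> nat set" where
  "positions x l = {p. p < length l \<and> l ! p = x}"

lemma finite_positions [simp]: "finite (positions x l)"
  by (simp add: positions_def)

lemma card_positions: "card (positions x l) = count_list l x"
  by (simp add: positions_def count_list_eq_length_filter length_filter_conv_card eq_commute)

lemma positions_snoc:
  "positions x (l @ [y]) = (if x = y then insert (length l) (positions x l) else positions x l)"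
  by (auto simp: positions_def nth_append)

text \<open>The start is at 0 rather than 1 because the list is meant to include the opening root
  leaf, which supplies the initial height.\<close>

lemma path_weight_eq_prod:
  "path_weight 0 l = (\<Prod>p\<in>positions Closing l. nat (rise (take p l)))"
proof (induction l rule: rev_induct)
  case Nil
  then show ?case by (simp add: positions_def)
next
  case (snoc x l)
  have "length l \<notin> positions Closing l" by (simp add: positions_def)
  moreover have "(\<Prod>p\<in>positions Closing l. nat (rise (take p (l @ [x])))) = path_weight 0 l"
    unfolding snoc by (rule prod.cong) (simp_all add: positions_def)
  ultimately show ?case
    by (cases x) (simp_all add: path_weight_append positions_snoc)
qed

text \<open>Only the closings have to be saturated; openings may stay free. This condition survives
  cutting the list to a prefix, so that the count can proceed by induction from the end.\<close>

definition matchings :: "leaf list \<Rightarrow> (nat \<times> nat) set set" where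
  "matchings l = {M. M \<subseteq> positions Opening l \<times> positions Closing l \<and> inj_on fst M \<and>
     bij_betw snd M (positions Closing l) \<and> (\<forall>(p, c)\<in>M. p < c)}"

lemma finite_matchings: "finite (matchings l)"
  by (rule finite_subset[of _ "Pow (positions Opening l \<times> positions Closing l)"])
    (auto simp: matchings_def)

lemma matchings_snoc_Opening: "matchings (l @ [Opening]) = matchings l"
proof -
  have "length l \<notin> fst ` M"
    if "M \<subseteq> X \<times> positions Closing l" "\<forall>(p, c)\<in>M. p < c" for M X
  proof
    assume "length l \<in> fst ` M"
    then obtain c where c: "(length l, c) \<in> M" by auto
    then have "length l < c" "c \<in> positions Closing l" using that by auto
    then show False by (simp add: positions_def)
  qed
  then have "M \<subseteq> insert (length l) (positions Opening l) \<times> positions Closing l \<longleftrightarrow>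
      M \<subseteq> positions Opening l \<times> positions Closing l" if "\<forall>(p, c)\<in>M. p < c" for M
    using that by (smt (verit) fst_conv image_eqI insertE insert_iff mem_Sigma_iff subrelI subset_iff)
  then show ?thesis
    unfolding matchings_def positions_snoc by (intro Collect_cong) auto
qed

text \<open>Every opening precedes a closing appended at the end, so the latter may take any opening
  still free. The choice is read off from the unique pair with second entry
  \<open>length l\<close>.\<close>

lemma bij_betw_matchings_snoc_Closing:
  "bij_betw (\<lambda>(M, p). insert (p, length l) M)
     (SIGMA M:matchings l. positions Opening l - fst ` M) (matchings (l @ [Closing]))"
    (is "bij_betw ?f ?S ?T")
proof (rule bij_betw_imageI)
  let ?n = "length l"
  have old: "c \<noteq> ?n" if "M \<in> matchings l" "(p, c) \<in> M" for M p c
    using that unfolding matchings_def positions_def by auto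
  have cl: "positions Closing (l @ [Closing]) = insert ?n (positions Closing l)"
    and op: "positions Opening (l @ [Closing]) = positions Opening l"
    by (simp_all add: positions_snoc)
  have n: "?n \<notin> positions x l" for x by (simp add: positions_def)
  show "inj_on ?f ?S"
  proof (rule inj_onI, clarify)
    fix M p M' p'
    assume M: "M \<in> matchings l" "M' \<in> matchings l" and eq: "insert (p, ?n) M = insert (p', ?n) M'"
    have "M = insert (p, ?n) M - {x. snd x = ?n}" "M' = insert (p', ?n) M' - {x. snd x = ?n}"
      using old[OF M(1)] old[OF M(2)] by auto
    then show "M = M' \<and> p = p'" using eq old[OF M(1)] old[OF M(2)] by blast
  qed
  show "?f ` ?S = ?T"
  proof safe
    fix M p assume M: "M \<in> matchings l" and p: "p \<in> positions Opening l" "p \<notin> fst ` M"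
    have "bij_betw snd (insert (p, ?n) M) (insert ?n (positions Closing l))"
      using M n[of Closing] unfolding matchings_def bij_betw_def by (auto simp: inj_on_insert)
    moreover have "inj_on fst (insert (p, ?n) M)"
      using M p(2) unfolding matchings_def by (auto simp: inj_on_insert)
    moreover have "p < ?n" using p(1) by (simp add: positions_def)
    ultimately show "insert (p, ?n) M \<in> matchings (l @ [Closing])"
      using M p(1) unfolding matchings_def cl op by auto
  next
    fix N assume N: "N \<in> ?T"
    have inj: "inj_on fst N" "inj_on snd N"
      and sub: "N \<subseteq> positions Opening l \<times> insert ?n (positions Closing l)"
      and im: "snd ` N = insert ?n (positions Closing l)" and lt: "\<forall>(p, c)\<in>N. p < c"
      using N unfolding matchings_def cl op bij_betw_def by auto
    have "?n \<in> snd ` N" using im by simp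
    then obtain p where p: "(p, ?n) \<in> N" by auto
    define M where "M = N - {(p, ?n)}"
    have "snd ` M = snd ` N - snd ` {(p, ?n)}" "fst ` M = fst ` N - fst ` {(p, ?n)}"
      unfolding M_def using p by (auto simp only: intro!: inj_on_image_set_diff[OF inj(1)] inj_on_image_set_diff[OF inj(2)])
    then have im': "snd ` M = positions Closing l" and p': "p \<notin> fst ` M"
      using im n[of Closing] by auto
    have "c \<in> positions Closing l" if "(p', c) \<in> M" for p' c
      unfolding im'[symmetric] using that by (rule rev_image_eqI) simp
    then have "M \<subseteq> positions Opening l \<times> positions Closing l"
      using sub unfolding M_def by blast
    moreover note im'
    moreover have "inj_on fst M" "inj_on snd M"
      using inj unfolding M_def by (auto intro: inj_on_subset)
    ultimately have "M \<in> matchings l"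
      using lt unfolding matchings_def bij_betw_def M_def by auto
    moreover note p'
    moreover have "p \<in> positions Opening l" using p sub by auto
    moreover have "N = insert (p, ?n) M" using p unfolding M_def by auto
    ultimately show "N \<in> ?f ` ?S" by (intro image_eqI[of _ _ "(M, p)"]) auto
  qed
qed

lemma card_matchings: "card (matchings l) = path_weight 0 l"
proof (induction l rule: rev_induct)
  case Nil
  have "matchings [] = {{}}" by (auto simp: matchings_def positions_def bij_betw_def)
  then show ?case by simp
next
  case (snoc x l)
  show ?case
  proof (cases x)
    case Opening
    then show ?thesis using snoc by (simp add: matchings_snoc_Opening path_weight_append)
  next
    case Closing
    \<comment> \<open>The number of free openings does not depend on \<open>M\<close>, which turns
      the dependent sum into a product.\<close>
    have "card (positions Opening l - fst ` M) = nat (rise l)" if "M \<in> matchings l" for M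
    proof -
      have "fst ` M \<subseteq> positions Opening l" "inj_on fst M" and b: "bij_betw snd M (positions Closing l)"
        using that unfolding matchings_def by auto
      then have "card (positions Opening l - fst ` M) = card (positions Opening l) - card M"
        by (subst card_Diff_subset) (auto simp: card_image finite_subset)
      then show ?thesis
        using bij_betw_same_card[OF b] by (simp add: card_positions rise_def)
    qed
    moreover have "card (matchings (l @ [Closing])) =
        card (SIGMA M:matchings l. positions Opening l - fst ` M)"
      using bij_betw_same_card[OF bij_betw_matchings_snoc_Closing] by simp
    ultimately show ?thesis
      using snoc by (simp add: Closing path_weight_append finite_matchings)
  qed
qed

section \<open>From leaf lists back to trees\<close>

lemma openings_eq: "openings t = positions Opening (leaves t)"
  and closings_eq: "closings t = positions Closing (leaves t)"
  by (simp_all add: openings_def closings_def positions_def)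

lemma height_eq: "height t p = rise (take p (leaves t))"
  by (simp add: height_def rise_def)

text \<open>With equally many leaves of both kinds, an injective choice of openings that saturates
  the closings must use every opening.\<close>

lemma forward_matching_iff:
  assumes "card (openings t) = card (closings t)"
  shows "forward_matching t M \<longleftrightarrow> M \<in> matchings (leaves t)"
proof
  assume M: "forward_matching t M"
  then have sub: "M \<subseteq> openings t \<times> closings t"
    and u1: "\<And>p. p \<in> openings t \<Longrightarrow> \<exists>!c. (p, c) \<in> M"
    and u2: "\<And>c. c \<in> closings t \<Longrightarrow> \<exists>!p. (p, c) \<in> M"
    and lt: "\<forall>(p, c)\<in>M. p < c"
    unfolding forward_matching_def by auto
  have "inj_on fst M"
  proof (rule inj_onI)
    fix x y assume "x \<in> M" "y \<in> M" "fst x = fst y"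
    then show "x = y" using sub u1[of "fst x"] by (cases x, cases y) auto
  qed
  moreover have "inj_on snd M"
  proof (rule inj_onI)
    fix x y assume "x \<in> M" "y \<in> M" "snd x = snd y"
    then show "x = y" using sub u2[of "snd x"] by (cases x, cases y) auto
  qed
  moreover have "snd ` M = closings t"
  proof
    show "closings t \<subseteq> snd ` M"
    proof
      fix c assume "c \<in> closings t"
      then obtain p where "(p, c) \<in> M" using u2 by blast
      then show "c \<in> snd ` M" by (rule rev_image_eqI) simp
    qed
  qed (use sub in auto)
  ultimately show "M \<in> matchings (leaves t)"
    using sub lt unfolding matchings_def bij_betw_def openings_eq closings_eq by auto
next
  assume M: "M \<in> matchings (leaves t)"
  then have sub: "M \<subseteq> openings t \<times> closings t" and inj: "inj_on fst M" "inj_on snd M"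
    and b: "bij_betw snd M (closings t)" and lt: "\<forall>(p, c)\<in>M. p < c"
    unfolding matchings_def bij_betw_def openings_eq closings_eq by auto
  have im: "fst ` M = openings t"
  proof (rule card_subset_eq)
    show "finite (openings t)" by (simp add: openings_eq)
    show "fst ` M \<subseteq> openings t" using sub by auto
    show "card (fst ` M) = card (openings t)"
      using bij_betw_same_card[OF b] inj(1) assms by (simp add: card_image)
  qed
  have "\<exists>!c. (p, c) \<in> M" if "p \<in> openings t" for p
  proof (rule ex_ex1I)
    show "\<exists>c. (p, c) \<in> M" using that unfolding im[symmetric] by auto
    show "c = c'" if "(p, c) \<in> M" "(p, c') \<in> M" for c c'
      using inj_onD[OF inj(1) _ that] by simp
  qed
  moreover have "\<exists>!p. (p, c) \<in> M" if "c \<in> closings t" for c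
  proof (rule ex_ex1I)
    show "\<exists>p. (p, c) \<in> M" using that unfolding bij_betw_imp_surj_on[OF b, symmetric] by auto
    show "p = p'" if "(p, c) \<in> M" "(p', c) \<in> M" for p p'
      using inj_onD[OF inj(2) _ that] by simp
  qed
  ultimately show "forward_matching t M"
    using sub lt unfolding forward_matching_def by auto
qed

lemma card_forward_matchings:
  assumes "card (openings t) = card (closings t)"
  shows "finite {M. forward_matching t M}"
    and "card {M. forward_matching t M} = path_weight 1 (nonroot_leaves t)"
proof -
  have "{M. forward_matching t M} = matchings (leaves t)"
    using forward_matching_iff[OF assms] by auto
  then show "finite {M. forward_matching t M}"
    "card {M. forward_matching t M} = path_weight 1 (nonroot_leaves t)"
    by (simp_all add: finite_matchings card_matchings leaves_def)
qed

lemma card_enrichments: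
  defines "W t \<equiv> {w. balanced t \<and> w \<in> (\<Pi>\<^sub>E p\<in>closings t. {0..height t p - 1})}"
  shows "finite (W t)" and "card (W t) = path_weight 1 (nonroot_leaves t)"
proof -
  have fin: "finite (closings t)" by (simp add: closings_eq)
  \<comment> \<open>A closing leaf of height below 1 has an empty range of labels, so the mere
    existence of \<open>w\<close> forces balance.\<close>
  have "balanced t" if "w \<in> (\<Pi>\<^sub>E p\<in>closings t. {0..height t p - 1})" for w
    using PiE_mem[OF that] unfolding balanced_def by fastforce
  then have W: "W t = (\<Pi>\<^sub>E p\<in>closings t. {0..height t p - 1})"
    unfolding W_def by blast
  show "finite (W t)"
    unfolding W by (rule finite_PiE[OF fin]) simp
  have "card (W t) = (\<Prod>p\<in>closings t. nat (height t p))"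
    unfolding W by (simp add: card_PiE[OF fin])
  also have "\<dots> = path_weight 0 (leaves t)"
    by (simp add: path_weight_eq_prod closings_eq height_eq)
  finally show "card (W t) = path_weight 1 (nonroot_leaves t)"
    by (simp add: leaves_def)
qed

section \<open>The generating series of the trees\<close>

text \<open>A grammar for the trees of \<open>m_bipartite\<close>. The nodeless tree must be a
  closing leaf, as its root leaf is opening. A white node and its black child are generated
  together, with \<open>a\<close> opening leaves before that child and \<open>b\<close> after
  it.\<close>

inductive mtree :: "nat \<Rightarrow> tree \<Rightarrow> bool" for m where
  Leaf: "mtree m (Leaf Closing)"
| Node: "a + b = m - 2 \<Longrightarrow> length us = m - 1 \<Longrightarrow> \<forall>u\<in>set us. mtree m u \<Longrightarrow>
    mtree m (Node White (replicate a (Leaf Opening) @ Node Black us # replicate b (Leaf Opening)))"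

lemma rise_replicate_Opening: "rise (replicate a Opening) = int a"
  by (induction a) simp_all

lemma rise_concat: "\<forall>u\<in>set us. rise (f u) = - 1 \<Longrightarrow> rise (concat (map f us)) = - int (length us)"
  by (induction us) simp_all

text \<open>A white node brings \<open>m - 2\<close> openings, and its black child
  \<open>m - 1\<close> trees of rise -1, which again totals -1. The grammar thus yields equally many
  opening and closing leaves automatically.\<close>

lemma rise_mtree: "mtree m t \<Longrightarrow> m \<ge> 2 \<Longrightarrow> rise (nonroot_leaves t) = - 1"
proof (induction rule: mtree.induct)
  case (Node a b us)
  then have "rise (concat (map nonroot_leaves us)) = - int (m - 1)"
    using rise_concat[of us nonroot_leaves] by simp
  then show ?case
    using Node.hyps(1) Node.prems by (simp add: rise_replicate_Opening)
qed simp

text \<open>The local conditions of \<open>m_bipartite\<close>, separated because they pass to all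
  subtrees, whereas the colour of the root and the balance of leaf numbers need not.\<close>

definition mnodes_ok :: "nat \<Rightarrow> tree \<Rightarrow> bool" where
  "mnodes_ok m t \<longleftrightarrow> (\<forall>c ts. Node c ts \<in> subtrees t \<longrightarrow>
     length ts + 1 = m \<and> (\<forall>s\<in>set ts. child_ok c s) \<and>
     (c = White \<longrightarrow> length (filter is_black_node ts) = 1 \<and>
        length (filter (\<lambda>s. s = Leaf Opening) ts) = m - 2))"

lemma mnodes_ok_Leaf [simp]: "mnodes_ok m (Leaf l)"
  by (simp add: mnodes_ok_def)

lemma mnodes_ok_Node:
  "mnodes_ok m (Node c ts) \<longleftrightarrow> length ts + 1 = m \<and> (\<forall>s\<in>set ts. child_ok c s \<and> mnodes_ok m s) \<and>
     (c = White \<longrightarrow> length (filter is_black_node ts) = 1 \<and>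
        length (filter (\<lambda>s. s = Leaf Opening) ts) = m - 2)"
  unfolding mnodes_ok_def by auto

lemma mnodes_ok_mtree:
  assumes "mtree m t" and "m \<ge> 2"
  shows "mnodes_ok m t \<and> (t = Leaf Closing \<or> (\<exists>ts. t = Node White ts))"
  using assms(1)
proof (induction rule: mtree.induct)
  case (Node a b us)
  have "\<forall>u\<in>set us. child_ok Black u \<and> mnodes_ok m u"
    using Node.IH by auto
  then have "mnodes_ok m (Node Black us)"
    using Node.hyps assms(2) by (simp add: mnodes_ok_Node)
  then show ?case
    using Node.hyps assms(2) by (auto simp: mnodes_ok_Node)
qed simp

lemma length_filter_eqD: "length (filter P xs) = length xs \<Longrightarrow> \<forall>x\<in>set xs. P x"
  using length_filter_less[of _ xs P] by auto

lemma mtree_mnodes_ok: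
  assumes "m \<ge> 3"
  shows "mnodes_ok m t \<Longrightarrow> t = Leaf Closing \<or> (\<exists>ts. t = Node White ts) \<Longrightarrow> mtree m t"
proof (induction t rule: measure_induct_rule[of size])
  case (less t)
  show ?case
  proof (cases "t = Leaf Closing")
    case True
    then show ?thesis by (simp add: mtree.Leaf)
  next
    case False
    then obtain ts where t: "t = Node White ts" using less.prems by blast
    have len: "length ts + 1 = m" and ok: "\<And>s. s \<in> set ts \<Longrightarrow> mnodes_ok m s"
      and black: "length (filter is_black_node ts) = 1"
      and op: "length (filter (\<lambda>s. s = Leaf Opening) ts) = m - 2"
      using less.prems(1) unfolding t mnodes_ok_Node by auto
    obtain s where "filter is_black_node ts = [s]"
      using black by (auto simp: length_Suc_conv)
    then obtain xs ys where ts: "ts = xs @ s # ys" and s: "is_black_node s"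
      and xs: "\<forall>x\<in>set xs. \<not> is_black_node x" and ys: "filter is_black_node ys = []"
      by (auto simp: filter_eq_Cons_iff)
    obtain us where us: "s = Node Black us" using s by (cases s) auto
    \<comment> \<open>One black node and \<open>m - 2\<close> opening leaves exhaust the
      \<open>m - 1\<close> children, so only opening leaves surround the black child.\<close>
    have lens: "length (filter (\<lambda>s. s = Leaf Opening) xs) + length (filter (\<lambda>s. s = Leaf Opening) ys)
        = length xs + length ys"
      using op len unfolding ts us by simp
    have "length (filter (\<lambda>s. s = Leaf Opening) xs) = length xs"
      "length (filter (\<lambda>s. s = Leaf Opening) ys) = length ys"
      using lens length_filter_le[of "\<lambda>s. s = Leaf Opening" xs]
        length_filter_le[of "\<lambda>s. s = Leaf Opening" ys] by linarith+
    then have "\<forall>x\<in>set xs. x = Leaf Opening" "\<forall>x\<in>set ys. x = Leaf Opening"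
      by (blast dest: length_filter_eqD)+
    then have rep: "xs = replicate (length xs) (Leaf Opening)" "ys = replicate (length ys) (Leaf Opening)"
      by (auto intro: replicate_length_same[symmetric])
    have okB: "mnodes_ok m (Node Black us)" using ok[of s] by (simp add: ts us)
    have "mtree m u" if u: "u \<in> set us" for u
    proof (rule less.IH)
      have "size u < size (Node Black us)"
        using u by (auto simp: less_Suc_eq_le intro: size_list_estimation')
      also have "size (Node Black us) < size t"
        by (simp add: t ts us)
      finally show "size u < size t" .
      show "mnodes_ok m u" using okB u by (simp add: mnodes_ok_Node)
      have "child_ok Black u" using okB u by (simp add: mnodes_ok_Node)
      then show "u = Leaf Closing \<or> (\<exists>ts. u = Node White ts)"
      proof (cases u)
        case (Leaf l)
        then show ?thesis using \<open>child_ok Black u\<close> by (cases l) auto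
      next
        case (Node c us')
        then show ?thesis using \<open>child_ok Black u\<close> by (cases c) auto
      qed
    qed
    moreover have "length us = m - 1" using okB by (auto simp: mnodes_ok_Node)
    moreover have "length xs + length ys = m - 2" using len by (simp add: ts)
    ultimately show ?thesis
      using mtree.Node[of "length xs" "length ys" m us]
      unfolding rep[symmetric] unfolding t ts us by blast
  qed
qed

lemma card_openings_eq_iff:
  "card (openings t) = card (closings t) \<longleftrightarrow> rise (nonroot_leaves t) = - 1"
  by (auto simp: openings_eq closings_eq card_positions leaves_def rise_def)

lemma m_bipartite_iff_mtree:
  assumes "m \<ge> 3"
  shows "m_bipartite m t \<longleftrightarrow> mtree m t"
proof
  assume t: "m_bipartite m t"
  then have "rise (nonroot_leaves t) = - 1"
    unfolding m_bipartite_def blossoming_def card_openings_eq_iff by blast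
  moreover have "(\<exists>l. t = Leaf l) \<or> (\<exists>ts. t = Node White ts) \<and> mnodes_ok m t"
    using t unfolding m_bipartite_def mnodes_ok_def by blast
  ultimately have "mnodes_ok m t \<and> (t = Leaf Closing \<or> (\<exists>ts. t = Node White ts))"
  proof (elim disjE exE conjE)
    \<comment> \<open>\<open>Leaf Opening\<close> has rise 1 and is excluded: both leaves of the
      nodeless tree would be opening.\<close>
    fix l assume "t = Leaf l" "rise (nonroot_leaves t) = - 1"
    then show ?thesis by (cases l) simp_all
  qed simp
  then show "mtree m t" using mtree_mnodes_ok[OF assms] by blast
next
  assume t: "mtree m t"
  then have ok: "mnodes_ok m t" "t = Leaf Closing \<or> (\<exists>ts. t = Node White ts)"
    using mnodes_ok_mtree[of m t] assms by simp_all
  have "ts \<noteq> []" if "Node c ts \<in> subtrees t" for c ts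
    using that ok(1) assms unfolding mnodes_ok_def by fastforce
  moreover have "card (openings t) = card (closings t)"
    unfolding card_openings_eq_iff using rise_mtree[OF t] assms by simp
  ultimately have "blossoming t" unfolding blossoming_def by blast
  then show "m_bipartite m t"
    using ok unfolding m_bipartite_def mnodes_ok_def by blast
qed

section \<open>Trees and forests with a given number of black nodes\<close>

definition mtrees :: "nat \<Rightarrow> nat \<Rightarrow> tree set" where
  "mtrees m n = {t. mtree m t \<and> black_nodes t = n}"

definition mforests :: "nat \<Rightarrow> nat \<Rightarrow> nat \<Rightarrow> tree list set" where
  "mforests m k n = {us. length us = k \<and> (\<forall>u\<in>set us. mtree m u) \<and> sum_list (map black_nodes us) = n}"

definition white_node :: "nat \<Rightarrow> nat \<times> tree list \<Rightarrow> tree" where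
  "white_node m = (\<lambda>(a, us). Node White
     (replicate a (Leaf Opening) @ Node Black us # replicate (m - 2 - a) (Leaf Opening)))"

lemma mtrees_0: "mtrees m 0 = {Leaf Closing}"
  by (auto simp: mtrees_def intro: mtree.Leaf elim: mtree.cases)

lemma mtrees_Suc: "mtrees m (Suc n) = white_node m ` ({..m-2} \<times> mforests m (m - 1) n)"
proof
  show "mtrees m (Suc n) \<subseteq> white_node m ` ({..m-2} \<times> mforests m (m - 1) n)"
  proof
    fix t assume t: "t \<in> mtrees m (Suc n)"
    then have "mtree m t" by (simp add: mtrees_def)
    then show "t \<in> white_node m ` ({..m-2} \<times> mforests m (m - 1) n)"
    proof cases
      case Leaf
      then show ?thesis using t by (simp add: mtrees_def)
    next
      case (Node a b us)
      then have "b = m - 2 - a" "a \<le> m - 2" by simp_all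
      moreover have "us \<in> mforests m (m - 1) n"
        using t Node by (simp add: mtrees_def mforests_def sum_list_replicate)
      ultimately show ?thesis
        using Node by (intro image_eqI[of _ _ "(a, us)"]) (auto simp: white_node_def)
    qed
  qed
  show "white_node m ` ({..m-2} \<times> mforests m (m - 1) n) \<subseteq> mtrees m (Suc n)"
  proof safe
    fix a us assume a: "a \<le> m - 2" and us: "us \<in> mforests m (m - 1) n"
    have "mtree m (white_node m (a, us))"
      unfolding white_node_def prod.case
      by (rule mtree.Node) (use a us in \<open>simp_all add: mforests_def\<close>)
    then show "white_node m (a, us) \<in> mtrees m (Suc n)"
      using us by (simp add: mtrees_def mforests_def white_node_def sum_list_replicate)
  qed
qed

lemma inj_white_node: "inj_on (white_node m) S"
proof (rule inj_onI)
  fix x y assume "white_node m x = white_node m y"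
  then have *: "replicate (fst x) (Leaf Opening) @ Node Black (snd x) # replicate (m - 2 - fst x) (Leaf Opening) =
      replicate (fst y) (Leaf Opening) @ Node Black (snd y) # replicate (m - 2 - fst y) (Leaf Opening)"
    by (simp add: white_node_def case_prod_unfold)
  \<comment> \<open>The leading run of opening leaves stops at the black child, so its length is the
    first component.\<close>
  then have "takeWhile (\<lambda>t. t = Leaf Opening) (replicate (fst x) (Leaf Opening) @ Node Black (snd x) # replicate (m - 2 - fst x) (Leaf Opening)) =
      takeWhile (\<lambda>t. t = Leaf Opening) (replicate (fst y) (Leaf Opening) @ Node Black (snd y) # replicate (m - 2 - fst y) (Leaf Opening))"
    by simp
  then have "fst x = fst y"
    by (simp add: takeWhile_append)
  then show "x = y" using * by (simp add: prod_eq_iff)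
qed

lemma mforests_0: "mforests m 0 n = (if n = 0 then {[]} else {})"
  by (auto simp: mforests_def)

lemma mforests_Suc:
  "mforests m (Suc k) n = (\<lambda>(u, us). u # us) ` (\<Union>j\<in>{0..n}. mtrees m j \<times> mforests m k (n - j))"
    (is "?L = ?R")
proof
  show "?L \<subseteq> ?R"
  proof
    fix vs assume "vs \<in> ?L"
    then obtain u us where vs: "vs = u # us"
      and "u \<in> mtrees m (black_nodes u)" "us \<in> mforests m k (n - black_nodes u)" "black_nodes u \<le> n"
      by (cases vs) (auto simp: mforests_def mtrees_def)
    then show "vs \<in> ?R"
      unfolding vs by (intro image_eqI[of _ _ "(u, us)"]) auto
  qed
  show "?R \<subseteq> ?L"
    by (auto simp: mforests_def mtrees_def)
qed

lemma finite_mforests: "(\<And>j. j \<le> n \<Longrightarrow> finite (mtrees m j)) \<Longrightarrow> finite (mforests m k n)"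
  by (induction k arbitrary: n) (simp_all add: mforests_0 mforests_Suc)

lemma finite_mtrees: "finite (mtrees m n)"
proof (induction n rule: less_induct)
  case (less n)
  then show ?case
    by (cases n) (auto simp: mtrees_0 mtrees_Suc less_Suc_eq_le intro!: finite_mforests)
qed

section \<open>Weighted generating series of trees and forests\<close>

definition tree_series :: "nat \<Rightarrow> int \<Rightarrow> int fps" where
  "tree_series m i = Abs_fps (\<lambda>n. int (\<Sum>t\<in>mtrees m n. path_weight i (nonroot_leaves t)))"

definition forest_series :: "nat \<Rightarrow> nat \<Rightarrow> int \<Rightarrow> int fps" where
  "forest_series m k i =
     Abs_fps (\<lambda>n. int (\<Sum>us\<in>mforests m k n. path_weight i (concat (map nonroot_leaves us))))"

lemma forest_series_0: "forest_series m 0 i = 1"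
  by (simp add: forest_series_def mforests_0 fps_eq_iff)

text \<open>The first tree has rise -1, whatever its shape, so the remaining forest is always read
  from height \<open>i - 1\<close>.\<close>

lemma forest_series_Suc:
  assumes "m \<ge> 2"
  shows "forest_series m (Suc k) i = tree_series m i * forest_series m k (i - 1)"
proof (rule fps_ext)
  fix n
  let ?P = "\<lambda>j. mtrees m j \<times> mforests m k (n - j)"
  let ?w = "\<lambda>i us. path_weight i (concat (map nonroot_leaves us))"
  have "inj_on (\<lambda>(u, us). u # us) S" for S :: "(tree \<times> tree list) set"
    by (auto simp: inj_on_def)
  then have "(\<Sum>us\<in>mforests m (Suc k) n. ?w i us) = (\<Sum>(u, us)\<in>(\<Union>j\<in>{0..n}. ?P j). ?w i (u # us))"
    unfolding mforests_Suc by (subst sum.reindex) (auto simp: case_prod_unfold)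
  also have "\<dots> = (\<Sum>j=0..n. \<Sum>(u, us)\<in>?P j. ?w i (u # us))"
    by (rule sum.UNION_disjoint) (simp_all add: finite_mtrees finite_mforests, auto simp: mtrees_def)
  also have "\<dots> = (\<Sum>j=0..n. \<Sum>(u, us)\<in>?P j. path_weight i (nonroot_leaves u) * ?w (i - 1) us)"
  proof (intro sum.cong refl, clarify)
    fix j u us assume "u \<in> mtrees m j"
    then show "?w i (u # us) = path_weight i (nonroot_leaves u) * ?w (i - 1) us"
      using rise_mtree[of m u] assms by (simp add: mtrees_def path_weight_append)
  qed
  also have "\<dots> = (\<Sum>j=0..n. (\<Sum>u\<in>mtrees m j. path_weight i (nonroot_leaves u)) *
      (\<Sum>us\<in>mforests m k (n - j). ?w (i - 1) us))"
    by (simp add: sum_product sum.cartesian_product)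
  finally show "fps_nth (forest_series m (Suc k) i) n =
      fps_nth (tree_series m i * forest_series m k (i - 1)) n"
    by (simp add: forest_series_def tree_series_def fps_mult_nth flip: of_nat_mult of_nat_sum)
qed

lemma forest_series_eq:
  assumes "m \<ge> 2"
  shows "forest_series m k i = (\<Prod>a<k. tree_series m (i - int a))"
proof (induction k arbitrary: i)
  case (Suc k)
  show ?case
    unfolding forest_series_Suc[OF assms] Suc
    by (subst prod.lessThan_Suc_shift) (simp add: algebra_simps)
qed (simp add: forest_series_0)

lemma tree_series_nth_0: "fps_nth (tree_series m i) 0 = int (nat i)"
  by (simp add: tree_series_def mtrees_0)

lemma path_weight_Opening: "path_weight i (replicate a Opening @ l) = path_weight (i + int a) l"
  by (induction a arbitrary: i) (simp_all add: algebra_simps)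

text \<open>The \<open>a\<close> openings before the black child lift the path from \<open>i\<close>
  to \<open>i + a\<close>; those after it have weight 1.\<close>

lemma tree_series_nth_Suc:
  "fps_nth (tree_series m i) (Suc n) = (\<Sum>a\<le>m-2. fps_nth (forest_series m (m - 1) (i + int a)) n)"
proof -
  have one: "path_weight j (replicate a Opening) = 1" for j a
    using path_weight_Opening[of j a "[]"] by simp
  have "path_weight i (nonroot_leaves (white_node m x)) =
      path_weight (i + int (fst x)) (concat (map nonroot_leaves (snd x)))" for x
    by (simp add: white_node_def case_prod_unfold path_weight_Opening)
      (simp add: path_weight_append one)
  then show ?thesis
    unfolding tree_series_def forest_series_def
    by (simp add: mtrees_Suc sum.reindex[OF inj_white_node] sum.cartesian_product case_prod_unfold)
qed

text \<open>A path of rise -1 from a height at most 0 ends below 0. This reproduces the convention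
  on \<open>q\<close> at nonpositive indices, whose product has the vanishing factor with
  \<open>a = 0\<close>.\<close>

lemma tree_series_nonpos:
  assumes "m \<ge> 2" and "i \<le> 0"
  shows "tree_series m i = 0"
proof (rule fps_ext)
  fix n
  have "path_weight i (nonroot_leaves t) = 0" if "t \<in> mtrees m n" for t
    using that rise_mtree[of m t] assms by (intro path_weight_eq_0) (simp_all add: mtrees_def)
  then show "fps_nth (tree_series m i) n = fps_nth 0 n"
    by (simp add: tree_series_def)
qed

lemma tree_series_system:
  assumes "m \<ge> 2"
  shows "series_system m (tree_series m) (\<lambda>i. fps_X * (\<Prod>a=0..m-2. tree_series m (i + int a)))"
proof -
  have idx: "{0..m-2} = {..<m-1}" using assms by auto
  have "tree_series m i =
      of_int i + (\<Sum>a=0..m-2. fps_X * (\<Prod>b=0..m-2. tree_series m (i - int a + int b)))" if "i \<ge> 1" for i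
  proof (rule fps_ext)
    fix n
    show "fps_nth (tree_series m i) n = fps_nth (of_int i +
        (\<Sum>a=0..m-2. fps_X * (\<Prod>b=0..m-2. tree_series m (i - int a + int b)))) n"
    proof (cases n)
      case 0
      then show ?thesis using that by (simp add: tree_series_nth_0 fps_sum_nth)
    next
      case (Suc k)
      \<comment> \<open>The forest after \<open>a\<close> openings is read at heights
        \<open>i + a\<close> down to \<open>i + a - (m - 2)\<close>. Replacing \<open>a\<close> by
        \<open>m - 2 - a\<close> and reversing the product gives the factors of \<open>q\<close> at
        index \<open>i - a\<close>.\<close>
      have "forest_series m (m - 1) (i + int (m - 1 - Suc a)) =
          (\<Prod>b<m-1. tree_series m (i - int a + int b))" if "a < m - 1" for a
      proof -
        have "(\<Prod>b<m-1. tree_series m (i - int a + int b)) =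
            (\<Prod>b<m-1. tree_series m (i - int a + int (m - 1 - Suc b)))"
          by (rule prod.nat_diff_reindex[symmetric])
        also have "\<dots> = (\<Prod>b<m-1. tree_series m (i + int (m - 1 - Suc a) - int b))"
          using that by (intro prod.cong) (auto simp: of_nat_diff algebra_simps)
        finally show ?thesis by (simp add: forest_series_eq[OF assms])
      qed
      then have "(\<Sum>a<m-1. fps_nth (forest_series m (m - 1) (i + int (m - 1 - Suc a))) k) =
          (\<Sum>a<m-1. fps_nth (\<Prod>b<m-1. tree_series m (i - int a + int b)) k)"
        by (intro sum.cong) auto
      moreover have "(\<Sum>a<m-1. fps_nth (forest_series m (m - 1) (i + int (m - 1 - Suc a))) k) =
          (\<Sum>a<m-1. fps_nth (forest_series m (m - 1) (i + int a)) k)"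
        by (rule sum.nat_diff_reindex)
      moreover have "{..m-2} = {..<m-1}" using assms by auto
      ultimately show ?thesis
        by (simp add: Suc tree_series_nth_Suc fps_sum_nth idx)
    qed
  qed
  moreover have "fps_X * (\<Prod>a=0..m-2. tree_series m (i + int a)) = 0" if "i \<le> 0" for i
  proof -
    have "(\<Prod>a=0..m-2. tree_series m (i + int a)) = 0"
      by (rule prod_zero) (use that tree_series_nonpos[OF assms] in \<open>auto intro!: bexI[of _ 0]\<close>)
    then show ?thesis by simp
  qed
  ultimately show ?thesis unfolding series_system_def by blast
qed

text \<open>Enrichments and matchings enter only through their number on each tree, so one statement
  on decorations \<open>D t\<close> covers both families.\<close>

lemma enumerated_by_tree_pairs:
  assumes "m \<ge> 3" and "series_system m r q"
    and D: "\<And>t. m_bipartite m t \<Longrightarrow> finite (D t) \<and> card (D t) = path_weight 1 (nonroot_leaves t)"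
  shows "enumerated_by {(t, d). m_bipartite m t \<and> d \<in> D t} (\<lambda>x. black_nodes (fst x)) (r 1)"
proof -
  have r1: "r 1 = tree_series m 1"
    using series_system_unique(2)[OF assms(2) tree_series_system] assms(1) by simp
  have "{x \<in> {(t, d). m_bipartite m t \<and> d \<in> D t}. black_nodes (fst x) = n} = (SIGMA t:mtrees m n. D t)" for n
    by (auto simp: mtrees_def m_bipartite_iff_mtree[OF assms(1)])
  moreover have "finite (SIGMA t:mtrees m n. D t)" for n
    using D m_bipartite_iff_mtree[OF assms(1)] by (intro finite_SigmaI finite_mtrees) (simp add: mtrees_def)
  moreover have "card (SIGMA t:mtrees m n. D t) = (\<Sum>t\<in>mtrees m n. path_weight 1 (nonroot_leaves t))" for n
    using D m_bipartite_iff_mtree[OF assms(1)]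
    by (subst card_SigmaI[OF finite_mtrees]) (simp_all add: mtrees_def)
  ultimately show ?thesis
    unfolding enumerated_by_def r1 tree_series_def by simp
qed

lemma enumerated_by_enriched_trees:
  assumes "m \<ge> 3" and "series_system m r q"
  shows "enumerated_by (enriched_trees m) (\<lambda>x. black_nodes (fst x)) (r 1)"
proof -
  have "enriched_trees m = {(t, w). m_bipartite m t \<and>
      w \<in> {w. balanced t \<and> w \<in> (\<Pi>\<^sub>E p\<in>closings t. {0..height t p - 1})}}"
    by (auto simp: enriched_trees_def)
  then show ?thesis
    using enumerated_by_tree_pairs[OF assms, of "\<lambda>t. {w. balanced t \<and>
      w \<in> (\<Pi>\<^sub>E p\<in>closings t. {0..height t p - 1})}"] card_enrichments by simp
qed

lemma enumerated_by_matched_trees: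
  assumes "m \<ge> 3" and "series_system m r q"
  shows "enumerated_by (matched_trees m) (\<lambda>x. black_nodes (fst x)) (r 1)"
proof -
  have "matched_trees m = {(t, M). m_bipartite m t \<and> M \<in> {M. forward_matching t M}}"
    by (auto simp: matched_trees_def)
  moreover have "card (openings t) = card (closings t)" if "m_bipartite m t" for t
    using that unfolding m_bipartite_def blossoming_def by blast
  ultimately show ?thesis
    using enumerated_by_tree_pairs[OF assms, of "\<lambda>t. {M. forward_matching t M}"]
      card_forward_matchings by simp
qed

section \<open>Moments from the string equations\<close>

text \<open>Subtracting consecutive equations for \<open>r\<close> leaves only the two ends of the
  window of terms \<open>q\<close>. With \<open>r\<close> continued by 0 this is valid from
  \<open>i = 0\<close> on, and \<open>q_eq\<close> can be imposed at all indices, since both sides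
  vanish at nonpositive ones.\<close>

locale string_equations =
  fixes m :: nat and g :: "'a::comm_ring_1" and r q :: "int \<Rightarrow> 'a"
  assumes m_ge: "m \<ge> 2"
    and r_nonpos: "\<And>i. i \<le> 0 \<Longrightarrow> r i = 0"
    and r_step: "\<And>i. i \<ge> 0 \<Longrightarrow> r (i + 1) = r i + 1 + q (i + 1) - q (i - int m + 2)"
    and q_eq: "\<And>i. q i = g * (\<Prod>a<m-1. r (i + int a))"
begin

text \<open>
  Multiplication by the two variables, written in the bases of polynomials that are biorthogonal
  for the weight \<open>exp (- x y + (x\<^sup>m + g y\<^sup>m) / m)\<close>.
\<close>

definition A :: "(int \<Rightarrow> 'a) \<Rightarrow> int \<Rightarrow> 'a" where
  "A v j = v (j - 1) + q (j + 1) * v (j + int m - 1)"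

definition B :: "(int \<Rightarrow> 'a) \<Rightarrow> int \<Rightarrow> 'a" where
  "B v j = r (j + 1) * v (j + 1) + v (j - int m + 1)"

definition e :: "int \<Rightarrow> int \<Rightarrow> 'a" where
  "e i j = of_bool (j = i)"

definition supported :: "(int \<Rightarrow> 'a) \<Rightarrow> bool" where
  "supported v \<longleftrightarrow> (\<forall>j<0. v j = 0)"

text \<open>The vacuum expectation that plays the role of the normalized value of the functional at
  \<open>x^a y^b\<close>.\<close>

definition moment :: "nat \<Rightarrow> nat \<Rightarrow> 'a" where
  "moment a b = (B ^^ b) ((A ^^ a) (e 0)) 0"

lemma q_nonpos:
  assumes "i \<le> 0"
  shows "q i = 0"
proof -
  have "(\<Prod>a<m-1. r (i + int a)) = 0"
    by (rule prod_zero) (use m_ge assms r_nonpos in \<open>auto intro!: bexI[of _ 0]\<close>)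
  then show ?thesis by (simp add: q_eq)
qed

lemma supported_A: "supported v \<Longrightarrow> supported (A v)"
  by (simp add: supported_def A_def q_nonpos)

lemma supported_B: "supported v \<Longrightarrow> supported (B v)"
  using m_ge by (simp add: supported_def B_def r_nonpos)

lemma supported_A_funpow: "supported ((A ^^ a) (e 0))"
  by (induction a) (simp_all add: supported_A, simp add: supported_def e_def)

lemma supported_B_funpow: "supported v \<Longrightarrow> supported ((B ^^ b) v)"
  by (induction b) (simp_all add: supported_B)

text \<open>Both sides are \<open>g\<close> times the product of \<open>r\<close> over the
  \<open>m\<close> indices from \<open>j\<close> to \<open>j + m - 1\<close>.\<close>

lemma r_mult_q: "r j * q (j + 1) = q j * r (j + int m - 1)"
proof -
  obtain k where k: "m - 1 = Suc k" using m_ge by (cases "m - 1") auto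
  then have m: "int m = int k + 2" by simp
  have "r j * (\<Prod>a<m-1. r (j + 1 + int a)) = (\<Prod>a<Suc (m-1). r (j + int a))"
    by (subst prod.lessThan_Suc_shift) (simp add: add_ac)
  also have "\<dots> = (\<Prod>a<m-1. r (j + int a)) * r (j + int m - 1)"
    unfolding prod.lessThan_Suc using m_ge by (simp add: of_nat_diff algebra_simps)
  finally show ?thesis
    unfolding q_eq[of j] q_eq[of "j + 1"] by (simp add: algebra_simps)
qed

text \<open>In the commutator the terms at \<open>j - m\<close> cancel outright, those at
  \<open>j + m\<close> cancel by \<open>r_mult_q\<close>, and the coefficient of \<open>v j\<close>
  is 1 by \<open>r_step\<close>. The latter is available for \<open>j \<ge> 0\<close> only; at
  negative \<open>j\<close> the support of \<open>v\<close> takes over.\<close>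

lemma B_A:
  assumes "supported v"
  shows "B (A v) j = A (B v) j + v j"
proof -
  have q': "r (j + 1) * q (j + 2) = q (j + 1) * r (j + int m)"
    using r_mult_q[of "j + 1"] by (simp add: add_ac)
  have "B (A v) j - A (B v) j =
      v j * (r (j + 1) - r j + q (j - int m + 2) - q (j + 1)) +
      v (j + int m) * (r (j + 1) * q (j + 2) - q (j + 1) * r (j + int m))"
    by (simp add: A_def B_def algebra_simps)
  also have "\<dots> = v j * (r (j + 1) - r j + q (j - int m + 2) - q (j + 1))"
    by (simp add: q')
  also have "\<dots> = v j"
    using assms r_step[of j] by (cases "j < 0") (simp_all add: supported_def)
  finally show ?thesis by (simp add: algebra_simps)
qed

lemma A_linear: "A (\<lambda>j. c * v j + w j) = (\<lambda>j. c * A v j + A w j)"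
  by (simp add: A_def fun_eq_iff algebra_simps)

lemma B_linear: "B (\<lambda>j. c * v j + w j) = (\<lambda>j. c * B v j + B w j)"
  by (simp add: B_def fun_eq_iff algebra_simps)

lemma B_funpow_linear: "(B ^^ b) (\<lambda>j. c * v j + w j) = (\<lambda>j. c * (B ^^ b) v j + (B ^^ b) w j)"
  by (induction b) (simp_all add: B_linear)

lemma A_funpow_e: "k < m \<Longrightarrow> (A ^^ k) (e 0) = e (int k)"
proof (induction k)
  case (Suc k)
  have "A (e (int k)) j = e (int (Suc k)) j" for j
    using Suc.prems by (auto simp: A_def e_def q_nonpos)
  then show ?case using Suc by auto
qed simp

text \<open>On powers of \<open>A\<close> the operator \<open>B\<close> is derivative plus
  multiplication by the power \<open>m - 1\<close>. The commutator drives the induction. Its start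
  holds because \<open>r 0 = 0\<close>, so that \<open>B (e 0)\<close> is the basis vector
  \<open>m - 1\<close>, which \<open>A\<close> also reaches from \<open>e 0\<close> in
  \<open>m - 1\<close> steps.\<close>

lemma B_A_funpow:
  "B ((A ^^ a) (e 0)) = (\<lambda>j. of_nat a * (A ^^ (a - 1)) (e 0) j + (A ^^ (a + m - 1)) (e 0) j)"
proof (induction a)
  case 0
  have "(A ^^ (m - 1)) (e 0) = e (int m - 1)"
    using m_ge A_funpow_e[of "m - 1"] by (simp add: of_nat_diff)
  moreover have "B (e 0) = e (int m - 1)"
    using m_ge by (auto simp: B_def e_def r_nonpos fun_eq_iff)
  ultimately show ?case by simp
next
  case (Suc a)
  let ?v = "\<lambda>k. (A ^^ k) (e 0)"
  have "of_nat a * A (?v (a - 1)) j = of_nat a * ?v a j" for j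
    by (cases a) simp_all
  moreover have "A (?v (a + m - 1)) = ?v (Suc a + m - 1)"
    using m_ge by (cases m) simp_all
  ultimately have "A (B (?v a)) j = of_nat a * ?v a j + ?v (Suc a + m - 1) j" for j
    unfolding Suc.IH A_linear by simp
  then show ?case
    by (simp add: fun_eq_iff B_A[OF supported_A_funpow] algebra_simps)
qed

lemma moment_Suc: "moment a (Suc b) = of_nat a * moment (a - 1) b + moment (a + m - 1) b"
  unfolding moment_def funpow_Suc_right comp_apply B_A_funpow B_funpow_linear ..

text \<open>At an index this low, the raising part of \<open>B\<close> would draw on a negative
  index, where the vector vanishes. Only the lowering part, with its factors \<open>r\<close>,
  contributes.\<close>

lemma B_funpow_low:
  assumes "supported v"
  shows "j \<ge> 0 \<Longrightarrow> j + int k < int m \<Longrightarrow>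
    (B ^^ k) v j = (\<Prod>a<k. r (j + 1 + int a)) * v (j + int k)"
proof (induction k arbitrary: j)
  case (Suc k)
  have "(B ^^ k) v (j - int m + 1) = 0"
    using supported_B_funpow[OF assms, of k] Suc.prems unfolding supported_def by simp
  then have "(B ^^ Suc k) v j = r (j + 1) * (B ^^ k) v (j + 1)"
    by (simp add: B_def)
  also have "\<dots> = r (j + 1) * ((\<Prod>a<k. r (j + 1 + 1 + int a)) * v (j + 1 + int k))"
    using Suc by simp
  also have "\<dots> = (\<Prod>a<Suc k. r (j + 1 + int a)) * v (j + int (Suc k))"
    by (subst prod.lessThan_Suc_shift) (simp add: algebra_simps)
  finally show ?case .
qed simp

text \<open>Both sides equal \<open>q 1\<close> times the coefficient at index \<open>m - 1\<close>:
  one step of \<open>A\<close> picks it up directly, and \<open>m - 1\<close> lowering steps of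
  \<open>B\<close> collect the product in \<open>q 1\<close>. This is integration by parts in
  \<open>y\<close>.\<close>

lemma moment_Suc_0: "moment (Suc a) 0 = g * moment a (m - 1)"
proof -
  let ?v = "(A ^^ a) (e 0)"
  have "A ?v 0 = q 1 * ?v (int m - 1)"
    using supported_A_funpow[of a] by (simp add: A_def supported_def)
  moreover have "(B ^^ (m - 1)) ?v 0 = (\<Prod>a<m-1. r (1 + int a)) * ?v (int m - 1)"
    using B_funpow_low[OF supported_A_funpow, of 0 "m - 1" a] m_ge by (simp add: of_nat_diff)
  ultimately show ?thesis
    by (simp add: moment_def q_eq)
qed

lemma moment_0_0: "moment 0 0 = 1"
  by (simp add: moment_def e_def)

lemma moment_1_1: "moment 1 1 = r 1"
  using m_ge A_funpow_e[of 1] by (simp add: moment_def B_def e_def)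

end


text \<open>
  \<open>gauss_moment m a b\<close> is the value at \<open>x\<^sup>a y\<^sup>b exp ((x\<^sup>m + g y\<^sup>m) / m)\<close> of the functional with
  \<open>x\<^sup>i y\<^sup>j \<mapsto> i!\<close> if \<open>i = j\<close> and \<open>0\<close> otherwise, as a series in \<open>g\<close>.
\<close>

definition gauss_moment :: "nat \<Rightarrow> nat \<Rightarrow> nat \<Rightarrow> rat fps" where
  "gauss_moment m a b = Abs_fps (\<lambda>k.
     if a \<le> b + m * k \<and> m dvd (b + m * k - a)
     then let l = (b + m * k - a) div m
          in fact (b + m * k) / (of_nat m ^ l * fact l * (of_nat m ^ k * fact k))
     else 0)"

text \<open>The exponents \<open>l\<close> and \<open>k\<close> say how often \<open>x^m / m\<close>
  and \<open>g y^m / m\<close> are taken from the exponential; the functional keeps the term only if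
  the total degrees in \<open>x\<close> and \<open>y\<close> agree.\<close>

lemma gauss_moment_nth:
  assumes "m > 0" and "a + m * l = b + m * k"
  shows "fps_nth (gauss_moment m a b) k =
    fact (a + m * l) / (of_nat m ^ l * fact l * (of_nat m ^ k * fact k))"
proof -
  have "b + m * k - a = m * l" "a \<le> b + m * k" using assms(2) by simp_all
  then show ?thesis using assms by (simp add: gauss_moment_def)
qed

lemma gauss_moment_nth_0:
  assumes "\<And>l. a + m * l \<noteq> b + m * k"
  shows "fps_nth (gauss_moment m a b) k = 0"
proof -
  have "\<not> (a \<le> b + m * k \<and> m dvd (b + m * k - a))"
    using assms by (metis dvdE le_add_diff_inverse)
  then show ?thesis unfolding gauss_moment_def by (simp only: fps_nth_Abs_fps if_False)
qed

text \<open>Integration by parts in \<open>x\<close>: the leading factor \<open>a + m l\<close> of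
  the factorial splits. The part \<open>a\<close> lowers the power of \<open>x\<close>, the part
  \<open>m l\<close> cancels against \<open>m^l l!\<close> and leaves one factor
  \<open>x^m / m\<close> less.\<close>

lemma gauss_moment_Suc:
  assumes "m > 0"
  shows "gauss_moment m a (Suc b) =
    of_nat a * gauss_moment m (a - 1) b + gauss_moment m (a + m - 1) b"
proof (rule fps_ext)
  fix k
  let ?M = "\<lambda>a b. fps_nth (gauss_moment m a b) k"
  have "?M a (Suc b) = of_nat a * ?M (a - 1) b + ?M (a + m - 1) b"
  proof (cases "\<exists>l. a + m * l = Suc b + m * k")
    case True
    then obtain l where l: "a + m * l = Suc b + m * k" by blast
    define c where "c = of_nat m ^ l * fact l * (of_nat m ^ k * (fact k :: rat))"
    have "c \<noteq> 0" using assms by (simp add: c_def)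
    have "?M a (Suc b) = fact (a + m * l) / c"
      unfolding c_def by (rule gauss_moment_nth[OF assms l])
    also have "\<dots> = of_nat (a + m * l) * fact (b + m * k) / c"
      unfolding l by simp
    also have "\<dots> = of_nat a * (fact (b + m * k) / c) + of_nat (m * l) * (fact (b + m * k) / c)"
      by (simp add: algebra_simps add_divide_distrib)
    also have "of_nat a * (fact (b + m * k) / c) = of_nat a * ?M (a - 1) b"
    proof (cases a)
      case (Suc a')
      then have l': "a' + m * l = b + m * k" using l by simp
      show ?thesis using gauss_moment_nth[OF assms l'] unfolding l' by (simp add: Suc c_def)
    qed simp
    also have "of_nat (m * l) * (fact (b + m * k) / c) = ?M (a + m - 1) b"
    proof (cases l)
      case 0
      have "a + m - 1 + m * l' \<noteq> b + m * k" for l'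
        using l assms by (simp add: 0)
      then show ?thesis by (simp add: 0 gauss_moment_nth_0)
    next
      case (Suc l')
      then have l': "a + m - 1 + m * l' = b + m * k" using l assms by (simp add: algebra_simps)
      have "c = of_nat (m * l) * (of_nat m ^ l' * fact l' * (of_nat m ^ k * fact k))"
        unfolding c_def Suc by (simp add: field_simps)
      then show ?thesis
        using gauss_moment_nth[OF assms l'] \<open>c \<noteq> 0\<close> unfolding l' by simp
    qed
    finally show ?thesis .
  next
    case False
    have "a - 1 + m * l \<noteq> b + m * k" if "a > 0" for l
    proof
      assume "a - 1 + m * l = b + m * k"
      then have "a + m * l = Suc b + m * k" using that by simp
      then show False using False by blast
    qed
    moreover have "a + m - 1 + m * l \<noteq> b + m * k" for l
    proof
      assume "a + m - 1 + m * l = b + m * k"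
      then have "a + m * Suc l = Suc b + m * k" using assms by simp
      then show False using False by blast
    qed
    moreover have "?M a (Suc b) = 0"
      by (rule gauss_moment_nth_0) (use False in blast)
    ultimately show ?thesis
      by (cases "a = 0") (simp_all add: gauss_moment_nth_0)
  qed
  then show "?M a (Suc b) =
      fps_nth (of_nat a * gauss_moment m (a - 1) b + gauss_moment m (a + m - 1) b) k"
    by (simp add: fps_mult_of_nat_nth)
qed

text \<open>Integration by parts in \<open>y\<close>: the leading factor \<open>m k\<close> of
  \<open>(m k)!\<close> cancels against \<open>m^k k!\<close>, which costs one power of
  \<open>g\<close>.\<close>

lemma gauss_moment_Suc_0:
  assumes "m > 0"
  shows "gauss_moment m (Suc a) 0 = fps_X * gauss_moment m a (m - 1)"
proof (rule fps_ext)
  fix k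
  show "fps_nth (gauss_moment m (Suc a) 0) k = fps_nth (fps_X * gauss_moment m a (m - 1)) k"
  proof (cases k)
    case 0
    then show ?thesis by (simp add: gauss_moment_nth_0)
  next
    case (Suc j)
    have iff: "Suc a + m * l = 0 + m * k \<longleftrightarrow> a + m * l = m - 1 + m * j" for l
      using assms by (auto simp: Suc)
    show ?thesis
    proof (cases "\<exists>l. a + m * l = m - 1 + m * j")
      case True
      then obtain l where l: "a + m * l = m - 1 + m * j" by blast
      have l': "Suc a + m * l = 0 + m * k" using l iff by blast
      have "fps_nth (gauss_moment m (Suc a) 0) k =
          of_nat (m * k) * fact (a + m * l) / (of_nat m ^ l * fact l * (of_nat m ^ k * fact k))"
      proof -
        have mk: "m * k = Suc (a + m * l)" using l' by simp
        show ?thesis unfolding gauss_moment_nth[OF assms l'] mk by simp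
      qed
      also have "\<dots> = fps_nth (gauss_moment m a (m - 1)) j"
      proof -
        have "of_nat m ^ k * (fact k :: rat) = of_nat (m * k) * (of_nat m ^ j * fact j)"
          unfolding Suc by (simp add: field_simps)
        moreover have "of_nat (m * k) \<noteq> (0 :: rat)"
          unfolding of_nat_eq_0_iff using assms by (simp add: Suc)
        ultimately show ?thesis
          unfolding gauss_moment_nth[OF assms l] by (simp del: of_nat_mult)
      qed
      finally show ?thesis by (simp add: Suc)
    next
      case False
      then have "fps_nth (gauss_moment m (Suc a) 0) k = 0"
        by (intro gauss_moment_nth_0) (use iff in blast)
      moreover have "fps_nth (gauss_moment m a (m - 1)) j = 0"
        by (rule gauss_moment_nth_0) (use False in blast)
      ultimately show ?thesis by (simp add: Suc)
    qed
  qed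
qed

text \<open>The two recursions determine all moments from the one with \<open>a = b = 0\<close>.\<close>

lemma gauss_moment_eq:
  assumes "string_equations m fps_X r q"
  shows "gauss_moment m a b = gauss_moment m 0 0 * string_equations.moment m r q a b"
proof -
  interpret string_equations m fps_X r q by fact
  have m: "m > 0" using m_ge by simp
  define D where "D a b = gauss_moment m a b - gauss_moment m 0 0 * moment a b" for a b
  have D_Suc: "D a (Suc b) = of_nat a * D (a - 1) b + D (a + m - 1) b" for a b
    unfolding D_def gauss_moment_Suc[OF m] moment_Suc by (simp add: algebra_simps)
  have D_Suc_0: "D (Suc a) 0 = fps_X * D a (m - 1)" for a
    unfolding D_def gauss_moment_Suc_0[OF m] moment_Suc_0 by (simp add: algebra_simps)
  \<comment> \<open>Lexicographic induction on \<open>k\<close> and \<open>b\<close>. Lowering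
    \<open>b\<close> may raise \<open>a\<close>, which is therefore arbitrary; at
    \<open>b = 0\<close> the factor \<open>fps_X\<close> lowers \<open>k\<close>, so that resetting
    \<open>b\<close> to \<open>m - 1\<close> is harmless.\<close>
  have "fps_nth (D a b) k = 0" for a b k
  proof (induction k arbitrary: a b rule: less_induct)
    case (less k)
    show ?case
    proof (induction b arbitrary: a)
      case 0
      show ?case
      proof (cases a)
        case 0
        then show ?thesis by (simp add: D_def moment_0_0)
      next
        case (Suc a')
        then show ?thesis using less.IH by (cases k) (simp_all add: D_Suc_0)
      qed
    next
      case (Suc b)
      then show ?case by (simp add: D_Suc fps_mult_of_nat_nth)
    qed
  qed
  then have "D a b = 0" by (intro fps_ext) simp
  then show ?thesis by (simp add: D_def)
qed

section \<open>From the integer system to the string equations\<close>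

definition rat_fps :: "int fps \<Rightarrow> rat fps" where
  "rat_fps f = Abs_fps (\<lambda>n. of_int (fps_nth f n))"

lemma rat_fps_simps [simp]:
  "rat_fps 0 = 0" "rat_fps 1 = 1" "rat_fps fps_X = fps_X"
  "rat_fps (f + h) = rat_fps f + rat_fps h" "rat_fps (f - h) = rat_fps f - rat_fps h"
  "rat_fps (f * h) = rat_fps f * rat_fps h"
  by (simp_all add: rat_fps_def fps_eq_iff fps_mult_nth)

lemma rat_fps_prod: "rat_fps (prod f S) = (\<Prod>x\<in>S. rat_fps (f x))"
  by (induction S rule: infinite_finite_induct) simp_all

lemma series_system_string_equations:
  assumes "series_system m r q" and "m \<ge> 2"
  shows "string_equations m fps_X (\<lambda>i. if i \<le> 0 then 0 else rat_fps (r i)) (\<lambda>i. rat_fps (q i))"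
proof
  have r: "r i = of_int i + (\<Sum>a=0..m-2. q (i - int a))" if "i \<ge> 1" for i
    using assms that by (simp add: series_system_def)
  have q: "q i = fps_X * (\<Prod>a=0..m-2. r (i + int a))" if "i \<ge> 1" for i
    using assms that by (simp add: series_system_def)
  have q0: "q i = 0" if "i \<le> 0" for i
    using assms that by (simp add: series_system_def)
  have idx: "{0..m-2} = {..<m-1}" using assms(2) by auto
  define s where "s i = (if i \<le> 0 then 0 else r i)" for i
  \<comment> \<open>At \<open>i = 0\<close> only terms \<open>q\<close> at indices up to 0 occur, so
    the formula gives the chosen value 0 and consecutive equations can be subtracted from there
    on.\<close>
  have s: "s i = of_int i + (\<Sum>a<m-1. q (i - int a))" if "i \<ge> 0" for i
    using that r[of i] by (auto simp: s_def idx q0)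
  show "(if i + 1 \<le> 0 then 0 else rat_fps (r (i + 1))) =
      (if i \<le> 0 then 0 else rat_fps (r i)) + 1 + rat_fps (q (i + 1)) - rat_fps (q (i - int m + 2))"
    if i: "i \<ge> 0" for i
  proof -
    obtain k where k: "m - 1 = Suc k" using assms(2) by (cases "m - 1") auto
    have "(\<Sum>a<m-1. q (i + 1 - int a)) = q (i + 1) + (\<Sum>a<k. q (i - int a))"
      unfolding k by (subst sum.lessThan_Suc_shift) (simp add: algebra_simps)
    moreover have "(\<Sum>a<m-1. q (i - int a)) = (\<Sum>a<k. q (i - int a)) + q (i - int m + 2)"
    proof -
      have "i - int k = i - int m + 2" using k assms(2) by simp
      then show ?thesis unfolding k sum.lessThan_Suc by (simp only:)
    qed
    ultimately have "s (i + 1) = s i + 1 + q (i + 1) - q (i - int m + 2)"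
      using i by (simp add: s algebra_simps)
    then have "rat_fps (s (i + 1)) = rat_fps (s i + 1 + q (i + 1) - q (i - int m + 2))" by simp
    then show ?thesis using i by (cases "i = 0") (simp_all add: s_def)
  qed
  show "rat_fps (q i) = fps_X * (\<Prod>a<m-1. if i + int a \<le> 0 then 0 else rat_fps (r (i + int a)))" for i
  proof (cases "i \<ge> 1")
    case True
    then show ?thesis by (simp add: q idx rat_fps_prod)
  next
    case False
    then have "(\<Prod>a<m-1. if i + int a \<le> 0 then 0 else rat_fps (r (i + int a))) = 0"
      using assms(2) by (intro prod_zero) (auto intro!: bexI[of _ 0])
    then show ?thesis using False by (simp add: q0)
  qed
qed (use assms in auto)

text \<open>The coefficients of \<open>Z\<close>: the number of pairs of permutations of
  \<open>m * n\<close> edges with all cycles of length \<open>m\<close>, divided by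
  \<open>(m n)!\<close>.\<close>

definition map_weight :: "nat \<Rightarrow> nat \<Rightarrow> rat" where
  "map_weight m n = fact (m * n) / (of_nat m ^ n * fact n)\<^sup>2"

text \<open>The value at \<open>x y\<close> is \<open>r_1\<close> times the value at 1, and raising
  the common degree from \<open>m n\<close> to \<open>m n + 1\<close> multiplies the factorial by
  \<open>m n + 1\<close>.\<close>

lemma map_weight_r_1:
  assumes "series_system m r q" and "m \<ge> 2"
  shows "(\<Sum>k=0..n. map_weight m (n - k) * of_int (fps_nth (r 1) k)) =
    of_nat (Suc (m * n)) * map_weight m n"
proof -
  let ?r = "\<lambda>i. if i \<le> 0 then 0 else rat_fps (r i)" and ?q = "\<lambda>i. rat_fps (q i)"
  interpret string_equations m fps_X ?r ?q
    by (rule series_system_string_equations) fact+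
  have m: "m > 0" using assms(2) by simp
  have z: "fps_nth (gauss_moment m 0 0) k = map_weight m k" for k
    using gauss_moment_nth[OF m, of 0 k 0 k] by (simp add: map_weight_def power2_eq_square)
  have "gauss_moment m 1 1 = gauss_moment m 0 0 * rat_fps (r 1)"
    using gauss_moment_eq[OF string_equations_axioms, of 1 1] moment_1_1 by simp
  then have "fps_nth (gauss_moment m 1 1) n = (\<Sum>k=0..n. map_weight m k * of_int (fps_nth (r 1) (n - k)))"
    by (simp add: fps_mult_nth z rat_fps_def)
  also have "\<dots> = (\<Sum>k=0..n. map_weight m (n - k) * of_int (fps_nth (r 1) k))"
    by (subst sum.atLeastAtMost_rev) simp
  finally show ?thesis
    using gauss_moment_nth[OF m, of 1 n 1 n] by (simp add: map_weight_def power2_eq_square)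
qed

section \<open>Permutations with all cycles of the same length\<close>

definition mperms :: "nat \<Rightarrow> 'a set \<Rightarrow> ('a \<Rightarrow> 'a) set" where
  "mperms m E = {\<sigma>. \<sigma> permutes E \<and> (\<forall>x\<in>E. card (orbit \<sigma> x) = m)}"

lemma finite_mperms: "finite E \<Longrightarrow> finite (mperms m E)"
  by (rule finite_subset[OF _ finite_permutations[of E]]) (auto simp: mperms_def)

lemma mperms_empty [simp]: "mperms m {} = {id}"
  by (auto simp: mperms_def)

lemma self_in_orbit: "\<sigma> permutes E \<Longrightarrow> finite E \<Longrightarrow> x \<in> orbit \<sigma> x"
  by (rule permutation_self_in_orbit) (auto simp: permutation_permutes)

section \<open>Splitting a permutation along an invariant set\<close>

lemma perm_restrict_permutes:
  assumes "\<sigma> permutes E" and "finite S" and "\<sigma> ` S \<subseteq> S"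
  shows "perm_restrict \<sigma> S permutes S"
proof (rule bij_imp_permutes)
  have "inj_on \<sigma> S" using assms(1) by (rule permutes_inj_on)
  then have "bij_betw \<sigma> S S"
    using endo_inj_surj[OF assms(2,3)] by (simp add: bij_betw_def)
  then show "bij_betw (perm_restrict \<sigma> S) S S"
    by (rule bij_betw_cong[THEN iffD1, rotated]) (simp add: perm_restrict_simps)
qed (simp add: perm_restrict_simps)

text \<open>By finiteness, a set mapped into itself is mapped onto itself, so its complement is
  closed too.\<close>

lemma permutes_image_Diff:
  assumes "\<sigma> permutes E" and "finite K" and "\<sigma> ` K \<subseteq> K"
  shows "\<sigma> ` (E - K) \<subseteq> E - K"
proof -
  have "\<sigma> ` K = K" using endo_inj_surj[OF assms(2,3)] permutes_inj_on[OF assms(1)] by blast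
  then show ?thesis
    using permutes_image[OF assms(1)] permutes_inj[OF assms(1)] by (simp add: image_set_diff)
qed

lemma orbit_perm_restrict:
  assumes "x \<in> S" and "\<sigma> ` S \<subseteq> S"
  shows "orbit (perm_restrict \<sigma> S) x = orbit \<sigma> x"
  by (rule orbit_cong0[symmetric, of _ S]) (use assms in \<open>auto simp: perm_restrict_simps\<close>)

lemma perm_restrict_mperms:
  assumes "\<sigma> \<in> mperms m E" and "finite S" and "S \<subseteq> E" and "\<sigma> ` S \<subseteq> S"
  shows "perm_restrict \<sigma> S \<in> mperms m S"
  using assms perm_restrict_permutes[of \<sigma> E S] orbit_perm_restrict[of _ S \<sigma>]
  by (auto simp: mperms_def)

lemma perm_restrict_split:
  assumes "\<sigma> permutes E" and "finite E" and "K \<subseteq> E" and "\<sigma> ` K \<subseteq> K"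
  shows "perm_restrict \<sigma> K \<circ> perm_restrict \<sigma> (E - K) = \<sigma>"
proof -
  have K: "finite K" using assms(2,3) finite_subset by blast
  have "perm_restrict \<sigma> K \<circ> perm_restrict \<sigma> (E - K) = perm_restrict \<sigma> (K \<union> (E - K))"
    by (rule perm_restrict_union)
      (use perm_restrict_permutes[OF assms(1)] K permutes_image_Diff[OF assms(1) K assms(4)] assms(2,4) in auto)
  also have "K \<union> (E - K) = E" using assms(3) by blast
  finally show ?thesis using assms(1) by (simp only: perm_restrict_id)
qed

lemma comp_permutes_on:
  assumes "\<alpha> permutes K" and "\<beta> permutes L" and "K \<inter> L = {}"
  shows "x \<in> K \<Longrightarrow> (\<alpha> \<circ> \<beta>) x = \<alpha> x" and "x \<in> L \<Longrightarrow> (\<alpha> \<circ> \<beta>) x = \<beta> x"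
proof -
  show "(\<alpha> \<circ> \<beta>) x = \<alpha> x" if "x \<in> K"
    using that assms by (simp add: permutes_not_in[OF assms(2)] disjoint_iff)
  show "(\<alpha> \<circ> \<beta>) x = \<beta> x" if "x \<in> L"
  proof -
    have "\<beta> x \<notin> K" using that assms permutes_in_image[OF assms(2)] by blast
    then show ?thesis by (simp add: permutes_not_in[OF assms(1)])
  qed
qed

lemma perm_restrict_comp_permutes:
  assumes "\<alpha> permutes K" and "\<beta> permutes L" and "K \<inter> L = {}"
  shows "perm_restrict (\<alpha> \<circ> \<beta>) K = \<alpha>" and "perm_restrict (\<alpha> \<circ> \<beta>) L = \<beta>"
  using comp_permutes_on[OF assms] permutes_not_in[OF assms(1)] permutes_not_in[OF assms(2)]
  by (auto simp: perm_restrict_def fun_eq_iff)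

lemma comp_mperms:
  assumes "\<alpha> \<in> mperms m K" and "\<beta> \<in> mperms m (E - K)" and "K \<subseteq> E"
  shows "\<alpha> \<circ> \<beta> \<in> mperms m E" and "(\<alpha> \<circ> \<beta>) ` K \<subseteq> K"
proof -
  have \<alpha>: "\<alpha> permutes K" and \<beta>: "\<beta> permutes (E - K)"
    using assms unfolding mperms_def by auto
  note on = comp_permutes_on[OF \<alpha> \<beta> Diff_disjoint]
  have K: "(\<alpha> \<circ> \<beta>) ` K \<subseteq> K" and L: "(\<alpha> \<circ> \<beta>) ` (E - K) \<subseteq> E - K"
    using on permutes_in_image[OF \<alpha>] permutes_in_image[OF \<beta>] by auto
  have "\<alpha> \<circ> \<beta> permutes E"
    by (rule permutes_compose)
      (use permutes_subset[OF \<alpha> assms(3)] permutes_subset[OF \<beta> Diff_subset] in auto)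
  moreover have "card (orbit (\<alpha> \<circ> \<beta>) x) = m" if "x \<in> E" for x
  proof (cases "x \<in> K")
    case True
    then have "orbit (\<alpha> \<circ> \<beta>) x = orbit \<alpha> x"
      using K on by (intro orbit_cong0[of _ K]) auto
    then show ?thesis using True assms(1) by (simp add: mperms_def)
  next
    case False
    then have "orbit (\<alpha> \<circ> \<beta>) x = orbit \<beta> x"
      using L on that by (intro orbit_cong0[of _ "E - K"]) auto
    then show ?thesis using False that assms(2) by (simp add: mperms_def)
  qed
  ultimately show "\<alpha> \<circ> \<beta> \<in> mperms m E" by (simp add: mperms_def)
  show "(\<alpha> \<circ> \<beta>) ` K \<subseteq> K" by (rule K)
qed

section \<open>Counting by the cycle of a marked element\<close>

lemma orbit_full:
  assumes "\<sigma> \<in> mperms m C" and "finite C" and "card C = m" and "x \<in> C"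
  shows "orbit \<sigma> x = C"
proof (rule card_subset_eq[OF assms(2)])
  show "orbit \<sigma> x \<subseteq> C"
    using assms by (intro permutes_orbit_subset) (auto simp: mperms_def)
qed (use assms in \<open>simp add: mperms_def\<close>)

text \<open>Such a permutation is a single cycle, written uniquely as a list that starts with
  \<open>e\<close>; the other elements may come in any order.\<close>

lemma card_cyclic_perms:
  assumes "finite C" and "e \<in> C"
  shows "card (mperms (card C) C) = fact (card C - 1)"
proof -
  let ?L = "permutations_of_set (C - {e})"
  have "bij_betw (\<lambda>ys. cycle_of_list (e # ys)) ?L (mperms (card C) C)"
  proof (rule bij_betw_imageI)
    have L: "distinct (e # ys)" "set (e # ys) = C" if "ys \<in> ?L" for ys
      using that assms by (auto simp: permutations_of_set_def)
    \<comment> \<open>Iterating the cycle rotates its list. Hence the entry at position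
      \<open>i\<close> is the \<open>i\<close>-th iterate of \<open>e\<close>, which recovers the
      list from the permutation.\<close>
    have pow: "((cycle_of_list cs) ^^ k) (cs ! i) = cs ! ((k + i) mod length cs)"
      if "distinct cs" "i < length cs" for cs :: "'a list" and i k
    proof -
      have "map ((cycle_of_list cs) ^^ k) cs ! i = rotate k cs ! i"
        using cyclic_rotation[OF that(1)] by simp
      then show ?thesis using that(2) by (simp add: nth_rotate)
    qed
    show "inj_on (\<lambda>ys. cycle_of_list (e # ys)) ?L"
    proof (rule inj_onI)
      fix ys zs assume ys: "ys \<in> ?L" and zs: "zs \<in> ?L"
        and eq: "cycle_of_list (e # ys) = cycle_of_list (e # zs)"
      have len: "length (e # ys) = card C" "length (e # zs) = card C"
        using distinct_card[OF L(1)[OF ys]] distinct_card[OF L(1)[OF zs]] L(2)[OF ys] L(2)[OF zs]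
        by simp_all
      have "e # ys = e # zs"
      proof (rule nth_equalityI)
        show "length (e # ys) = length (e # zs)" using len by simp
        fix i assume "i < length (e # ys)"
        then show "(e # ys) ! i = (e # zs) ! i"
          using pow[OF L(1)[OF ys], of 0 i] pow[OF L(1)[OF zs], of 0 i] len eq by simp
      qed
      then show "ys = zs" by simp
    qed
    show "(\<lambda>ys. cycle_of_list (e # ys)) ` ?L = mperms (card C) C"
    proof safe
      fix ys assume ys: "ys \<in> ?L"
      let ?cs = "e # ys"
      have per: "cycle_of_list ?cs permutes C"
        using cycle_permutes[of ?cs] L(2)[OF ys] by simp
      have "orbit (cycle_of_list ?cs) x = C" if "x \<in> C" for x
      proof
        show "orbit (cycle_of_list ?cs) x \<subseteq> C" by (rule permutes_orbit_subset[OF per that])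
        show "C \<subseteq> orbit (cycle_of_list ?cs) x"
        proof
          fix y assume "y \<in> C"
          then have "x \<in> set ?cs" "y \<in> set ?cs" using that L(2)[OF ys] by simp_all
          then obtain i j where i: "i < length ?cs" "x = ?cs ! i" and j: "j < length ?cs" "y = ?cs ! j"
            unfolding in_set_conv_nth by blast
          \<comment> \<open>Orbits consist of positive iterates, so a full turn is added to keep the
            exponent positive also when \<open>j \<le> i\<close>.\<close>
          define k where "k = length ?cs + j - i"
          have k: "k + i = length ?cs + j" "k > 0" using i(1) j(1) unfolding k_def by linarith+
          have "(k + i) mod length ?cs = j" unfolding k(1) using j(1) by (simp only: mod_add_self1 mod_less)
          then have "((cycle_of_list ?cs) ^^ k) x = y"
            using pow[OF L(1)[OF ys] i(1), of k] i(2) j(2) by (simp only:)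
          then show "y \<in> orbit (cycle_of_list ?cs) x"
            using k(2) unfolding orbit_altdef by blast
        qed
      qed
      then show "cycle_of_list ?cs \<in> mperms (card C) C"
        using per by (simp add: mperms_def)
    next
      fix \<sigma> assume \<sigma>: "\<sigma> \<in> mperms (card C) C"
      then have per: "\<sigma> permutes C" by (simp add: mperms_def)
      then have perm: "permutation \<sigma>" using assms(1) by (auto simp: permutation_permutes)
      let ?cs = "support \<sigma> e"
      have "set ?cs = orbit \<sigma> e"
        using support_set[OF perm, of e] orbit_altdef_permutation[OF perm, of e] by auto
      then have set: "set ?cs = C" using orbit_full[OF \<sigma> assms(1) refl assms(2)] by simp
      have dist: "distinct ?cs" using cycle_of_permutation[OF perm] .
      have "least_power \<sigma> e > 0" using least_power_of_permutation(2)[OF perm] .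
      define ys where "ys = map (\<lambda>i. (\<sigma> ^^ i) e) [1..<least_power \<sigma> e]"
      have cs: "?cs = e # ys"
        using \<open>least_power \<sigma> e > 0\<close> by (simp add: upt_conv_Cons ys_def)
      have "cycle_of_list ?cs x = \<sigma> x" for x
      proof (cases "x \<in> C")
        case True
        then show ?thesis using cycle_restrict[OF perm, of x e] set by simp
      next
        case False
        then show ?thesis using id_outside_supp[of x ?cs] set permutes_not_in[OF per] by simp
      qed
      then have "\<sigma> = cycle_of_list (e # ys)"
        unfolding cs by (intro ext) simp
      moreover have "ys \<in> ?L"
        using dist set unfolding cs permutations_of_set_def by auto
      ultimately show "\<sigma> \<in> (\<lambda>ys. cycle_of_list (e # ys)) ` ?L" by blast
    qed
  qed
  then have "card (mperms (card C) C) = card ?L" by (simp add: bij_betw_same_card)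
  then show ?thesis using assms by simp
qed

lemma card_mperms_orbit:
  assumes "finite E" and "C \<subseteq> E" and "e \<in> C"
  shows "card {\<sigma> \<in> mperms m E. orbit \<sigma> e = C} =
    (if card C = m then fact (m - 1) * card (mperms m (E - C)) else 0)"
proof (cases "card C = m")
  case True
  have C: "finite C" using assms finite_subset by blast
  have "bij_betw (\<lambda>\<sigma>. (perm_restrict \<sigma> C, perm_restrict \<sigma> (E - C)))
      {\<sigma> \<in> mperms m E. orbit \<sigma> e = C} (mperms m C \<times> mperms m (E - C))"
  proof (rule bij_betwI[where g = "\<lambda>(\<alpha>, \<beta>). \<alpha> \<circ> \<beta>"])
    have cl: "\<sigma> ` C \<subseteq> C" if "\<sigma> \<in> mperms m E" "orbit \<sigma> e = C" for \<sigma>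
      using that(2) by (auto intro: orbit.step)
    show "(\<lambda>\<sigma>. (perm_restrict \<sigma> C, perm_restrict \<sigma> (E - C))) \<in>
        {\<sigma> \<in> mperms m E. orbit \<sigma> e = C} \<rightarrow> mperms m C \<times> mperms m (E - C)"
    proof
      fix \<sigma> assume "\<sigma> \<in> {\<sigma> \<in> mperms m E. orbit \<sigma> e = C}"
      then have \<sigma>: "\<sigma> \<in> mperms m E" "\<sigma> ` C \<subseteq> C" using cl by simp_all
      then have "\<sigma> ` (E - C) \<subseteq> E - C"
        using C by (intro permutes_image_Diff) (simp_all add: mperms_def)
      then show "(perm_restrict \<sigma> C, perm_restrict \<sigma> (E - C)) \<in> mperms m C \<times> mperms m (E - C)"
        using perm_restrict_mperms[OF \<sigma>(1)] \<sigma>(2) C assms by simp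
    qed
    show "(\<lambda>(\<alpha>, \<beta>). \<alpha> \<circ> \<beta>) \<in> mperms m C \<times> mperms m (E - C) \<rightarrow> {\<sigma> \<in> mperms m E. orbit \<sigma> e = C}"
    proof safe
      fix \<alpha> \<beta> assume *: "\<alpha> \<in> mperms m C" "\<beta> \<in> mperms m (E - C)"
      show "\<alpha> \<circ> \<beta> \<in> mperms m E" by (rule comp_mperms[OF * assms(2)])
      have "orbit (\<alpha> \<circ> \<beta>) e = orbit \<alpha> e"
        using comp_mperms(2)[OF * assms(2)] comp_permutes_on(1)[of \<alpha> C \<beta> "E - C"] * assms(3)
        by (intro orbit_cong0[of _ C]) (auto simp: mperms_def)
      then have "orbit (\<alpha> \<circ> \<beta>) e = C" using orbit_full[OF *(1) C True assms(3)] by simp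
      then show "x \<in> orbit (\<alpha> \<circ> \<beta>) e \<Longrightarrow> x \<in> C" "x \<in> C \<Longrightarrow> x \<in> orbit (\<alpha> \<circ> \<beta>) e" for x
        by simp_all
    qed
    show "(\<lambda>(\<alpha>, \<beta>). \<alpha> \<circ> \<beta>) (perm_restrict \<sigma> C, perm_restrict \<sigma> (E - C)) = \<sigma>"
      if "\<sigma> \<in> {\<sigma> \<in> mperms m E. orbit \<sigma> e = C}" for \<sigma>
      using that cl perm_restrict_split[OF _ assms(1,2)] by (simp add: mperms_def)
    show "(\<lambda>\<sigma>. (perm_restrict \<sigma> C, perm_restrict \<sigma> (E - C))) (case x of (\<alpha>, \<beta>) \<Rightarrow> \<alpha> \<circ> \<beta>) = x"
      if "x \<in> mperms m C \<times> mperms m (E - C)" for x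
      using that perm_restrict_comp_permutes[of "fst x" C "snd x" "E - C"]
      by (auto simp: mperms_def)
  qed
  then have "card {\<sigma> \<in> mperms m E. orbit \<sigma> e = C} = card (mperms m C \<times> mperms m (E - C))"
    by (rule bij_betw_same_card)
  then show ?thesis
    using card_cyclic_perms[OF C assms(3)] True by (simp add: card_cartesian_product)
next
  case False
  have "{\<sigma> \<in> mperms m E. orbit \<sigma> e = C} = {}"
    using False assms by (auto simp: mperms_def)
  then show ?thesis using False by (simp only: card.empty if_False)
qed

lemma card_subsets_containing:
  assumes "finite E" and "e \<in> E" and "k > 0"
  shows "card {C. C \<subseteq> E \<and> e \<in> C \<and> card C = k} = (card E - 1 choose (k - 1))"
proof -
  have "{C. C \<subseteq> E \<and> e \<in> C \<and> card C = k} = insert e ` {D. D \<subseteq> E - {e} \<and> card D = k - 1}"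
  proof (intro equalityI subsetI)
    fix C assume C: "C \<in> {C. C \<subseteq> E \<and> e \<in> C \<and> card C = k}"
    then have "C = insert e (C - {e})" "C - {e} \<subseteq> E - {e}" "card (C - {e}) = k - 1"
      using assms finite_subset by auto
    then show "C \<in> insert e ` {D. D \<subseteq> E - {e} \<and> card D = k - 1}" by blast
  next
    fix C assume "C \<in> insert e ` {D. D \<subseteq> E - {e} \<and> card D = k - 1}"
    then obtain D where D: "C = insert e D" "D \<subseteq> E - {e}" "card D = k - 1" by blast
    then have "finite D" "e \<notin> D" using assms finite_subset by auto
    then show "C \<in> {C. C \<subseteq> E \<and> e \<in> C \<and> card C = k}" using D assms by auto
  qed
  moreover have "inj_on (insert e) {D. D \<subseteq> E - {e} \<and> card D = k - 1}"
  proof (rule inj_onI)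
    fix D D' assume "D \<in> {D. D \<subseteq> E - {e} \<and> card D = k - 1}" "D' \<in> {D. D \<subseteq> E - {e} \<and> card D = k - 1}"
      and "insert e D = insert e D'"
    then show "D = D'" using insert_ident[of e D D'] by auto
  qed
  ultimately show ?thesis
    using assms by (simp add: card_image n_subsets)
qed

lemma card_mperms_rec:
  assumes "finite E" and "e \<in> E"
  shows "card (mperms m E) =
    (\<Sum>C | C \<subseteq> E \<and> e \<in> C \<and> card C = m. fact (m - 1) * card (mperms m (E - C)))"
proof -
  let ?S = "{C. C \<subseteq> E \<and> e \<in> C}"
  have fin: "finite ?S" using assms(1) by simp
  have "mperms m E = (\<Union>C\<in>?S. {\<sigma> \<in> mperms m E. orbit \<sigma> e = C})"
  proof -
    have "orbit \<sigma> e \<in> ?S" if "\<sigma> \<in> mperms m E" for \<sigma>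
    proof -
      have "\<sigma> permutes E" using that by (simp add: mperms_def)
      then show ?thesis using self_in_orbit[OF _ assms(1), of \<sigma> e] permutes_orbit_subset[OF _ assms(2)] by blast
    qed
    then show ?thesis by blast
  qed
  also have "card \<dots> = (\<Sum>C\<in>?S. card {\<sigma> \<in> mperms m E. orbit \<sigma> e = C})"
    by (rule card_UN_disjoint[OF fin]) (use finite_mperms[OF assms(1)] in auto)
  also have "\<dots> = (\<Sum>C\<in>?S. if card C = m then fact (m - 1) * card (mperms m (E - C)) else 0)"
    by (rule sum.cong) (use card_mperms_orbit[OF assms(1)] in auto)
  also have "\<dots> = (\<Sum>C\<in>{C \<in> ?S. card C = m}. fact (m - 1) * card (mperms m (E - C)))"
    by (rule sum.inter_filter[OF fin, symmetric])
  also have "{C \<in> ?S. card C = m} = {C. C \<subseteq> E \<and> e \<in> C \<and> card C = m}" by auto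
  finally show ?thesis .
qed

text \<open>The cycle of a marked element can be chosen in
  \<open>(N choose (m - 1)) * (m - 1)!\<close> ways, \<open>N\<close> being the number of other
  elements. The induction hypothesis contributes \<open>(N - (m - 1))!\<close>, and the product
  collapses to \<open>N!\<close>.\<close>

lemma card_mperms:
  assumes "m > 0"
  shows "finite E \<Longrightarrow> card E = m * n \<Longrightarrow> card (mperms m E) * (m ^ n * fact n) = fact (m * n)"
proof (induction n arbitrary: E)
  case 0
  then show ?case by simp
next
  case (Suc n)
  define N where "N = m * n + (m - 1)"
  have N: "m * Suc n = Suc N" using assms by (simp add: N_def)
  have "E \<noteq> {}" using Suc.prems N by auto
  then obtain e where e: "e \<in> E" by blast
  have "card (mperms m (E - C)) * (m ^ n * fact n) = fact (m * n)" if "C \<subseteq> E" "card C = m" for C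
  proof (rule Suc.IH)
    show "card (E - C) = m * n"
      using that Suc.prems card_Diff_subset[OF finite_subset[OF that(1) Suc.prems(1)] that(1)] by simp
  qed (use Suc.prems in simp)
  then have "card (mperms m E) * (m ^ n * fact n) =
      (\<Sum>C | C \<subseteq> E \<and> e \<in> C \<and> card C = m. fact (m - 1) * fact (m * n))"
    unfolding card_mperms_rec[OF Suc.prems(1) e] sum_distrib_right
    by (intro sum.cong) (simp_all add: mult.assoc)
  also have "\<dots> = (N choose (m - 1)) * (fact (m - 1) * fact (N - (m - 1)))"
  proof -
    have "N - (m - 1) = m * n" by (simp add: N_def)
    then show ?thesis
      using card_subsets_containing[OF Suc.prems(1) e assms] unfolding Suc.prems(2) N by simp
  qed
  also have "\<dots> = fact N"
    using binomial_fact_lemma[of "m - 1" N] by (simp add: N_def algebra_simps)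
  finally have "card (mperms m E) * (m ^ n * fact n) = fact N" .
  moreover have "card (mperms m E) * (m ^ Suc n * fact (Suc n)) =
      m * Suc n * (card (mperms m E) * (m ^ n * fact n))"
    by (simp add: algebra_simps)
  ultimately show ?case unfolding N by simp
qed

text \<open>Cycles cut the set into blocks of size \<open>m\<close>. This discards the subsets of
  other sizes as possible components.\<close>

lemma mperms_dvd_card:
  assumes "finite E" and "\<sigma> \<in> mperms m E"
  shows "m dvd card E"
  using assms
proof (induction "card E" arbitrary: E \<sigma> rule: less_induct)
  case less
  show ?case
  proof (cases "E = {}")
    case False
    then obtain e where e: "e \<in> E" by blast
    let ?C = "orbit \<sigma> e"
    have per: "\<sigma> permutes E" using less.prems by (simp add: mperms_def)
    have C: "?C \<subseteq> E" "finite ?C" "card ?C = m" "e \<in> ?C" "\<sigma> ` ?C \<subseteq> ?C"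
      using permutes_orbit_subset[OF per e] less.prems e self_in_orbit[OF per less.prems(1), of e]
      by (simp_all add: mperms_def finite_subset[OF _ less.prems(1)] image_subset_iff orbit.step)
    have "perm_restrict \<sigma> (E - ?C) \<in> mperms m (E - ?C)"
      using less.prems permutes_image_Diff[OF per C(2,5)] by (intro perm_restrict_mperms) auto
    moreover have "card (E - ?C) < card E"
      using C(4) e less.prems(1) by (intro psubset_card_mono) auto
    ultimately have "m dvd card (E - ?C)" using less by simp
    moreover have "card E = card ?C + card (E - ?C)"
      using card_Diff_subset[OF C(2,1)] card_mono[OF less.prems(1) C(1)] by simp
    ultimately show ?thesis using C(3) by simp
  qed simp
qed

section \<open>Pairs of permutations and their components\<close>

text \<open>Forward steps suffice: on a finite set the inverse of a permutation is reached by
  iterating it, so reachability is symmetric nevertheless.\<close>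

definition step_rel :: "('a \<Rightarrow> 'a) \<times> ('a \<Rightarrow> 'a) \<Rightarrow> ('a \<times> 'a) set" where
  "step_rel p = {(x, y). y = fst p x \<or> y = snd p x}"

definition component :: "('a \<Rightarrow> 'a) \<times> ('a \<Rightarrow> 'a) \<Rightarrow> 'a \<Rightarrow> 'a set" where
  "component p e = (step_rel p)\<^sup>* `` {e}"

definition mpairs :: "nat \<Rightarrow> 'a set \<Rightarrow> (('a \<Rightarrow> 'a) \<times> ('a \<Rightarrow> 'a)) set" where
  "mpairs m E = mperms m E \<times> mperms m E"

definition connected_pairs :: "nat \<Rightarrow> 'a set \<Rightarrow> 'a \<Rightarrow> (('a \<Rightarrow> 'a) \<times> ('a \<Rightarrow> 'a)) set" where
  "connected_pairs m E e = {p \<in> mpairs m E. component p e = E}"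

lemma component_self: "e \<in> component p e"
  by (simp add: component_def)

lemma component_step:
  assumes "x \<in> component p e"
  shows "fst p x \<in> component p e" and "snd p x \<in> component p e"
proof -
  have x: "(e, x) \<in> (step_rel p)\<^sup>*" using assms by (simp add: component_def)
  have "(x, fst p x) \<in> step_rel p" "(x, snd p x) \<in> step_rel p" by (simp_all add: step_rel_def)
  then have "(e, fst p x) \<in> (step_rel p)\<^sup>*" "(e, snd p x) \<in> (step_rel p)\<^sup>*"
    using rtrancl.rtrancl_into_rtrancl[OF x] by simp_all
  then show "fst p x \<in> component p e" "snd p x \<in> component p e"
    by (simp_all add: component_def)
qed

lemma component_closed: "fst p ` component p e \<subseteq> component p e" "snd p ` component p e \<subseteq> component p e"
  by (auto intro: component_step)

text \<open>The induction principle for connectivity. It serves to carry reachability from one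
  structure to another and to prove that connected pairs are rigid.\<close>

lemma component_least:
  assumes "e \<in> S" and "\<And>x. x \<in> S \<Longrightarrow> fst p x \<in> S" and "\<And>x. x \<in> S \<Longrightarrow> snd p x \<in> S"
  shows "component p e \<subseteq> S"
proof
  fix x assume "x \<in> component p e"
  then have "(e, x) \<in> (step_rel p)\<^sup>*" by (simp add: component_def)
  then show "x \<in> S"
    by induction (use assms in \<open>auto simp: step_rel_def\<close>)
qed

lemma component_cong:
  assumes "e \<in> S" and "fst p ` S \<subseteq> S" and "snd p ` S \<subseteq> S"
    and "\<And>x. x \<in> S \<Longrightarrow> fst p x = fst p' x" and "\<And>x. x \<in> S \<Longrightarrow> snd p x = snd p' x"
  shows "component p e = component p' e"
proof -
  have sub: "component q' e \<subseteq> component q e"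
    if "fst q ` S \<subseteq> S" "snd q ` S \<subseteq> S"
      and eq: "\<And>x. x \<in> S \<Longrightarrow> fst q' x = fst q x" "\<And>x. x \<in> S \<Longrightarrow> snd q' x = snd q x" for q q'
  proof -
    have "component q' e \<subseteq> component q e \<inter> S"
    proof (rule component_least)
      show "e \<in> component q e \<inter> S" using assms(1) by (simp add: component_self)
      fix x assume "x \<in> component q e \<inter> S"
      then have x: "x \<in> component q e" "x \<in> S" by simp_all
      show "fst q' x \<in> component q e \<inter> S" "snd q' x \<in> component q e \<inter> S"
        unfolding eq[OF x(2)] using that(1,2) x component_step[OF x(1)] by auto
    qed
    then show ?thesis by blast
  qed
  have "fst p' ` S \<subseteq> S" "snd p' ` S \<subseteq> S"
    using assms by (simp_all add: image_subset_iff)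
  then show ?thesis
    by (intro equalityI sub assms(2-5) assms(4,5)[symmetric])
qed

lemma component_subset:
  assumes "fst p permutes E" and "snd p permutes E" and "e \<in> E"
  shows "component p e \<subseteq> E"
  using assms by (intro component_least) (simp_all add: permutes_in_image)

lemma step_rel_sym:
  assumes "permutation (fst p)" and "permutation (snd p)" and "(x, y) \<in> (step_rel p)\<^sup>*"
  shows "(y, x) \<in> (step_rel p)\<^sup>*"
proof -
  have orb: "(x, y) \<in> (step_rel p)\<^sup>*" if "y \<in> orbit \<sigma> x" "\<sigma> = fst p \<or> \<sigma> = snd p" for x y \<sigma>
    using that(1)
  proof induction
    case base
    show ?case by (rule r_into_rtrancl) (use that(2) in \<open>auto simp: step_rel_def\<close>)
  next
    case (step z)
    show ?case
      by (rule rtrancl.rtrancl_into_rtrancl[OF step.IH]) (use that(2) in \<open>auto simp: step_rel_def\<close>)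
  qed
  have bwd: "(\<sigma> x, x) \<in> (step_rel p)\<^sup>*" if "\<sigma> = fst p \<or> \<sigma> = snd p" for \<sigma> x
  proof (rule orb[OF _ that])
    have "permutation \<sigma>" using that assms(1,2) by blast
    then show "x \<in> orbit \<sigma> (\<sigma> x)"
      using permutation_self_in_orbit[of \<sigma> x] permutation_orbit_step[of \<sigma> x] by simp
  qed
  show ?thesis
    using assms(3)
  proof induction
    case (step y z)
    have "(z, y) \<in> (step_rel p)\<^sup>*"
      using step(2) bwd by (auto simp: step_rel_def)
    then show ?case using step(3) by (rule rtrancl_trans)
  qed simp
qed

definition restrict_pair :: "('a \<Rightarrow> 'a) \<times> ('a \<Rightarrow> 'a) \<Rightarrow> 'a set \<Rightarrow> ('a \<Rightarrow> 'a) \<times> ('a \<Rightarrow> 'a)" where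
  "restrict_pair p S = (perm_restrict (fst p) S, perm_restrict (snd p) S)"

text \<open>Both the component of the mark and its complement are closed under the two permutations.
  The pair is connected on the former and arbitrary on the latter.\<close>

lemma card_mpairs_component:
  assumes "finite E" and "K \<subseteq> E" and "e \<in> K"
  shows "card {p \<in> mpairs m E. component p e = K} =
    card (connected_pairs m K e) * card (mpairs m (E - K))"
proof -
  have K: "finite K" using assms finite_subset by blast
  let ?f = "\<lambda>p. (restrict_pair p K, restrict_pair p (E - K))"
  let ?g = "\<lambda>(a, b). (fst a \<circ> fst b, snd a \<circ> snd b)"
  have "bij_betw ?f {p \<in> mpairs m E. component p e = K} (connected_pairs m K e \<times> mpairs m (E - K))"
  proof (rule bij_betwI[where g = ?g])
    have cl: "fst p ` K \<subseteq> K" "snd p ` K \<subseteq> K" if "component p e = K" for p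
      using component_closed[of p e] that by simp_all
    have mp: "fst p \<in> mperms m E" "snd p \<in> mperms m E" "fst p permutes E" "snd p permutes E"
      if "p \<in> mpairs m E" for p :: "('a \<Rightarrow> 'a) \<times> ('a \<Rightarrow> 'a)" and E
      using that by (auto simp: mpairs_def mperms_def)
    show "?f \<in> {p \<in> mpairs m E. component p e = K} \<rightarrow> connected_pairs m K e \<times> mpairs m (E - K)"
    proof
      fix p assume "p \<in> {p \<in> mpairs m E. component p e = K}"
      then have p: "p \<in> mpairs m E" and comp: "component p e = K" by simp_all
      have "restrict_pair p K \<in> mpairs m K"
        using perm_restrict_mperms[OF mp(1)[OF p] K assms(2) cl(1)[OF comp]]
          perm_restrict_mperms[OF mp(2)[OF p] K assms(2) cl(2)[OF comp]]
        by (simp add: restrict_pair_def mpairs_def)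
      moreover have "restrict_pair p (E - K) \<in> mpairs m (E - K)"
        using perm_restrict_mperms[OF mp(1)[OF p] _ Diff_subset permutes_image_Diff[OF mp(3)[OF p] K cl(1)[OF comp]]]
          perm_restrict_mperms[OF mp(2)[OF p] _ Diff_subset permutes_image_Diff[OF mp(4)[OF p] K cl(2)[OF comp]]]
          assms(1)
        by (simp add: restrict_pair_def mpairs_def)
      moreover have "component p e = component (restrict_pair p K) e"
        by (rule component_cong[of e K])
          (use assms(3) cl[OF comp] in \<open>simp_all add: restrict_pair_def perm_restrict_simps\<close>)
      ultimately show "?f p \<in> connected_pairs m K e \<times> mpairs m (E - K)"
        using comp by (simp add: connected_pairs_def)
    qed
    show "?g \<in> connected_pairs m K e \<times> mpairs m (E - K) \<rightarrow> {p \<in> mpairs m E. component p e = K}"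
    proof
      fix x assume "x \<in> connected_pairs m K e \<times> mpairs m (E - K)"
      then obtain a b where x: "x = (a, b)" and a: "a \<in> mpairs m K" "component a e = K"
        and b: "b \<in> mpairs m (E - K)"
        by (auto simp: connected_pairs_def)
      let ?p = "(fst a \<circ> fst b, snd a \<circ> snd b)"
      have 1: "fst a \<circ> fst b \<in> mperms m E" "(fst a \<circ> fst b) ` K \<subseteq> K"
        by (rule comp_mperms[OF mp(1)[OF a(1)] mp(1)[OF b] assms(2)])+
      have 2: "snd a \<circ> snd b \<in> mperms m E" "(snd a \<circ> snd b) ` K \<subseteq> K"
        by (rule comp_mperms[OF mp(2)[OF a(1)] mp(2)[OF b] assms(2)])+
      have "component ?p e = component a e"
        by (rule component_cong[of e K])
          (use assms(3) 1(2) 2(2) comp_permutes_on(1)[OF mp(3)[OF a(1)] mp(3)[OF b] Diff_disjoint]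
            comp_permutes_on(1)[OF mp(4)[OF a(1)] mp(4)[OF b] Diff_disjoint] in \<open>simp_all\<close>)
      then show "?g x \<in> {p \<in> mpairs m E. component p e = K}"
        using 1(1) 2(1) a(2) by (simp add: x mpairs_def)
    qed
    show "?g (?f p) = p" if "p \<in> {p \<in> mpairs m E. component p e = K}" for p
    proof -
      have p: "p \<in> mpairs m E" and comp: "component p e = K" using that by simp_all
      show ?thesis
        using perm_restrict_split[OF mp(3)[OF p] assms(1,2) cl(1)[OF comp]]
          perm_restrict_split[OF mp(4)[OF p] assms(1,2) cl(2)[OF comp]]
        by (simp add: restrict_pair_def)
    qed
    show "?f (?g x) = x" if "x \<in> connected_pairs m K e \<times> mpairs m (E - K)" for x
    proof -
      obtain a b where x: "x = (a, b)" and a: "a \<in> mpairs m K" and b: "b \<in> mpairs m (E - K)"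
        using \<open>x \<in> _\<close> by (auto simp: connected_pairs_def)
      show ?thesis
        using perm_restrict_comp_permutes[OF mp(3)[OF a] mp(3)[OF b] Diff_disjoint]
          perm_restrict_comp_permutes[OF mp(4)[OF a] mp(4)[OF b] Diff_disjoint]
        by (simp add: x restrict_pair_def)
    qed
  qed
  then show ?thesis
    by (simp add: bij_betw_same_card card_cartesian_product)
qed

lemma finite_mpairs: "finite E \<Longrightarrow> finite (mpairs m E)"
  by (simp add: mpairs_def finite_mperms)

lemma card_mpairs_rec:
  assumes "finite E" and "e \<in> E"
  shows "card (mpairs m E) =
    (\<Sum>K | K \<subseteq> E \<and> e \<in> K. card (connected_pairs m K e) * card (mpairs m (E - K)))"
proof -
  let ?S = "{K. K \<subseteq> E \<and> e \<in> K}"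
  have "component p e \<in> ?S" if "p \<in> mpairs m E" for p
    using that component_subset[OF _ _ assms(2), of p] component_self[of e p]
    by (auto simp: mpairs_def mperms_def)
  then have "mpairs m E = (\<Union>K\<in>?S. {p \<in> mpairs m E. component p e = K})" by blast
  also have "card \<dots> = (\<Sum>K\<in>?S. card {p \<in> mpairs m E. component p e = K})"
    by (rule card_UN_disjoint) (use finite_mpairs[OF assms(1)] assms(1) in auto)
  also have "\<dots> = (\<Sum>K\<in>?S. card (connected_pairs m K e) * card (mpairs m (E - K)))"
    by (rule sum.cong) (use card_mpairs_component[OF assms(1)] in auto)
  finally show ?thesis .
qed

text \<open>
  \<open>c k\<close> stands for the number of rooted maps with \<open>k\<close> black vertices: a connected pair is such a
  map with its non-root edges labelled.
\<close>

lemma card_mpairs_weight: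
  assumes m: "m > 0" and n: "n > 0"
    and conn: "\<And>(K :: nat set) e k. finite K \<Longrightarrow> e \<in> K \<Longrightarrow> card K = m * k \<Longrightarrow>
      card (connected_pairs m K e) = c k * fact (m * k - 1)"
  shows "of_nat (m * n) * (fact (m * n) / (of_nat m ^ n * fact n)\<^sup>2 :: rat) =
    (\<Sum>k=1..n. of_nat (c k) * (fact (m * (n - k)) / (of_nat m ^ (n - k) * fact (n - k))\<^sup>2))"
proof -
  \<comment> \<open>The element 0 will carry the mark, and \<open>N\<close> counts the unmarked
    ones.\<close>
  define N where "N = m * n - 1"
  have N: "m * n = Suc N" using m n by (simp add: N_def)
  define E where "E = {..N}"
  have E: "finite E" "card E = m * n" "0 \<in> E" by (simp_all add: E_def N)
  have P: "of_nat (card (mpairs m F)) = (fact (m * k) / (of_nat m ^ k * fact k) :: rat)\<^sup>2"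
    if "finite F" "card F = m * k" for F :: "nat set" and k
  proof -
    have "of_nat (card (mperms m F)) * (of_nat m ^ k * fact k) = (fact (m * k) :: rat)"
      using arg_cong[OF card_mperms[OF m that], of "of_nat :: nat \<Rightarrow> rat"] by simp
    then have "of_nat (card (mperms m F)) = (fact (m * k) / (of_nat m ^ k * fact k) :: rat)"
      using m by (simp add: divide_simps)
    then show ?thesis
      by (simp add: mpairs_def card_cartesian_product power2_eq_square)
  qed
  let ?S = "{K. K \<subseteq> E \<and> 0 \<in> K}"
  let ?z = "\<lambda>k. (fact (m * k) / (of_nat m ^ k * fact k) :: rat)\<^sup>2"
  let ?t = "\<lambda>K. of_nat (card (connected_pairs m K 0)) * of_nat (card (mpairs m (E - K))) :: rat"
  have fin: "finite ?S" using E(1) by simp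
  have "?z n = (\<Sum>K\<in>?S. ?t K)"
    unfolding P[OF E(1,2), symmetric] card_mpairs_rec[OF E(1,3), of m] by simp
  also have "\<dots> = (\<Sum>K\<in>{K\<in>?S. m dvd card K}. ?t K)"
  proof (rule sum.mono_neutral_right[OF fin])
    show "\<forall>K\<in>?S - {K\<in>?S. m dvd card K}. ?t K = 0"
    proof
      fix K assume K: "K \<in> ?S - {K\<in>?S. m dvd card K}"
      then have "finite K" using finite_subset[OF _ E(1)] by simp
      then have "mperms m K = {}" using K mperms_dvd_card[of K _ m] by auto
      then show "?t K = 0" by (simp add: connected_pairs_def mpairs_def)
    qed
  qed auto
  also have "\<dots> = (\<Sum>k=1..n. \<Sum>K | K \<subseteq> E \<and> 0 \<in> K \<and> card K = m * k. ?t K)"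
  proof -
    have "{K\<in>?S. m dvd card K} = (\<Union>k\<in>{1..n}. {K. K \<subseteq> E \<and> 0 \<in> K \<and> card K = m * k})"
    proof (intro equalityI subsetI)
      fix K assume K: "K \<in> {K\<in>?S. m dvd card K}"
      then obtain k where k: "card K = m * k" by auto
      have "card K \<le> m * n" using card_mono[OF E(1)] K E(2) by auto
      moreover have "card K > 0"
      proof -
        have "finite K" "K \<noteq> {}" using K finite_subset[OF _ E(1)] by auto
        then show ?thesis by (simp add: card_gt_0_iff)
      qed
      ultimately have "k \<in> {1..n}" using m by (simp add: k Suc_le_eq)
      then show "K \<in> (\<Union>k\<in>{1..n}. {K. K \<subseteq> E \<and> 0 \<in> K \<and> card K = m * k})" using K k by blast
    qed auto
    then have "(\<Sum>K\<in>{K\<in>?S. m dvd card K}. ?t K) =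
        (\<Sum>K\<in>(\<Union>k\<in>{1..n}. {K. K \<subseteq> E \<and> 0 \<in> K \<and> card K = m * k}). ?t K)"
      by (rule arg_cong)
    also have "\<dots> = (\<Sum>k=1..n. \<Sum>K | K \<subseteq> E \<and> 0 \<in> K \<and> card K = m * k. ?t K)"
      by (rule sum.UNION_disjoint) (use m E(1) in auto)
    finally show ?thesis .
  qed
  \<comment> \<open>With \<open>j = m k - 1\<close>, the component of the mark has
    \<open>N choose j\<close> possible supports. The denominator \<open>j!\<close> of this binomial
    cancels the \<open>j!\<close> labellings of each rooted map.\<close>
  also have "\<dots> = (\<Sum>k=1..n. of_nat (c k) * (fact N / fact (m * (n - k))) * ?z (n - k))"
  proof (rule sum.cong[OF refl])
    fix k assume k: "k \<in> {1..n}"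
    define j where "j = m * k - 1"
    have mk: "m * k = Suc j" using k m by (simp add: j_def)
    have le: "m * k \<le> m * n" using k by simp
    have sub: "m * (n - k) = N - j"
      using le mk N by (simp add: diff_mult_distrib2)
    have jN: "j \<le> N" using le mk N by simp
    have "?t K = of_nat (c k) * fact j * ?z (n - k)" if "K \<subseteq> E" "0 \<in> K" "card K = m * k" for K
    proof -
      have K: "finite K" using that E(1) finite_subset by blast
      have "card (E - K) = m * (n - k)"
        using card_Diff_subset[OF K that(1)] that(3) E(2) by (simp add: diff_mult_distrib2)
      then show ?thesis
        using conn[OF K that(2,3)] P[of "E - K" "n - k"] E(1) by (simp add: mk)
    qed
    then have "(\<Sum>K | K \<subseteq> E \<and> 0 \<in> K \<and> card K = m * k. ?t K) =
        of_nat (card {K. K \<subseteq> E \<and> 0 \<in> K \<and> card K = m * k}) * (of_nat (c k) * fact j * ?z (n - k))"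
      by simp
    also have "card {K. K \<subseteq> E \<and> 0 \<in> K \<and> card K = m * k} = (N choose j)"
      using card_subsets_containing[OF E(1,3), of "m * k"] E(2) by (simp add: mk N)
    also have "of_nat (N choose j) = (fact N / (fact j * fact (N - j)) :: rat)"
      by (rule binomial_fact[OF jN])
    finally show "(\<Sum>K | K \<subseteq> E \<and> 0 \<in> K \<and> card K = m * k. ?t K) =
        of_nat (c k) * (fact N / fact (m * (n - k))) * ?z (n - k)"
      by (simp add: sub)
  qed
  finally have main: "?z n = (\<Sum>k=1..n. of_nat (c k) * (fact N / fact (m * (n - k))) * ?z (n - k))" .
  \<comment> \<open>Dividing by \<open>N! = (m n - 1)!\<close> turns numbers of pairs into the
    weights of \<open>Z\<close>; the quotient \<open>(m n)! / N!\<close> is the factor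
    \<open>m n\<close>.\<close>
  have "of_nat (m * n) * (fact (m * n) / (of_nat m ^ n * fact n)\<^sup>2 :: rat) = ?z n / fact N"
  proof -
    have *: "a * (F / D\<^sup>2) = (F / D)\<^sup>2 / f" if "F = a * f" "f \<noteq> 0" for a F D f :: rat
      using that by (simp add: power_divide power2_eq_square)
    show ?thesis unfolding N by (rule *) (simp_all only: fact_Suc fact_nonzero of_nat_fact not_False_eq_True)
  qed
  also have "\<dots> = (\<Sum>k=1..n. of_nat (c k) * (fact (m * (n - k)) / (of_nat m ^ (n - k) * fact (n - k))\<^sup>2))"
  proof -
    have *: "a * (f / F) * (F / D)\<^sup>2 / f = a * (F / D\<^sup>2)" if "F \<noteq> 0" "f \<noteq> 0" for a F D f :: rat
      using that by (simp add: power_divide power2_eq_square)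
    show ?thesis
      unfolding main sum_divide_distrib by (intro sum.cong refl *) simp_all
  qed
  finally show ?thesis .
qed

section \<open>Rooted maps as connected pairs of permutations\<close>

text \<open>Each edge has exactly one dart at a white vertex, so these darts stand for the
  edges.\<close>

definition white_darts :: "rmap \<Rightarrow> nat set" where
  "white_darts M = {d \<in> darts M. vertex_of M d \<in> whites M}"

lemma rooted_mbip_finite: "M \<in> rooted_mbip m \<Longrightarrow> finite (darts M)"
  by (simp add: rooted_mbip_def is_map_def)

lemma rooted_mbip_permutation:
  assumes "M \<in> rooted_mbip m"
  shows "permutation (rot M)" and "permutation (opp M)"
  using rooted_mbipD(1,2)[OF assms] rooted_mbip_finite[OF assms] by (auto simp: permutation_permutes)

lemma rooted_mbip_opp:
  assumes "M \<in> rooted_mbip m" and "d \<in> darts M"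
  shows "opp M d \<in> darts M" and "opp M (opp M d) = d"
    and "opp M d \<in> white_darts M \<longleftrightarrow> d \<notin> white_darts M"
proof -
  show d: "opp M d \<in> darts M"
    using assms(2) permutes_in_image[OF rooted_mbipD(2)[OF assms(1)]] by simp
  show "opp M (opp M d) = d"
    using assms unfolding rooted_mbip_def is_map_def by simp
  have "vertex_of M d \<in> whites M \<longleftrightarrow> vertex_of M (opp M d) \<notin> whites M"
    using assms unfolding rooted_mbip_def bipartite_coloring_def by simp
  then show "opp M d \<in> white_darts M \<longleftrightarrow> d \<notin> white_darts M"
    using d assms(2) by (simp add: white_darts_def)
qed

lemma rooted_mbip_rot:
  assumes "M \<in> rooted_mbip m" and "d \<in> darts M"
  shows "rot M d \<in> darts M" and "rot M d \<in> white_darts M \<longleftrightarrow> d \<in> white_darts M"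
proof -
  show d: "rot M d \<in> darts M"
    using assms(2) permutes_in_image[OF rooted_mbipD(1)[OF assms(1)]] by simp
  then show "rot M d \<in> white_darts M \<longleftrightarrow> d \<in> white_darts M"
    using permutation_orbit_step[OF rooted_mbip_permutation(1)[OF assms(1)], of d] assms(2)
    by (simp add: white_darts_def vertex_of_def)
qed

lemma rooted_mbip_root:
  assumes "M \<in> rooted_mbip m"
  shows "root_dart M \<in> white_darts M"
  using assms by (simp add: rooted_mbip_def white_darts_def)

text \<open>\<open>opp\<close> matches the white with the black darts, and the latter are
  partitioned into black vertices of \<open>m\<close> darts each.\<close>

lemma card_white_darts:
  assumes "M \<in> rooted_mbip m"
  shows "card (white_darts M) = m * num_blacks M"
proof -
  have perm: "permutation (rot M)" by (rule rooted_mbip_permutation(1)[OF assms])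
  have self: "d \<in> vertex_of M d" for d
    unfolding vertex_of_def by (rule permutation_self_in_orbit[OF perm])
  have same: "vertex_of M x = vertex_of M d" if "x \<in> vertex_of M d" for x d
    using that unfolding vertex_of_def by (rule orbit_cyclic_eq3[OF cyclic_on_orbit'[OF perm]])
  have "bij_betw (opp M) (white_darts M) (darts M - white_darts M)"
    by (rule bij_betwI[where g = "opp M"])
      (use rooted_mbip_opp[OF assms] in \<open>auto simp: white_darts_def\<close>)
  then have "card (white_darts M) = card (darts M - white_darts M)"
    by (rule bij_betw_same_card)
  also have "darts M - white_darts M = \<Union>(vertices M - whites M)"
  proof (intro equalityI subsetI)
    fix d assume d: "d \<in> darts M - white_darts M"
    then have "vertex_of M d \<in> vertices M - whites M"
      by (simp add: white_darts_def vertices_def)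
    then show "d \<in> \<Union>(vertices M - whites M)" using self by blast
  next
    fix x assume "x \<in> \<Union>(vertices M - whites M)"
    then obtain v where v: "v \<in> vertices M" "v \<notin> whites M" "x \<in> v" by blast
    then have "x \<in> darts M" using vertices_subset[OF assms] by blast
    moreover have "vertex_of M x = v" using v same by (auto simp: vertices_def)
    ultimately show "x \<in> darts M - white_darts M" using v(2) by (simp add: white_darts_def)
  qed
  also have "card \<dots> = m * card (vertices M - whites M)"
  proof (rule card_partition[symmetric])
    show "finite (vertices M - whites M)"
      using rooted_mbip_finite[OF assms] by (simp add: vertices_def)
    show "finite (\<Union>(vertices M - whites M))"
      by (rule finite_subset[OF _ rooted_mbip_finite[OF assms]]) (use vertices_subset[OF assms] in blast)
    show "card v = m" if "v \<in> vertices M - whites M" for v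
      using that assms by (simp add: rooted_mbip_def)
    show "v \<inter> w = {}" if vw: "v \<in> vertices M - whites M" "w \<in> vertices M - whites M" "v \<noteq> w" for v w
    proof (rule ccontr)
      assume "v \<inter> w \<noteq> {}"
      then obtain x where "x \<in> v" "x \<in> w" by blast
      then have "vertex_of M x = v" "vertex_of M x = w"
        using vw(1,2) same by (auto simp: vertices_def)
      then show False using vw(3) by simp
    qed
  qed
  finally show ?thesis by (simp add: num_blacks_def)
qed

text \<open>
  The edge \<open>x \<in> K\<close> has white dart \<open>2 * x\<close> and black dart \<open>2 * x + 1\<close>; the two permutations rotate
  the edges around the white and the black vertices.
\<close>

definition pair_map :: "nat set \<Rightarrow> nat \<Rightarrow> (nat \<Rightarrow> nat) \<times> (nat \<Rightarrow> nat) \<Rightarrow> rmap" where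
  "pair_map K e p = \<lparr>darts = {d. d div 2 \<in> K},
     rot = \<lambda>d. if even d then 2 * fst p (d div 2) else Suc (2 * snd p (d div 2)),
     opp = \<lambda>d. if d div 2 \<in> K then (if even d then Suc d else d - 1) else d,
     whites = (\<lambda>x. (*) 2 ` orbit (fst p) x) ` K,
     root_dart = 2 * e\<rparr>"

lemma even_odd_nat_cases:
  fixes d :: nat
  obtains (even) x where "d = 2 * x" | (odd) x where "d = Suc (2 * x)"
  by (metis evenE oddE Suc_eq_plus1)

lemma pair_map_simps [simp]:
  "d \<in> darts (pair_map K e p) \<longleftrightarrow> d div 2 \<in> K"
  "rot (pair_map K e p) (2 * x) = 2 * fst p x"
  "rot (pair_map K e p) (Suc (2 * x)) = Suc (2 * snd p x)"
  "x \<in> K \<Longrightarrow> opp (pair_map K e p) (2 * x) = Suc (2 * x)"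
  "x \<in> K \<Longrightarrow> opp (pair_map K e p) (Suc (2 * x)) = 2 * x"
  "whites (pair_map K e p) = (\<lambda>x. (*) 2 ` orbit (fst p) x) ` K"
  "root_dart (pair_map K e p) = 2 * e"
  by (simp_all add: pair_map_def)

lemma finite_pair_map_darts: "finite K \<Longrightarrow> finite (darts (pair_map K e p))"
proof (rule finite_subset)
  show "darts (pair_map K e p) \<subseteq> (*) 2 ` K \<union> (\<lambda>x. Suc (2 * x)) ` K"
  proof
    fix d assume "d \<in> darts (pair_map K e p)"
    then show "d \<in> (*) 2 ` K \<union> (\<lambda>x. Suc (2 * x)) ` K"
      by (cases d rule: even_odd_nat_cases) auto
  qed
qed simp

lemma connected_pairsD:
  assumes "p \<in> connected_pairs m K e" and "finite K"
  shows "fst p permutes K" "snd p permutes K" "permutation (fst p)" "permutation (snd p)"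
    "x \<in> K \<Longrightarrow> card (orbit (fst p) x) = m" "x \<in> K \<Longrightarrow> card (orbit (snd p) x) = m"
    "component p e = K"
  using assms unfolding connected_pairs_def mpairs_def mperms_def permutation_permutes by auto

lemma vertex_of_pair_map:
  assumes "p \<in> connected_pairs m K e" and "finite K"
  shows "vertex_of (pair_map K e p) (2 * x) = (*) 2 ` orbit (fst p) x"
    and "vertex_of (pair_map K e p) (Suc (2 * x)) = (\<lambda>y. Suc (2 * y)) ` orbit (snd p) x"
proof -
  note p = connected_pairsD[OF assms]
  show "vertex_of (pair_map K e p) (2 * x) = (*) 2 ` orbit (fst p) x"
    unfolding vertex_of_def
    by (rule orbit_inverse[symmetric, OF permutation_self_in_orbit[OF p(3)]]) simp
  show "vertex_of (pair_map K e p) (Suc (2 * x)) = (\<lambda>y. Suc (2 * y)) ` orbit (snd p) x"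
    unfolding vertex_of_def
    by (rule orbit_inverse[symmetric, OF permutation_self_in_orbit[OF p(4)], where f = "\<lambda>y. Suc (2 * y)"]) simp
qed

lemma pair_map_white_iff:
  assumes "p \<in> connected_pairs m K e" and "finite K" and "x \<in> K"
  shows "vertex_of (pair_map K e p) (2 * x) \<in> whites (pair_map K e p)"
    and "vertex_of (pair_map K e p) (Suc (2 * x)) \<notin> whites (pair_map K e p)"
proof -
  show "vertex_of (pair_map K e p) (2 * x) \<in> whites (pair_map K e p)"
    using assms(3) by (simp add: vertex_of_pair_map[OF assms(1,2)])
  show "vertex_of (pair_map K e p) (Suc (2 * x)) \<notin> whites (pair_map K e p)"
  proof
    assume "vertex_of (pair_map K e p) (Suc (2 * x)) \<in> whites (pair_map K e p)"
    then obtain y where eq: "(\<lambda>y. Suc (2 * y)) ` orbit (snd p) x = (*) 2 ` orbit (fst p) y"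
      by (auto simp: vertex_of_pair_map[OF assms(1,2)])
    have "Suc (2 * x) \<in> (*) 2 ` orbit (fst p) y"
      unfolding eq[symmetric]
      using permutation_self_in_orbit[OF connected_pairsD(4)[OF assms(1,2)]] by blast
    then show False by (auto dest: arg_cong[of _ _ even])
  qed
qed

lemma pair_map_rooted_mbip:
  assumes p: "p \<in> connected_pairs m K e" and K: "finite K" and e: "e \<in> K"
  shows "pair_map K e p \<in> rooted_mbip m"
proof -
  let ?M = "pair_map K e p"
  note pD = connected_pairsD[OF p K]
  have in_K: "fst p x \<in> K \<longleftrightarrow> x \<in> K" "snd p x \<in> K \<longleftrightarrow> x \<in> K" for x
    using permutes_in_image[OF pD(1)] permutes_in_image[OF pD(2)] by simp_all
  have rot: "rot ?M permutes darts ?M"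
  proof -
    have "inj (rot ?M)"
    proof (rule injI)
      fix c d assume eq: "rot ?M c = rot ?M d"
      have parity: "even (rot ?M d) \<longleftrightarrow> even d" for d
        by (simp add: pair_map_def)
      show "c = d"
      proof (cases c rule: even_odd_nat_cases)
        case (even x)
        then have "even d" using parity[of c] parity[of d] unfolding eq by simp
        then obtain y where y: "d = 2 * y" by (rule evenE)
        have "fst p x = fst p y" using eq unfolding even y by simp
        then show ?thesis using injD[OF permutes_inj[OF pD(1)]] even y by blast
      next
        case (odd x)
        then have "odd d" using parity[of c] parity[of d] unfolding eq by simp
        then obtain y where y: "d = Suc (2 * y)" by (cases d rule: even_odd_nat_cases) simp_all
        have "snd p x = snd p y" using eq unfolding odd y by simp
        then show ?thesis using injD[OF permutes_inj[OF pD(2)]] odd y by blast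
      qed
    qed
    moreover have "\<exists>c. rot ?M c = d" for d
    proof (cases d rule: even_odd_nat_cases)
      case (even x)
      obtain y where "fst p y = x" using permutes_surj[OF pD(1)] by (metis surjD)
      then show ?thesis using even by (intro exI[of _ "2 * y"]) simp
    next
      case (odd x)
      obtain y where "snd p y = x" using permutes_surj[OF pD(2)] by (metis surjD)
      then show ?thesis using odd by (intro exI[of _ "Suc (2 * y)"]) simp
    qed
    ultimately have "bij (rot ?M)" unfolding bij_def surj_def by metis
    moreover have "rot ?M d = d" if "d \<notin> darts ?M" for d
      using that permutes_not_in[OF pD(1)] permutes_not_in[OF pD(2)]
      by (cases d rule: even_odd_nat_cases) auto
    ultimately show ?thesis unfolding permutes_def bij_iff by blast
  qed
  have opp_opp: "opp ?M d \<in> darts ?M \<and> opp ?M (opp ?M d) = d \<and> opp ?M d \<noteq> d" if "d \<in> darts ?M" for d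
    using that by (cases d rule: even_odd_nat_cases) auto
  have opp: "opp ?M permutes darts ?M"
  proof (rule bij_imp_permutes)
    show "bij_betw (opp ?M) (darts ?M) (darts ?M)"
      by (rule bij_betwI[where g = "opp ?M"]) (use opp_opp in auto)
    show "opp ?M d = d" if "d \<notin> darts ?M" for d
      using that by (simp add: pair_map_def)
  qed
  have fin: "finite (darts ?M)" by (rule finite_pair_map_darts[OF K])
  have perms: "permutation (rot ?M)" "permutation (opp ?M)"
    using rot opp fin by (auto simp: permutation_permutes)
  let ?R = "(step_rel (rot ?M, opp ?M))\<^sup>*"
  have R: "(c, rot ?M d) \<in> ?R" "(c, opp ?M d) \<in> ?R" if "(c, d) \<in> ?R" for c d
    by (rule rtrancl.rtrancl_into_rtrancl[OF that], simp add: step_rel_def)+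
  \<comment> \<open>Seen from the white darts, the first permutation is \<open>rot\<close> and the
    second is \<open>opp\<close>, then \<open>rot\<close>, then \<open>opp\<close>; connectivity of
    the pair thus becomes reachability in the map.\<close>
  have "component p e \<subseteq> {x \<in> K. (2 * e, 2 * x) \<in> ?R}"
  proof (rule component_least)
    show "e \<in> {x \<in> K. (2 * e, 2 * x) \<in> ?R}" using e by simp
    fix x assume "x \<in> {x \<in> K. (2 * e, 2 * x) \<in> ?R}"
    then have x: "x \<in> K" "(2 * e, 2 * x) \<in> ?R" by simp_all
    have "(2 * e, 2 * fst p x) \<in> ?R" using R(1)[OF x(2)] by simp
    then show "fst p x \<in> {x \<in> K. (2 * e, 2 * x) \<in> ?R}"
      using x(1) by (simp add: in_K)
    have "(2 * e, 2 * snd p x) \<in> ?R"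
      using R(2)[OF R(1)[OF R(2)[OF x(2)]]] x(1) by (simp add: in_K)
    then show "snd p x \<in> {x \<in> K. (2 * e, 2 * x) \<in> ?R}"
      using x(1) by (simp add: in_K)
  qed
  then have reach: "(2 * e, 2 * x) \<in> ?R" if "x \<in> K" for x using that by (auto simp: pD(7))
  have root: "(2 * e, d) \<in> ?R" if "d \<in> darts ?M" for d
  proof (cases d rule: even_odd_nat_cases)
    case (even x)
    then show ?thesis using that reach[of x] by simp
  next
    case (odd x)
    then have "x \<in> K" using that by simp
    then show ?thesis using R(2)[OF reach[of x]] odd by simp
  qed
  \<comment> \<open>Paths from the root are enough, since they can be reversed.\<close>
  have trans: "(c, d) \<in> ?R" if "c \<in> darts ?M" "d \<in> darts ?M" for c d
  proof (rule rtrancl_trans[OF _ root[OF that(2)]])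
    show "(c, 2 * e) \<in> ?R"
      by (rule step_rel_sym[OF _ _ root[OF that(1)]]) (use perms in simp_all)
  qed
  have R_eq: "step_rel (rot ?M, opp ?M) = {(x, y). y = rot ?M x \<or> y = opp ?M x}"
    by (simp add: step_rel_def)
  have "is_map ?M"
    unfolding is_map_def R_eq[symmetric] using fin rot opp opp_opp trans by blast
  moreover have "bipartite_coloring ?M"
  proof -
    have "whites ?M \<subseteq> vertices ?M"
    proof
      fix v assume "v \<in> whites ?M"
      then obtain x where x: "x \<in> K" "v = (*) 2 ` orbit (fst p) x" by auto
      then have "v = vertex_of ?M (2 * x)" "2 * x \<in> darts ?M"
        by (simp_all add: vertex_of_pair_map[OF p K])
      then show "v \<in> vertices ?M" unfolding vertices_def by blast
    qed
    moreover have "vertex_of ?M d \<in> whites ?M \<longleftrightarrow> vertex_of ?M (opp ?M d) \<notin> whites ?M"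
      if "d \<in> darts ?M" for d
    proof (cases d rule: even_odd_nat_cases)
      case (even x)
      then have "x \<in> K" using that by simp
      then show ?thesis using pair_map_white_iff[OF p K, of x] unfolding even by (simp del: pair_map_simps(6))
    next
      case (odd x)
      then have "x \<in> K" using that by simp
      then show ?thesis using pair_map_white_iff[OF p K, of x] unfolding odd by (simp del: pair_map_simps(6))
    qed
    ultimately show ?thesis unfolding bipartite_coloring_def by blast
  qed
  moreover have "card v = m" if v: "v \<in> vertices ?M" for v
  proof -
    obtain d where d: "d div 2 \<in> K" "v = vertex_of ?M d" using v unfolding vertices_def by auto
    show ?thesis
    proof (cases d rule: even_odd_nat_cases)
      case (even x)
      then show ?thesis using d pD(5) by (simp add: vertex_of_pair_map[OF p K] card_image inj_on_def)
    next
      case (odd x)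
      then show ?thesis using d pD(6) by (simp add: vertex_of_pair_map[OF p K] card_image inj_on_def)
    qed
  qed
  moreover have "root_dart ?M \<in> darts ?M" using e by simp
  moreover have "vertex_of ?M (root_dart ?M) \<in> whites ?M"
    using pair_map_white_iff(1)[OF p K e] by (simp del: pair_map_simps(6))
  ultimately show ?thesis unfolding rooted_mbip_def by blast
qed

lemma white_darts_pair_map:
  assumes "p \<in> connected_pairs m K e" and "finite K"
  shows "white_darts (pair_map K e p) = (*) 2 ` K"
proof (intro equalityI subsetI)
  fix d assume "d \<in> white_darts (pair_map K e p)"
  then have d: "d div 2 \<in> K" "vertex_of (pair_map K e p) d \<in> whites (pair_map K e p)"
    by (simp_all add: white_darts_def del: pair_map_simps(6))
  then show "d \<in> (*) 2 ` K"
    using pair_map_white_iff(2)[OF assms] by (cases d rule: even_odd_nat_cases) (auto simp del: pair_map_simps(6))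
next
  fix d assume "d \<in> (*) 2 ` K"
  then show "d \<in> white_darts (pair_map K e p)"
    using pair_map_white_iff(1)[OF assms] by (auto simp: white_darts_def simp del: pair_map_simps(6))
qed

text \<open>Number the white darts by \<open>K\<close> so that the root dart gets \<open>e\<close>.
  Transporting \<open>rot\<close> gives the first permutation, transporting \<open>opp\<close>,
  \<open>rot\<close>, \<open>opp\<close> the second.\<close>

lemma pair_map_surj:
  assumes M: "M \<in> rooted_mbip m" and K: "finite K" and e: "e \<in> K"
    and card: "card K = card (white_darts M)"
  shows "\<exists>p\<in>connected_pairs m K e. \<exists>\<phi>. is_iso \<phi> (pair_map K e p) M"
proof -
  let ?W = "white_darts M"
  have W: "finite ?W" "?W \<subseteq> darts M"
    using rooted_mbip_finite[OF M] by (simp_all add: white_darts_def)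
  note opp = rooted_mbip_opp[OF M] and rot = rooted_mbip_rot[OF M]
  have "card (K - {e}) = card (?W - {root_dart M})"
    using card e rooted_mbip_root[OF M] by simp
  then obtain h0 where h0: "bij_betw h0 (K - {e}) (?W - {root_dart M})"
    using finite_same_card_bij[of "K - {e}" "?W - {root_dart M}"] K W by auto
  define h where "h = h0(e := root_dart M)"
  have he: "h e = root_dart M" by (simp add: h_def)
  have "bij_betw h (K - {e}) (?W - {root_dart M})"
    by (rule bij_betw_cong[THEN iffD1, OF _ h0]) (simp add: h_def)
  then have h: "bij_betw h K ?W"
    using notIn_Un_bij_betw3[of e "K - {e}" h "?W - {root_dart M}"] e rooted_mbip_root[OF M]
    by (simp add: he insert_absorb)
  define g where "g = inv_into K h"
  have hW: "h x \<in> ?W" if "x \<in> K" for x using bij_betwE[OF h] that by blast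
  have gK: "g d \<in> K" "h (g d) = d" if "d \<in> ?W" for d
    using that bij_betwE[OF bij_betw_inv_into[OF h]] bij_betw_inv_into_right[OF h] by (auto simp: g_def)
  have gh: "g (h x) = x" if "x \<in> K" for x
    using that bij_betw_inv_into_left[OF h] by (simp add: g_def)
  have WD: "d \<in> darts M" if "d \<in> ?W" for d using that W(2) by blast
  define \<sigma> where "\<sigma> x = (if x \<in> K then g (rot M (h x)) else x)" for x
  define \<tau> where "\<tau> x = (if x \<in> K then g (opp M (rot M (opp M (h x)))) else x)" for x
  have rotW: "rot M d \<in> ?W" if "d \<in> ?W" for d
    using that rot(2)[OF WD[OF that]] by simp
  have tauW: "opp M (rot M (opp M d)) \<in> ?W" if "d \<in> ?W" for d
  proof -
    have d: "opp M d \<in> darts M" "opp M d \<notin> ?W" using opp(1,3)[OF WD[OF that]] that by simp_all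
    then have "rot M (opp M d) \<in> darts M" "rot M (opp M d) \<notin> ?W" using rot[OF d(1)] by simp_all
    then show ?thesis using opp(3) by simp
  qed
  have \<sigma>: "\<sigma> x \<in> K" "h (\<sigma> x) = rot M (h x)" if "x \<in> K" for x
    using that gK[OF rotW[OF hW[OF that]]] by (simp_all add: \<sigma>_def)
  have \<tau>: "\<tau> x \<in> K" "h (\<tau> x) = opp M (rot M (opp M (h x)))" if "x \<in> K" for x
    using that gK[OF tauW[OF hW[OF that]]] by (simp_all add: \<tau>_def)
  have \<tau>': "opp M (h (\<tau> x)) = rot M (opp M (h x))" if "x \<in> K" for x
    using \<tau>(2)[OF that] opp(2)[OF rot(1)[OF opp(1)[OF WD[OF hW[OF that]]]]] by simp
  have injh: "x = y" if "h x = h y" "x \<in> K" "y \<in> K" for x y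
    using that gh by metis
  have injrot: "c = d" if "rot M c = rot M d" for c d
    using injD[OF permutes_inj[OF rooted_mbipD(1)[OF M]] that] .
  have injopp: "c = d" if "opp M c = opp M d" for c d
    using injD[OF permutes_inj[OF rooted_mbipD(2)[OF M]] that] .
  have per: "f permutes K"
    if "\<And>x. x \<in> K \<Longrightarrow> f x \<in> K" "\<And>x y. x \<in> K \<Longrightarrow> y \<in> K \<Longrightarrow> f x = f y \<Longrightarrow> x = y"
      "\<And>x. x \<notin> K \<Longrightarrow> f x = x" for f
  proof (rule bij_imp_permutes)
    have "inj_on f K" using that(2) by (rule inj_onI)
    moreover have "f ` K = K"
      by (rule endo_inj_surj[OF K _ \<open>inj_on f K\<close>]) (use that(1) in blast)
    ultimately show "bij_betw f K K" by (simp add: bij_betw_def)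
  qed (rule that(3))
  have \<sigma>per: "\<sigma> permutes K"
  proof (rule per)
    fix x y assume "x \<in> K" "y \<in> K" "\<sigma> x = \<sigma> y"
    then show "x = y" using \<sigma>(2) injh injrot by metis
  qed (simp_all add: \<sigma>(1), simp add: \<sigma>_def)
  have \<tau>per: "\<tau> permutes K"
  proof (rule per)
    fix x y assume "x \<in> K" "y \<in> K" "\<tau> x = \<tau> y"
    then have "rot M (opp M (h x)) = rot M (opp M (h y))" using \<tau>' by metis
    then show "x = y" using injh injrot injopp \<open>x \<in> K\<close> \<open>y \<in> K\<close> by metis
  qed (simp_all add: \<tau>(1), simp add: \<tau>_def)
  have orb\<sigma>: "h ` orbit \<sigma> x = vertex_of M (h x)" if "x \<in> K" for x
    unfolding vertex_of_def
  proof (rule orbit_inverse[OF self_in_orbit[OF \<sigma>per K]])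
    fix y assume "y \<in> orbit \<sigma> x"
    then have "y \<in> K" using permutes_orbit_subset[OF \<sigma>per that] by blast
    then show "rot M (h y) = h (\<sigma> y)" by (simp add: \<sigma>(2))
  qed
  have orb\<tau>: "(\<lambda>x. opp M (h x)) ` orbit \<tau> x = vertex_of M (opp M (h x))" if "x \<in> K" for x
    unfolding vertex_of_def
  proof (rule orbit_inverse[OF self_in_orbit[OF \<tau>per K], where f = "\<lambda>x. opp M (h x)"])
    fix y assume "y \<in> orbit \<tau> x"
    then have "y \<in> K" using permutes_orbit_subset[OF \<tau>per that] by blast
    then show "rot M (opp M (h y)) = opp M (h (\<tau> y))" by (simp add: \<tau>')
  qed
  have vm: "card (vertex_of M d) = m" if "d \<in> darts M" for d
    using M that by (simp add: rooted_mbip_def vertices_def)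
  have "card (orbit \<sigma> x) = m" if x: "x \<in> K" for x
  proof -
    have "inj_on h (orbit \<sigma> x)"
      by (rule inj_onI, rule injh) (use permutes_orbit_subset[OF \<sigma>per x] in blast)+
    then have "card (orbit \<sigma> x) = card (vertex_of M (h x))"
      unfolding orb\<sigma>[OF x, symmetric] by (rule card_image[symmetric])
    then show ?thesis using vm[OF WD[OF hW[OF x]]] by simp
  qed
  moreover have "card (orbit \<tau> x) = m" if x: "x \<in> K" for x
  proof -
    have "inj_on (\<lambda>x. opp M (h x)) (orbit \<tau> x)"
      by (rule inj_onI, rule injh, rule injopp) (use permutes_orbit_subset[OF \<tau>per x] in blast)+
    then have "card (orbit \<tau> x) = card (vertex_of M (opp M (h x)))"
      unfolding orb\<tau>[OF x, symmetric] by (rule card_image[symmetric])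
    then show ?thesis using vm[OF opp(1)[OF WD[OF hW[OF x]]]] by simp
  qed
  ultimately have mp: "(\<sigma>, \<tau>) \<in> mpairs m K"
    using \<sigma>per \<tau>per by (simp add: mpairs_def mperms_def)
  \<comment> \<open>The number of the edge that carries \<open>d\<close>. It projects paths of the
    map to paths of \<open>(\<sigma>, \<tau>)\<close>: \<open>opp\<close> stays on the edge, and
    \<open>rot\<close> becomes \<open>\<sigma>\<close> or \<open>\<tau>\<close> according to the
    colour of the dart.\<close>
  define edge where "edge d = (if d \<in> ?W then g d else g (opp M d))" for d
  have edge_opp: "edge (opp M d) = edge d" if "d \<in> darts M" for d
    using opp[OF that] by (simp add: edge_def)
  have edge_rot: "edge (rot M d) = (if d \<in> ?W then \<sigma> (edge d) else \<tau> (edge d))" if d: "d \<in> darts M" for d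
  proof (cases "d \<in> ?W")
    case True
    then show ?thesis using rotW[OF True] gK[OF True] by (simp add: edge_def \<sigma>_def)
  next
    case False
    then have "opp M d \<in> ?W" using opp(3)[OF d] by simp
    then show ?thesis
      using False rot(2)[OF d] gK[of "opp M d"] opp(2)[OF d] by (simp add: edge_def \<tau>_def)
  qed
  have "d \<in> darts M \<and> edge d \<in> component (\<sigma>, \<tau>) e"
    if "(root_dart M, d) \<in> {(x, y). y = rot M x \<or> y = opp M x}\<^sup>*" for d
    using that
  proof induction
    case base
    have "edge (root_dart M) = e"
      using rooted_mbip_root[OF M] gh[OF e] by (simp add: edge_def he[symmetric])
    then show ?case using rooted_mbipD(3)[OF M] by (simp add: component_self)
  next
    case (step c d)
    have comp: "\<sigma> (edge c) \<in> component (\<sigma>, \<tau>) e" "\<tau> (edge c) \<in> component (\<sigma>, \<tau>) e"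
      using component_step[of "edge c" "(\<sigma>, \<tau>)" e] step.IH by simp_all
    have c: "c \<in> darts M" using step.IH by simp
    consider "d = rot M c" | "d = opp M c" using step.hyps(2) by auto
    then show ?case
    proof cases
      case 1
      then show ?thesis using comp edge_rot[OF c] rot(1)[OF c] by simp
    next
      case 2
      then show ?thesis using step.IH edge_opp[OF c] opp(1)[OF c] by simp
    qed
  qed
  moreover have "(root_dart M, d) \<in> {(x, y). y = rot M x \<or> y = opp M x}\<^sup>*" if "d \<in> darts M" for d
    using M that rooted_mbipD(3)[OF M] by (simp add: rooted_mbip_def is_map_def)
  ultimately have "edge d \<in> component (\<sigma>, \<tau>) e" if "d \<in> darts M" for d
    using that by blast
  moreover have "edge (h x) = x" if "x \<in> K" for x
    using hW[OF that] gh[OF that] by (simp add: edge_def)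
  ultimately have "K \<subseteq> component (\<sigma>, \<tau>) e"
    using WD hW by (metis subsetI)
  then have p: "(\<sigma>, \<tau>) \<in> connected_pairs m K e"
    using component_subset[of "(\<sigma>, \<tau>)" K e] \<sigma>per \<tau>per e mp by (simp add: connected_pairs_def subset_antisym)
  let ?N = "pair_map K e (\<sigma>, \<tau>)"
  define \<phi> where "\<phi> d = (if even d then h (d div 2) else opp M (h (d div 2)))" for d
  have \<phi>: "\<phi> (2 * x) = h x" "\<phi> (Suc (2 * x)) = opp M (h x)" for x
    by (simp_all add: \<phi>_def)
  have "bij_betw \<phi> (darts ?N) (darts M)"
  proof (rule bij_betwI[where g = "\<lambda>d. if d \<in> ?W then 2 * g d else Suc (2 * g (opp M d))"])
    show "\<phi> \<in> darts ?N \<rightarrow> darts M"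
    proof
      fix d assume "d \<in> darts ?N"
      then show "\<phi> d \<in> darts M"
        using WD[OF hW[of "d div 2"]] opp(1)[OF WD[OF hW[of "d div 2"]]] by (simp add: \<phi>_def)
    qed
    show "(\<lambda>d. if d \<in> ?W then 2 * g d else Suc (2 * g (opp M d))) \<in> darts M \<rightarrow> darts ?N"
      using gK opp(3) by auto
    show "(if \<phi> d \<in> ?W then 2 * g (\<phi> d) else Suc (2 * g (opp M (\<phi> d)))) = d" if d: "d \<in> darts ?N" for d
    proof (cases d rule: even_odd_nat_cases)
      case (even x)
      then have "x \<in> K" using d by simp
      then show ?thesis using hW gh by (simp add: even \<phi>)
    next
      case (odd x)
      then have x: "x \<in> K" using d by simp
      then show ?thesis using hW[OF x] gh[OF x] opp[OF WD[OF hW[OF x]]] by (simp add: odd \<phi>)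
    qed
    show "\<phi> (if d \<in> ?W then 2 * g d else Suc (2 * g (opp M d))) = d" if d: "d \<in> darts M" for d
      using gK(2)[of d] gK(2)[of "opp M d"] opp[OF d] by (simp add: \<phi>)
  qed
  moreover have "\<phi> (rot ?N d) = rot M (\<phi> d) \<and> \<phi> (opp ?N d) = opp M (\<phi> d)" if d: "d \<in> darts ?N" for d
  proof (cases d rule: even_odd_nat_cases)
    case (even x)
    then have "x \<in> K" using d by simp
    then show ?thesis by (simp add: even \<phi> \<sigma>(2))
  next
    case (odd x)
    then have x: "x \<in> K" using d by simp
    then show ?thesis using opp(2)[OF WD[OF hW[OF x]]] by (simp add: odd \<phi> \<tau>')
  qed
  moreover have "image \<phi> ` whites ?N = whites M"
  proof -
    have "image \<phi> ` whites ?N = (\<lambda>x. h ` orbit \<sigma> x) ` K"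
      by (simp add: image_image \<phi>)
    also have "\<dots> = (\<lambda>x. vertex_of M (h x)) ` K"
      by (rule image_cong) (simp_all add: orb\<sigma>)
    also have "\<dots> = vertex_of M ` ?W"
      unfolding bij_betw_imp_surj_on[OF h, symmetric] by (simp add: image_image)
    also have "\<dots> = whites M"
      using rooted_mbipD(4)[OF M] by (auto simp: white_darts_def vertices_def)
    finally show ?thesis .
  qed
  moreover have "\<phi> (root_dart ?N) = root_dart M" by (simp add: \<phi> he)
  ultimately have "is_iso \<phi> ?N M" unfolding is_iso_def by blast
  then show ?thesis using p by blast
qed

section \<open>Relabelling the edges of a connected pair\<close>

definition conj_pair :: "('a \<Rightarrow> 'a) \<Rightarrow> ('a \<Rightarrow> 'a) \<times> ('a \<Rightarrow> 'a) \<Rightarrow> ('a \<Rightarrow> 'a) \<times> ('a \<Rightarrow> 'a)" where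
  "conj_pair \<pi> p = (\<pi> \<circ> fst p \<circ> inv \<pi>, \<pi> \<circ> snd p \<circ> inv \<pi>)"

lemma conj_pair_connected:
  assumes p: "p \<in> connected_pairs m K e" and K: "finite K" and \<pi>: "\<pi> permutes K" "\<pi> e = e"
    and e: "e \<in> K"
  shows "conj_pair \<pi> p \<in> connected_pairs m K e"
proof -
  note pD = connected_pairsD[OF p K]
  have inv: "inv \<pi> (\<pi> x) = x" for x using permutes_inverses(2)[OF \<pi>(1)] .
  have surj: "\<exists>y\<in>K. x = \<pi> y" if "x \<in> K" for x
    using that permutes_image[OF \<pi>(1)] by blast
  have mp: "\<pi> \<circ> \<sigma> \<circ> inv \<pi> \<in> mperms m K" if \<sigma>: "\<sigma> permutes K" "\<And>x. x \<in> K \<Longrightarrow> card (orbit \<sigma> x) = m" for \<sigma>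
  proof -
    have "\<pi> \<circ> \<sigma> \<circ> inv \<pi> permutes K"
      by (intro permutes_compose permutes_inv \<pi>(1) \<sigma>(1))
    moreover have "card (orbit (\<pi> \<circ> \<sigma> \<circ> inv \<pi>) x) = m" if x: "x \<in> K" for x
    proof -
      obtain y where y: "y \<in> K" "x = \<pi> y" using surj[OF x] by blast
      have "\<pi> ` orbit \<sigma> y = orbit (\<pi> \<circ> \<sigma> \<circ> inv \<pi>) (\<pi> y)"
        by (rule orbit_inverse[OF self_in_orbit[OF \<sigma>(1) K]]) (simp add: inv)
      then have "card (orbit (\<pi> \<circ> \<sigma> \<circ> inv \<pi>) x) = card (\<pi> ` orbit \<sigma> y)" by (simp add: y(2))
      also have "\<dots> = m" using \<sigma>(2)[OF y(1)] permutes_inj_on[OF \<pi>(1)] by (simp add: card_image)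
      finally show ?thesis .
    qed
    ultimately show ?thesis by (simp add: mperms_def)
  qed
  have "component p e \<subseteq> {x. \<pi> x \<in> component (conj_pair \<pi> p) e}"
  proof (rule component_least)
    show "e \<in> {x. \<pi> x \<in> component (conj_pair \<pi> p) e}" by (simp add: \<pi>(2) component_self)
    fix x assume "x \<in> {x. \<pi> x \<in> component (conj_pair \<pi> p) e}"
    then have "\<pi> x \<in> component (conj_pair \<pi> p) e" by simp
    then show "fst p x \<in> {x. \<pi> x \<in> component (conj_pair \<pi> p) e}"
      "snd p x \<in> {x. \<pi> x \<in> component (conj_pair \<pi> p) e}"
      using component_step[of "\<pi> x" "conj_pair \<pi> p" e] by (simp_all add: conj_pair_def inv)
  qed
  then have "K \<subseteq> component (conj_pair \<pi> p) e"
    unfolding pD(7) using surj by blast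
  moreover have "conj_pair \<pi> p \<in> mpairs m K"
    unfolding mpairs_def conj_pair_def using mp pD by simp
  moreover from this have "component (conj_pair \<pi> p) e \<subseteq> K"
    by (intro component_subset e) (auto simp: mpairs_def mperms_def)
  ultimately show ?thesis by (simp add: connected_pairs_def subset_antisym)
qed

text \<open>Rigidity: the set where the two relabellings agree contains \<open>e\<close> and is
  closed under both permutations of \<open>p\<close>, hence contains the whole component.\<close>

lemma conj_pair_inj:
  assumes p: "p \<in> connected_pairs m K e" and K: "finite K" and e: "e \<in> K"
    and \<pi>: "\<pi> permutes K" "\<pi> e = e" and \<rho>: "\<rho> permutes K" "\<rho> e = e"
    and eq: "conj_pair \<pi> p = conj_pair \<rho> p"
  shows "\<pi> = \<rho>"
proof -
  have conj: "fst (conj_pair \<pi> p) (\<pi> x) = \<pi> (fst p x)" "snd (conj_pair \<pi> p) (\<pi> x) = \<pi> (snd p x)"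
    if "\<pi> permutes K" for \<pi> x
    by (simp_all add: conj_pair_def permutes_inverses(2)[OF that])
  have "component p e \<subseteq> {x. \<pi> x = \<rho> x}"
  proof (rule component_least)
    show "e \<in> {x. \<pi> x = \<rho> x}" by (simp add: \<pi>(2) \<rho>(2))
    fix x assume "x \<in> {x. \<pi> x = \<rho> x}"
    then have x: "\<pi> x = \<rho> x" by simp
    show "fst p x \<in> {x. \<pi> x = \<rho> x}"
      using conj(1)[OF \<pi>(1), of x] conj(1)[OF \<rho>(1), of x] by (simp add: x eq)
    show "snd p x \<in> {x. \<pi> x = \<rho> x}"
      using conj(2)[OF \<pi>(1), of x] conj(2)[OF \<rho>(1), of x] by (simp add: x eq)
  qed
  then have "\<pi> x = \<rho> x" if "x \<in> K" for x
    using that unfolding connected_pairsD(7)[OF p K] by blast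
  moreover have "\<pi> x = \<rho> x" if "x \<notin> K" for x
    using that permutes_not_in[OF \<pi>(1)] permutes_not_in[OF \<rho>(1)] by simp
  ultimately show ?thesis by (intro ext) blast
qed

lemma pair_map_iso_conj:
  assumes p: "p \<in> connected_pairs m K e" and K: "finite K" and \<pi>: "\<pi> permutes K" "\<pi> e = e"
  shows "is_iso (\<lambda>d. if even d then 2 * \<pi> (d div 2) else Suc (2 * \<pi> (d div 2)))
    (pair_map K e p) (pair_map K e (conj_pair \<pi> p))" (is "is_iso ?\<phi> ?M ?N")
proof -
  note pD = connected_pairsD[OF p K]
  have inv: "inv \<pi> (\<pi> x) = x" "\<pi> (inv \<pi> x) = x" for x
    using permutes_inverses[OF \<pi>(1)] by simp_all
  have in_K: "\<pi> x \<in> K \<longleftrightarrow> x \<in> K" "inv \<pi> x \<in> K \<longleftrightarrow> x \<in> K" for x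
    using permutes_in_image[OF \<pi>(1)] permutes_in_image[OF permutes_inv[OF \<pi>(1)]] by simp_all
  have "bij_betw ?\<phi> (darts ?M) (darts ?N)"
    by (rule bij_betwI[where g = "\<lambda>d. if even d then 2 * inv \<pi> (d div 2) else Suc (2 * inv \<pi> (d div 2))"])
      (auto simp: in_K inv)
  moreover have "?\<phi> (rot ?M d) = rot ?N (?\<phi> d) \<and> ?\<phi> (opp ?M d) = opp ?N (?\<phi> d)" if "d \<in> darts ?M" for d
    using that by (cases d rule: even_odd_nat_cases) (simp_all add: conj_pair_def inv in_K)
  moreover have "image ?\<phi> ` whites ?M = whites ?N"
  proof -
    have "\<pi> ` orbit (fst p) x = orbit (\<pi> \<circ> fst p \<circ> inv \<pi>) (\<pi> x)" for x
      by (rule orbit_inverse[OF permutation_self_in_orbit[OF pD(3)]]) (simp add: inv)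
    moreover have "?\<phi> ` (*) 2 ` S = (*) 2 ` \<pi> ` S" for S
      unfolding image_image by (rule image_cong) simp_all
    ultimately have orb: "?\<phi> ` (*) 2 ` orbit (fst p) x = (*) 2 ` orbit (fst (conj_pair \<pi> p)) (\<pi> x)" for x
      by (simp only: conj_pair_def fst_conv)
    have "image ?\<phi> ` whites ?M = (\<lambda>x. ?\<phi> ` (*) 2 ` orbit (fst p) x) ` K"
      unfolding pair_map_simps(6) by (rule image_image)
    also have "\<dots> = (\<lambda>x. (*) 2 ` orbit (fst (conj_pair \<pi> p)) x) ` \<pi> ` K"
      unfolding orb by (rule image_image[symmetric])
    finally show ?thesis by (simp only: permutes_image[OF \<pi>(1)] pair_map_simps(6))
  qed
  moreover have "?\<phi> (root_dart ?M) = root_dart ?N" by (simp add: \<pi>(2))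
  ultimately show ?thesis unfolding is_iso_def by blast
qed

text \<open>An isomorphism preserves white vertices, hence the parity of darts, and it commutes with
  \<open>opp\<close>. It is therefore given by one permutation of the edges, which fixes
  \<open>e\<close> because the root dart is fixed.\<close>

lemma pair_map_isoD:
  assumes p: "p \<in> connected_pairs m K e" and p': "p' \<in> connected_pairs m K e"
    and K: "finite K" and e: "e \<in> K" and iso: "is_iso \<phi> (pair_map K e p) (pair_map K e p')"
  shows "\<exists>\<pi>. \<pi> permutes K - {e} \<and> p' = conj_pair \<pi> p"
proof -
  let ?M = "pair_map K e p" and ?N = "pair_map K e p'"
  note pD = connected_pairsD[OF p K] and pD' = connected_pairsD[OF p' K]
  have bij: "bij_betw \<phi> (darts ?M) (darts ?N)" and wh: "image \<phi> ` whites ?M = whites ?N"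
    and root: "\<phi> (2 * e) = 2 * e"
    and rot: "\<And>d. d \<in> darts ?M \<Longrightarrow> \<phi> (rot ?M d) = rot ?N (\<phi> d)"
    and opp: "\<And>d. d \<in> darts ?M \<Longrightarrow> \<phi> (opp ?M d) = opp ?N (\<phi> d)"
    using iso unfolding is_iso_def by simp_all
  define \<pi> where "\<pi> x = (if x \<in> K then \<phi> (2 * x) div 2 else x)" for x
  have even: "\<phi> (2 * x) = 2 * \<pi> x" "\<pi> x \<in> K" if x: "x \<in> K" for x
  proof -
    have "\<phi> ` (*) 2 ` orbit (fst p) x \<in> whites ?N"
      unfolding wh[symmetric] using x by auto
    then obtain y where "\<phi> ` (*) 2 ` orbit (fst p) x = (*) 2 ` orbit (fst p') y" by auto
    moreover have "\<phi> (2 * x) \<in> \<phi> ` (*) 2 ` orbit (fst p) x"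
      using permutation_self_in_orbit[OF pD(3)] by blast
    ultimately have "even (\<phi> (2 * x))" by auto
    then show "\<phi> (2 * x) = 2 * \<pi> x" using x by (simp add: \<pi>_def)
    have "2 * x \<in> darts ?M" using x by simp
    then have "\<phi> (2 * x) \<in> darts ?N" by (rule bij_betw_apply[OF bij])
    then show "\<pi> x \<in> K" using x by (simp add: \<pi>_def)
  qed
  have odd: "\<phi> (Suc (2 * x)) = Suc (2 * \<pi> x)" if x: "x \<in> K" for x
    using opp[of "2 * x"] x even[OF x] by simp
  have in_K: "fst p x \<in> K \<longleftrightarrow> x \<in> K" "snd p x \<in> K \<longleftrightarrow> x \<in> K" for x
    using permutes_in_image[OF pD(1)] permutes_in_image[OF pD(2)] by simp_all
  have "inj_on \<pi> K"
  proof (rule inj_onI)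
    fix x y assume xy: "x \<in> K" "y \<in> K" "\<pi> x = \<pi> y"
    then have "\<phi> (2 * x) = \<phi> (2 * y)" by (simp add: even)
    then have "2 * x = 2 * y"
      by (rule inj_onD[OF bij_betw_imp_inj_on[OF bij]]) (use xy(1,2) in simp_all)
    then show "x = y" by simp
  qed
  moreover from this have "\<pi> ` K = K" using even(2) by (intro endo_inj_surj K) auto
  ultimately have \<pi>: "\<pi> permutes K"
    by (intro bij_imp_permutes) (simp_all add: bij_betw_def, simp add: \<pi>_def)
  have \<pi>e: "\<pi> e = e" using even(1)[OF e] root by simp
  have "\<pi> permutes K - {e}"
    by (rule permutes_superset[OF \<pi>]) (use \<pi>e in auto)
  have c: "\<pi> (fst p x) = fst p' (\<pi> x) \<and> \<pi> (snd p x) = snd p' (\<pi> x)" if x: "x \<in> K" for x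
    using rot[of "2 * x"] rot[of "Suc (2 * x)"] x by (simp add: even odd in_K)
  have "p' = conj_pair \<pi> p"
  proof -
    have "fst p' x = \<pi> (fst p (inv \<pi> x)) \<and> snd p' x = \<pi> (snd p (inv \<pi> x))" for x
    proof (cases "x \<in> K")
      case True
      then have "inv \<pi> x \<in> K" using permutes_in_image[OF permutes_inv[OF \<pi>]] by blast
      then show ?thesis using c[of "inv \<pi> x"] permutes_inverses(1)[OF \<pi>] by simp
    next
      case False
      then have "inv \<pi> x = x" using permutes_not_in[OF permutes_inv[OF \<pi>]] by simp
      then show ?thesis
        using False permutes_not_in[OF \<pi>] permutes_not_in[OF pD(1)] permutes_not_in[OF pD(2)]
          permutes_not_in[OF pD'(1)] permutes_not_in[OF pD'(2)] by simp
    qed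
    then show ?thesis by (simp add: conj_pair_def prod_eq_iff fun_eq_iff)
  qed
  with \<open>\<pi> permutes K - {e}\<close> show ?thesis by blast
qed

section \<open>Rooted maps by number of black vertices\<close>

definition map_classes :: "nat \<Rightarrow> nat \<Rightarrow> rmap set set" where
  "map_classes m n = {C \<in> rooted_mbip m // map_iso m. black_vertices (Some C) = n}"

text \<open>
  Relabellings fixing the root act freely on connected pairs, so
  each rooted map comes from exactly \<open>(card K - 1)!\<close> pairs.
\<close>

lemma card_connected_pairs:
  fixes K :: "nat set"
  assumes m: "m > 0" and K: "finite K" and e: "e \<in> K" and card: "card K = m * n"
  shows "card (connected_pairs m K e) = card (map_classes m n) * fact (m * n - 1)"
    and "finite (map_classes m n)"
proof -
  let ?X = "connected_pairs m K e"
  define cls where "cls p = map_iso m `` {pair_map K e p}" for p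
  have fin: "finite ?X"
    using finite_mpairs[OF K, of m] by (simp add: connected_pairs_def)
  have cls_eq: "cls p = cls p' \<longleftrightarrow> (\<exists>\<phi>. is_iso \<phi> (pair_map K e p) (pair_map K e p'))"
    if "p \<in> ?X" "p' \<in> ?X" for p p'
    using pair_map_rooted_mbip[OF that(1) K e] pair_map_rooted_mbip[OF that(2) K e]
    unfolding cls_def by (subst eq_equiv_class_iff[OF equiv_map_iso]) (simp_all add: map_iso_def)
  have image: "cls ` ?X = map_classes m n"
  proof (intro equalityI subsetI)
    fix C assume "C \<in> cls ` ?X"
    then obtain p where p: "p \<in> ?X" "C = cls p" by blast
    have M: "pair_map K e p \<in> rooted_mbip m" by (rule pair_map_rooted_mbip[OF p(1) K e])
    then have C: "C \<in> rooted_mbip m // map_iso m"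
      unfolding p(2) cls_def by (rule quotientI)
    moreover have "pair_map K e p \<in> C"
      unfolding p(2) cls_def by (rule equiv_class_self[OF equiv_map_iso M])
    ultimately have "black_vertices (Some C) = num_blacks (pair_map K e p)"
      by (rule black_vertices_class)
    moreover have "m * num_blacks (pair_map K e p) = m * n"
      unfolding card_white_darts[OF M, symmetric] white_darts_pair_map[OF p(1) K]
      by (simp add: card_image inj_on_def card)
    ultimately show "C \<in> map_classes m n" using C m by (simp add: map_classes_def)
  next
    fix C assume "C \<in> map_classes m n"
    then have C: "C \<in> rooted_mbip m // map_iso m" "black_vertices (Some C) = n"
      by (simp_all only: map_classes_def mem_Collect_eq)
    then obtain M where M: "M \<in> rooted_mbip m" "C = map_iso m `` {M}" by (auto elim: quotientE)
    have "M \<in> C" unfolding M(2) by (rule equiv_class_self[OF equiv_map_iso M(1)])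
    then have "num_blacks M = n" using black_vertices_class[OF C(1)] C(2) by simp
    \<comment> \<open>The number of black vertices determines the number of edges, so one label set
      \<open>K\<close> serves for all maps of the level.\<close>
    then have "card K = card (white_darts M)" using card_white_darts[OF M(1)] card by simp
    then obtain p \<phi> where p: "p \<in> ?X" "is_iso \<phi> (pair_map K e p) M"
      using pair_map_surj[OF M(1) K e] by blast
    then have "(pair_map K e p, M) \<in> map_iso m"
      using pair_map_rooted_mbip[OF p(1) K e] M(1) by (auto simp: map_iso_def)
    then have "cls p = C"
      unfolding cls_def M(2) by (rule equiv_class_eq[OF equiv_map_iso])
    then show "C \<in> cls ` ?X" using p(1) by blast
  qed
  show "finite (map_classes m n)"
    unfolding image[symmetric] using fin by simp
  have fibre: "card {q \<in> ?X. cls q = cls p} = fact (m * n - 1)" if p: "p \<in> ?X" for p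
  proof -
    have fix_e: "\<pi> permutes K" "\<pi> e = e" if "\<pi> permutes K - {e}" for \<pi>
      using permutes_subset[OF that] permutes_not_in[OF that, of e] by auto
    have "{q \<in> ?X. cls q = cls p} = (\<lambda>\<pi>. conj_pair \<pi> p) ` {\<pi>. \<pi> permutes K - {e}}"
    proof (intro equalityI subsetI)
      fix q assume "q \<in> {q \<in> ?X. cls q = cls p}"
      then have q: "q \<in> ?X" "cls p = cls q" by simp_all
      then obtain \<phi> where "is_iso \<phi> (pair_map K e p) (pair_map K e q)"
        using cls_eq[OF p q(1)] by blast
      then show "q \<in> (\<lambda>\<pi>. conj_pair \<pi> p) ` {\<pi>. \<pi> permutes K - {e}}"
        using pair_map_isoD[OF p q(1) K e] by blast
    next
      fix q assume "q \<in> (\<lambda>\<pi>. conj_pair \<pi> p) ` {\<pi>. \<pi> permutes K - {e}}"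
      then obtain \<pi> where \<pi>: "\<pi> permutes K - {e}" "q = conj_pair \<pi> p" by blast
      have q: "q \<in> ?X" unfolding \<pi>(2) by (rule conj_pair_connected[OF p K fix_e[OF \<pi>(1)] e])
      have "cls p = cls q"
        using cls_eq[OF p q] pair_map_iso_conj[OF p K fix_e[OF \<pi>(1)]] unfolding \<pi>(2) by blast
      then show "q \<in> {q \<in> ?X. cls q = cls p}" using q by simp
    qed
    moreover have "inj_on (\<lambda>\<pi>. conj_pair \<pi> p) {\<pi>. \<pi> permutes K - {e}}"
      by (rule inj_onI, rule conj_pair_inj[OF p K e]) (simp_all add: fix_e)
    ultimately have "card {q \<in> ?X. cls q = cls p} = card {\<pi>. \<pi> permutes K - {e}}"
      by (simp add: card_image)
    also have "\<dots> = fact (m * n - 1)"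
      by (rule card_permutations) (use K e card in simp_all)
    finally show ?thesis .
  qed
  have "card ?X = (\<Sum>C\<in>cls ` ?X. card {q \<in> ?X. cls q = C})"
    using sum.image_gen[OF fin, of "\<lambda>_. 1::nat" cls] by simp
  also have "\<dots> = (\<Sum>C\<in>cls ` ?X. fact (m * n - 1))"
    by (rule sum.cong) (use fibre in auto)
  finally show "card ?X = card (map_classes m n) * fact (m * n - 1)"
    by (simp add: image)
qed

text \<open>The root dart is white, and white darts number \<open>m\<close> per black vertex. So the
  coefficient at \<open>n = 0\<close> is due to \<open>None\<close> alone.\<close>

lemma map_classes_0: "m > 0 \<Longrightarrow> map_classes m 0 = {}"
proof (rule ccontr)
  assume m: "m > 0" and "map_classes m 0 \<noteq> {}"
  then obtain C where C: "C \<in> rooted_mbip m // map_iso m" "black_vertices (Some C) = 0"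
    unfolding map_classes_def by blast
  then obtain M where M: "M \<in> rooted_mbip m" "C = map_iso m `` {M}" by (auto elim: quotientE)
  have "M \<in> C" unfolding M(2) by (rule equiv_class_self[OF equiv_map_iso M(1)])
  then have "card (white_darts M) = 0"
    using black_vertices_class[OF C(1)] C(2) card_white_darts[OF M(1)] by simp
  moreover have "finite (white_darts M)"
    using rooted_mbip_finite[OF M(1)] by (simp add: white_darts_def)
  ultimately show False using rooted_mbip_root[OF M(1)] by simp
qed

lemma rooted_maps_level:
  assumes "m > 0"
  shows "{x \<in> rooted_maps m. black_vertices x = n} =
    (if n = 0 then {None} else Some ` map_classes m n)"
proof -
  have "{x \<in> rooted_maps m. black_vertices x = n} =
      (if n = 0 then {None} else {}) \<union> Some ` map_classes m n"
    by (auto simp: rooted_maps_def map_classes_def simp del: black_vertices.simps(2))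
  then show ?thesis using map_classes_0[OF assms] by simp
qed

lemma enumerated_by_rooted_maps:
  assumes "m \<ge> 3" and "series_system m r q"
  shows "enumerated_by (rooted_maps m) black_vertices (r 1)"
proof -
  have m: "m > 0" using assms(1) by simp
  have fin: "finite (map_classes m n)" if "n > 0" for n
    by (rule card_connected_pairs(2)[of m "{..<m * n}" 0]) (use m that in simp_all)
  define c where "c n = card {x \<in> rooted_maps m. black_vertices x = n}" for n
  have c0: "c 0 = 1" and c: "n > 0 \<Longrightarrow> c n = card (map_classes m n)" for n
    by (simp_all add: c_def rooted_maps_level[OF m] card_image)
  have weight: "of_nat (m * n) * map_weight m n = (\<Sum>k=1..n. map_weight m (n - k) * of_nat (c k))"
    if "n > 0" for n
  proof -
    have "card (connected_pairs m K e) = c k * fact (m * k - 1)"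
      if K: "finite K" "e \<in> K" "card K = m * k" for K :: "nat set" and e k
    proof -
      \<comment> \<open>The value \<open>c 0 = 1\<close> belongs to the trivial object and is not a
        number of classes of maps; the element \<open>e\<close> of \<open>K\<close> excludes this
        case.\<close>
      have "k > 0" using K by (cases k) auto
      then show ?thesis using card_connected_pairs(1)[OF m K] c by simp
    qed
    then show ?thesis
      using card_mpairs_weight[OF m that, of c] by (simp add: map_weight_def mult.commute)
  qed
  \<comment> \<open>Both sequences solve the same triangular system, whose diagonal entry is
    \<open>map_weight m 0 = 1\<close>.\<close>
  have "fps_nth (r 1) n = int (c n)" for n
  proof (induction n rule: less_induct)
    case (less n)
    have mw0: "map_weight m 0 = 1" by (simp add: map_weight_def)
    have "(\<Sum>k=0..n. map_weight m (n - k) * of_int (fps_nth (r 1) k)) =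
        (\<Sum>k=0..n. map_weight m (n - k) * of_nat (c k))"
    proof (cases "n = 0")
      case True
      then show ?thesis
        using map_weight_r_1[OF assms(2), of 0] assms(1) by (simp add: c0)
    next
      case False
      \<comment> \<open>The term with \<open>k = 0\<close>, from the trivial object, supplies the 1
        in \<open>m n + 1\<close>.\<close>
      have "(\<Sum>k=0..n. map_weight m (n - k) * of_nat (c k)) =
          map_weight m n + (\<Sum>k=1..n. map_weight m (n - k) * of_nat (c k))"
        by (simp add: sum.atLeast_Suc_atMost c0)
      also have "\<dots> = of_nat (Suc (m * n)) * map_weight m n"
        using weight[of n] False by (simp add: algebra_simps)
      finally show ?thesis
        using map_weight_r_1[OF assms(2), of n] assms(1) by simp
    qed
    then have "(\<Sum>k<n. map_weight m (n - k) * of_int (fps_nth (r 1) k)) + of_int (fps_nth (r 1) n) =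
        (\<Sum>k<n. map_weight m (n - k) * of_nat (c k)) + of_nat (c n)"
      by (simp add: atLeast0AtMost lessThan_Suc_atMost[symmetric] mw0)
    moreover have "(\<Sum>k<n. map_weight m (n - k) * of_int (fps_nth (r 1) k)) =
        (\<Sum>k<n. map_weight m (n - k) * of_nat (c k))"
      by (rule sum.cong) (use less in simp_all)
    ultimately have "(of_int (fps_nth (r 1) n) :: rat) = of_int (int (c n))" by simp
    then show ?case by (simp only: of_int_eq_iff)
  qed
  moreover have "finite {x \<in> rooted_maps m. black_vertices x = n}" for n
    using fin by (simp add: rooted_maps_level[OF m])
  ultimately show ?thesis
    unfolding enumerated_by_def c_def by blast
qed

text \<open>Level sets of the same weight are finite and of equal size; arbitrary bijections between
  them are glued, the weight of \<open>x\<close> telling which one to apply.\<close>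

lemma enumerated_by_same_series:
  assumes "enumerated_by S w f" and "enumerated_by S' w' f"
  shows "\<exists>\<phi>. bij_betw \<phi> S S' \<and> (\<forall>x\<in>S. w' (\<phi> x) = w x)"
proof -
  let ?L = "\<lambda>n. {x \<in> S. w x = n}" and ?L' = "\<lambda>n. {x \<in> S'. w' x = n}"
  have "\<exists>h. bij_betw h (?L n) (?L' n)" for n
    by (rule finite_same_card_bij) (use assms in \<open>auto simp: enumerated_by_def\<close>)
  then obtain h where h: "\<And>n. bij_betw (h n) (?L n) (?L' n)" by metis
  define \<phi> where "\<phi> x = h (w x) x" for x
  have mem: "\<phi> x \<in> S'" "w' (\<phi> x) = w x" if "x \<in> S" for x
    using bij_betwE[OF h[of "w x"]] that by (auto simp: \<phi>_def)
  have "inj_on \<phi> S"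
  proof (rule inj_onI)
    fix x y assume xy: "x \<in> S" "y \<in> S" "\<phi> x = \<phi> y"
    then have "w x = w y" using mem(2) by metis
    then show "x = y"
      using xy inj_onD[OF bij_betw_imp_inj_on[OF h[of "w x"]], of x y] by (simp add: \<phi>_def)
  qed
  moreover have "S' \<subseteq> \<phi> ` S"
  proof
    fix y assume "y \<in> S'"
    then have "y \<in> h (w' y) ` ?L (w' y)" using bij_betw_imp_surj_on[OF h[of "w' y"]] by simp
    then obtain x where "x \<in> S" "y = \<phi> x" by (auto simp: \<phi>_def)
    then show "y \<in> \<phi> ` S" by blast
  qed
  ultimately have "bij_betw \<phi> S S'"
    using mem(1) by (auto simp: bij_betw_def)
  then show ?thesis using mem(2) by blast
qed

theorem theorem3:
  fixes m :: nat and r q :: "int \<Rightarrow> int fps"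
  assumes "m \<ge> 3" and "series_system m r q"
  shows "(\<exists>\<phi> \<psi>.
            bij_betw \<phi> (enriched_trees m) (matched_trees m) \<and>
            (\<forall>x\<in>enriched_trees m. black_nodes (fst (\<phi> x)) = black_nodes (fst x)) \<and>
            bij_betw \<psi> (matched_trees m) (rooted_maps m) \<and>
            (\<forall>y\<in>matched_trees m. black_vertices (\<psi> y) = black_nodes (fst y))) \<and>
         enumerated_by (enriched_trees m) (\<lambda>x. black_nodes (fst x)) (r 1) \<and>
         enumerated_by (matched_trees m) (\<lambda>y. black_nodes (fst y)) (r 1) \<and>
         enumerated_by (rooted_maps m) black_vertices (r 1)"
proof -
  have e: "enumerated_by (enriched_trees m) (\<lambda>x. black_nodes (fst x)) (r 1)"
    and t: "enumerated_by (matched_trees m) (\<lambda>y. black_nodes (fst y)) (r 1)"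
    and g: "enumerated_by (rooted_maps m) black_vertices (r 1)"
    using enumerated_by_enriched_trees[OF assms] enumerated_by_matched_trees[OF assms]
      enumerated_by_rooted_maps[OF assms] by blast+
  show ?thesis
    using enumerated_by_same_series[OF e t] enumerated_by_same_series[OF t g] e t g by blast
qed

end
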